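(* Let $c>0$, $d<0$, let $\gamma:\mathbb R\to\mathbb R$ be $1$-periodic and $C^2$, and consider the system $$\ddot\psi=4\left(c^2\sin\psi+\varepsilon\gamma(t)z\right),\qquad \dot z=\varepsilon\gamma(t)\dot\psi.\qquad( * )$$ Suppose that there is an $\alpha_0\in\mathbb R$ such that $$\int_{-\infty}^\infty\gamma(t+\alpha_0)\,\mathrm{sech}(2ct)\,dt=0\quad\text{and}\quad\int_{-\infty}^\infty\dot\gamma(t+\alpha_0)\,\mathrm{sech}(2ct)\,dt\ne0 .$$ Then there is a $\delta>0$ such that for any $0\ne\varepsilon\in(-\delta,\delta)$ there are precisely four bounded solutions of $( * )$ (defined on $\mathbb R$) on the level set $\frac{\dot\psi^2}{2}-4c^2(1-\cos\psi)-2z^2=d$ of the form $$(\psi(t),z(t))=\Big(\pi+2\sigma_1\arctan\left(\sinh(2c(t-\alpha_0))\right),\ \sigma_2\sqrt{\tfrac{-d}{2}}\Big)+O(\varepsilon),\qquad \sigma_1,\sigma_2\in\{+1,-1\},$$ one for each choice of the signs $(\sigma_1,\sigma_2)$. Explicitly: for every sufficiently large $C>0$ there is $\delta>0$ such that for $0<|\varepsilon|<\delta$ and each choice of $(\sigma_1,\sigma_2)$ there is exactly one solution on $\mathbb R$ on this level set whose distance, uniformly in $t\in\mathbb R$, from the displayed leading term is at most $C|\varepsilon|$.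
   Context: Along every solution of $( * )$ the quantity $\frac{\dot\psi^2}{2}-4c^2(1-\cos\psi)-2z^2$ is constant; the number $d$ is the fixed value of this first integral. The functions $\pi\pm2\arctan(\sinh(2ct))$ are heteroclinic solutions of $\ddot\psi=4c^2\sin\psi$ connecting the saddles $0$ and $2\pi$. *)

theory Defs
  imports "HOL-Analysis.Analysis"
begin

definition sech :: "real \<Rightarrow> real" where
  "sech x = 1 / cosh x"

definition C2_real :: "(real \<Rightarrow> real) \<Rightarrow> bool" where
  "C2_real g \<longleftrightarrow>
     (\<forall>t. g differentiable at t) \<and> (\<forall>t. deriv g differentiable at t) \<and>
     continuous_on UNIV (deriv (deriv g))"

text \<open>Solutions defined on the whole real line. The clause on \<open>deriv \<psi>\<close> says that the
  second derivative of \<open>\<psi>\<close> exists and has the required value.\<close>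

definition global_solution ::
    "real \<Rightarrow> (real \<Rightarrow> real) \<Rightarrow> real \<Rightarrow> (real \<Rightarrow> real) \<times> (real \<Rightarrow> real) \<Rightarrow> bool" where
  "global_solution c \<gamma> \<epsilon> = (\<lambda>(\<psi>, z). \<forall>t.
     \<psi> differentiable at t \<and>
     (deriv \<psi> has_real_derivative 4 * (c\<^sup>2 * sin (\<psi> t) + \<epsilon> * \<gamma> t * z t)) (at t) \<and>
     (z has_real_derivative \<epsilon> * \<gamma> t * deriv \<psi> t) (at t))"

definition on_level_set ::
    "real \<Rightarrow> real \<Rightarrow> (real \<Rightarrow> real) \<times> (real \<Rightarrow> real) \<Rightarrow> bool" where
  "on_level_set c d = (\<lambda>(\<psi>, z). \<forall>t.
     (deriv \<psi> t)\<^sup>2 / 2 - 4 * c\<^sup>2 * (1 - cos (\<psi> t)) - 2 * (z t)\<^sup>2 = d)"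

text \<open>Boundedness in the phase space with coordinates \<open>\<psi>\<close>, its derivative and \<open>z\<close>;
  the angle \<open>\<psi>\<close> is real-valued and not taken modulo \<open>2 * pi\<close>.\<close>

definition bounded_solution :: "(real \<Rightarrow> real) \<times> (real \<Rightarrow> real) \<Rightarrow> bool" where
  "bounded_solution = (\<lambda>(\<psi>, z). bounded (range (\<lambda>t. (\<psi> t, deriv \<psi> t, z t))))"

definition leading_term ::
    "real \<Rightarrow> real \<Rightarrow> real \<Rightarrow> real \<Rightarrow> real \<Rightarrow> real \<Rightarrow> real \<times> real" where
  "leading_term c d \<alpha> \<sigma>1 \<sigma>2 t =
     (pi + 2 * \<sigma>1 * arctan (sinh (2 * c * (t - \<alpha>))), \<sigma>2 * sqrt (- d / 2))"

definition uniformly_within ::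
    "real \<Rightarrow> (real \<Rightarrow> real \<times> real) \<Rightarrow> (real \<Rightarrow> real) \<times> (real \<Rightarrow> real) \<Rightarrow> bool" where
  "uniformly_within r p = (\<lambda>(\<psi>, z). \<forall>t. dist (\<psi> t, z t) (p t) \<le> r)"

end

theory Submission
  imports Defs "HOL-Library.Periodic_Fun"
begin

text \<open>
  With \<open>k = 2 * c\<close> the energy \<open>\<psi>'\<^sup>2 / 2 - k\<^sup>2 * (1 - cos \<psi>)\<close> factors, and \<open>\<psi>' = 2 * k * \<sigma> * sin (\<psi> / 2)\<close>
  on the unperturbed heteroclinic orbit. Writing \<open>\<psi> = \<psi>0 + \<epsilon> * v\<close>,
  \<open>\<psi>' = 2 * k * \<sigma> * sin (\<psi> / 2) + \<epsilon> * y\<close> and \<open>z = z0 + \<epsilon> * w\<close> therefore decouples the linear part into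
  two first-order equations, \<open>v' + k * tanh (k * t) * v = y\<close> and \<open>y' - k * tanh (k * t) * y = 4 * z0 * g\<close>;
  the level set determines \<open>w\<close> from \<open>v\<close> and \<open>y\<close>. The first equation has, for bounded \<open>y\<close>, a one-parameter
  family of bounded solutions (add \<open>a * sech (k * t)\<close>); the second has a bounded solution only if its
  right-hand side is orthogonal to \<open>sech (k * t)\<close>, and then just one. The vanishing Melnikov integral solves
  this condition at leading order. At the next order it is an affine equation for \<open>a\<close>
  whose slope is a nonzero multiple of the integral of \<open>g'\<close> against \<open>sech\<close>, so the full system is a
      fixed-point
  equation for \<open>a\<close> and three remainder functions. It is a contraction for small \<open>\<epsilon>\<close> on every ball, and
  a solution within \<open>C * \<bar>\<epsilon>\<bar>\<close> of the leading term gives a fixed point in a ball whose radius depends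
      only on \<open>C\<close>.
\<close>

text \<open>Solving the orthogonality condition for \<open>a\<close> makes \<open>a\<close> respond
  at order one to the corrections of \<open>v\<close> and \<open>w\<close>. These respond at order
  one to the correction of \<open>y\<close>, and only the correction of \<open>y\<close> carries a
  factor \<epsilon>. Plain iteration in the sup norm therefore need not contract. Giving each of
  these three links one factor \<eta> cures this, so the working parameter is the cube root \<eta>
  of |\<epsilon>|, with the sign kept apart. The equation for \<open>z\<close> has no decay:
  integrating it would leave a free constant and require a bound over infinite time. This is why
  \<open>w\<close> is taken algebraically from the level set; the differential equation for
  \<open>z\<close> is recovered afterwards on the branch where \<open>z\<close> has the sign of
  \<open>z0\<close>. For uniqueness, closeness in \<psi> and \<open>z\<close> alone says nothing
  about the derivative of \<psi>, hence nothing about \<open>y\<close>. A bound for \<open>y\<close>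
  is first obtained by interpolating between \<psi> and its second derivative.\<close>

section \<open>The hyperbolic secant and its integrals\<close>

lemma has_real_derivative_sech [derivative_intros]:
  assumes "(f has_real_derivative f') (at x within A)"
  shows "((\<lambda>x. sech (f x)) has_real_derivative - (tanh (f x) * sech (f x)) * f') (at x within A)"
proof -
  have "((\<lambda>x. 1 / cosh (f x)) has_real_derivative - (tanh (f x) * sech (f x)) * f') (at x within A)"
    by (auto intro!: derivative_eq_intros assms simp: sech_def tanh_def power2_eq_square field_simps)
  then show ?thesis
    by (simp add: sech_def [abs_def])
qed

lemma continuous_on_sech [continuous_intros]:
  "continuous_on A f \<Longrightarrow> continuous_on A (\<lambda>x. sech (f x))"
  unfolding sech_def by (auto intro!: continuous_intros)

lemma sech_pos: "sech x > 0"
  by (simp add: sech_def)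

lemma sech_nonneg [simp]: "sech x \<ge> 0"
  using sech_pos [of x] by simp

lemma sech_nz [simp]: "sech x \<noteq> 0"
  using sech_pos [of x] by simp

lemma sech_0 [simp]: "sech 0 = 1"
  by (simp add: sech_def)

lemma sech_times_cosh [simp]: "sech x * cosh x = 1" "cosh x * sech x = 1"
  by (simp_all add: sech_def)

lemma sech_le_1: "sech x \<le> 1"
  using cosh_real_ge_1 [of x] by (simp add: sech_def)

lemma sech_minus [simp]: "sech (- x) = sech x"
  by (simp add: sech_def)

text \<open>Used at \<open>x\<close> and, by evenness, at \<open>- x\<close>, this supplies the
  exponential decay of \<open>sech\<close> at both ends.\<close>

lemma sech_le_exp: "sech x \<le> 2 * exp x"
proof -
  have "1 \<le> exp x * exp x + exp x * exp (- x)"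
    by (simp flip: exp_add)
  then have "1 \<le> 2 * exp x * cosh x"
    by (simp add: cosh_def algebra_simps)
  then show ?thesis
    by (simp add: sech_def divide_le_eq)
qed

lemma sech_tendsto_0:
  assumes "k > 0"
  shows "((\<lambda>t. sech (k * t)) \<longlongrightarrow> 0) at_top" "((\<lambda>t. sech (k * t)) \<longlongrightarrow> 0) at_bot"
proof -
  have "filterlim (\<lambda>t. cosh (k * t)) at_top at_top"
    using assms by (intro filterlim_compose [OF cosh_real_at_top] filterlim_tendsto_pos_mult_at_top
        filterlim_ident) auto
  then show "((\<lambda>t. sech (k * t)) \<longlongrightarrow> 0) at_top"
    unfolding sech_def by (rule real_tendsto_divide_at_top [OF tendsto_const])
  then show "((\<lambda>t. sech (k * t)) \<longlongrightarrow> 0) at_bot"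
    by (simp add: filterlim_at_bot_mirror)
qed

lemma has_real_derivative_arctan_sinh:
  "((\<lambda>t. arctan (sinh (k * t))) has_real_derivative k * sech (k * t)) (at t)"
proof -
  have "1 + (sinh (k * t))\<^sup>2 = (cosh (k * t))\<^sup>2"
    by (simp add: cosh_square_eq)
  then have "inverse (1 + (sinh (k * t))\<^sup>2) * (cosh (k * t) * k) = k * sech (k * t)"
    by (simp add: sech_def power2_eq_square divide_simps)
  moreover have "((\<lambda>t. arctan (sinh (k * t))) has_real_derivative
      inverse (1 + (sinh (k * t))\<^sup>2) * (cosh (k * t) * k)) (at t)"
    by (intro DERIV_chain2 [OF DERIV_arctan]) (auto intro!: derivative_eq_intros)
  ultimately show ?thesis
    by metis
qed

lemma one_minus_tanh_square: "1 - (tanh x)\<^sup>2 = sech x * sech x"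
proof -
  have "(sinh x)\<^sup>2 / (cosh x)\<^sup>2 = 1 - 1 / (cosh x)\<^sup>2"
    by (simp add: sinh_square_eq diff_divide_distrib)
  then show ?thesis
    by (simp add: tanh_def sech_def power_divide power2_eq_square)
qed

text \<open>The antiderivative is the Gudermannian function up to scaling. The integrand is
  positive, so its finite limits at both ends give integrability and the value together.\<close>

lemma integrable_sech:
  assumes "k > 0"
  shows "integrable lborel (\<lambda>t. sech (k * t))" and integral_sech: "(LINT t|lborel. sech (k * t)) = pi / k"
proof -
  define F where "F t = arctan (sinh (k * t)) / k" for t
  have top: "filterlim (\<lambda>t. sinh (k * t)) at_top at_top"
    using assms by (intro filterlim_compose [OF sinh_real_at_top] filterlim_tendsto_pos_mult_at_top
        filterlim_ident) auto
  then have bot: "filterlim (\<lambda>t. sinh (k * t)) at_bot at_bot"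
    by (simp add: filterlim_at_bot_mirror filterlim_uminus_at_bot)
  have deriv: "DERIV F x :> sech (k * x)" for x
    using DERIV_cdivide [OF has_real_derivative_arctan_sinh [of k x], of k] assms by (simp add: F_def
        [abs_def])
  have cont: "isCont (\<lambda>t. sech (k * t)) x" for x
    by (intro continuous_on_interior [of UNIV] continuous_intros) auto
  have lim_bot: "((F \<circ> real_of_ereal) \<longlongrightarrow> - (pi / 2) / k) (at_right (- \<infinity>))"
    unfolding ereal_tendsto_simps F_def using assms
    by (intro tendsto_divide tendsto_const filterlim_compose [OF tendsto_arctan_at_bot bot]) auto
  have lim_top: "((F \<circ> real_of_ereal) \<longlongrightarrow> (pi / 2) / k) (at_left \<infinity>)"
    unfolding ereal_tendsto_simps F_def using assms
    by (intro tendsto_divide tendsto_const filterlim_compose [OF tendsto_arctan_at_top top]) auto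
  have "set_integrable lborel (einterval (- \<infinity>) \<infinity>) (\<lambda>t. sech (k * t))"
    and "(LBINT t=-\<infinity>..\<infinity>. sech (k * t)) = (pi / 2) / k - (- (pi / 2) / k)"
    by (rule interval_integral_FTC_nonneg [OF _ deriv cont _ lim_bot lim_top];
        auto intro: less_imp_le sech_pos)+
  then show "integrable lborel (\<lambda>t. sech (k * t))" "(LINT t|lborel. sech (k * t)) = pi / k"
    by (simp_all add: set_integrable_def interval_lebesgue_integral_def set_lebesgue_integral_def)
qed

lemma integrable_sech_mult:
  assumes "k > 0" "continuous_on UNIV f" "\<And>t. \<bar>f t\<bar> \<le> B"
  shows "integrable lborel (\<lambda>t. sech (k * t) * f t)"
proof (rule Bochner_Integration.integrable_bound)
  show "integrable lborel (\<lambda>t. sech (k * t) * B)"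
    using integrable_sech [OF assms(1)] by simp
  show "(\<lambda>t. sech (k * t) * f t) \<in> borel_measurable lborel"
    using assms(2) by (simp, intro borel_measurable_continuous_onI continuous_intros)
  show "AE t in lborel. norm (sech (k * t) * f t) \<le> norm (sech (k * t) * B)"
    using assms(3) sech_pos by (auto simp: abs_mult intro!: mult_left_mono order_trans [OF assms(3)])
qed

section \<open>Integrals over left half-lines\<close>

definition lower_integral :: "(real \<Rightarrow> real) \<Rightarrow> real \<Rightarrow> real" where
  "lower_integral f t = (LINT s:{..t}|lborel. f s)"

context
  fixes f :: "real \<Rightarrow> real"
  assumes cont: "continuous_on UNIV f" and int: "integrable lborel f"
begin

lemma lower_integral_deriv: "(lower_integral f has_real_derivative f t) (at t)"
proof -
  \<comment> \<open>The base point \<open>t - 1\<close> confines the moving endpoint to a compact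
    interval, where the fundamental theorem applies.\<close>
  have *: "lower_integral f u = lower_integral f (t - 1) + (LBINT s=t - 1..u. f s)" if "u > t - 1" for u
  proof -
    have s: "set_integrable lborel A f" if "A \<in> sets lborel" for A
      unfolding set_integrable_def by (intro integrable_mult_indicator int that)
    have "{..u} = {..t - 1} \<union> {t - 1<..u}"
      using that by auto
    then have "lower_integral f u = lower_integral f (t - 1) + (LINT s:{t - 1<..u}|lborel. f s)"
      unfolding lower_integral_def
      by (simp only:) (rule set_integral_Un, auto intro: s)
    then show ?thesis
      using that by (simp add: interval_integral_Ioc)
  qed
  have "((\<lambda>u. LBINT s=t - 1..u. f s) has_vector_derivative f t) (at t within {t - 1..t + 1})"
    by (rule interval_integral_FTC2) (auto intro: continuous_on_subset [OF cont])
  then have "((\<lambda>u. LBINT s=t - 1..u. f s) has_vector_derivative f t) (at t within {t - 1<..<t + 1})"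
    by (rule has_vector_derivative_within_subset) auto
  then have "((\<lambda>u. LBINT s=t - 1..u. f s) has_real_derivative f t) (at t)"
    unfolding has_real_derivative_iff_has_vector_derivative
    by (subst (asm) has_vector_derivative_within_open) auto
  then have "((\<lambda>u. lower_integral f (t - 1) + (LBINT s=t - 1..u. f s)) has_real_derivative f t) (at t)"
    by (auto intro!: derivative_eq_intros)
  then show ?thesis
    by (rule has_field_derivative_transform_within [where d = 1]) (auto simp: * dist_real_def)
qed

lemma lower_integral_at_top: "(lower_integral f \<longlongrightarrow> (LINT s|lborel. f s)) at_top"
  using tendsto_integral_at_top [of lborel f] int
  unfolding lower_integral_def set_lebesgue_integral_def by simp

lemma lower_integral_at_bot: "(lower_integral f \<longlongrightarrow> 0) at_bot"
proof -
  have "((\<lambda>y. LINT x|lborel. indicator {..- y} x *\<^sub>R f x) \<longlongrightarrow> (LINT x::real|lborel. 0)) at_top"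
  proof (rule integral_dominated_convergence_at_top [where w = "\<lambda>x. norm (f x)"])
    show "AE x in lborel. ((\<lambda>y. indicator {..- y} x *\<^sub>R f x) \<longlongrightarrow> 0) at_top"
    proof (rule AE_I2)
      fix x
      have "\<forall>\<^sub>F y in at_top. indicator {..- y} x *\<^sub>R f x = 0"
        using eventually_gt_at_top [of "- x"] by eventually_elim (auto simp: indicator_def)
      then show "((\<lambda>y. indicator {..- y} x *\<^sub>R f x) \<longlongrightarrow> 0) at_top"
        by (rule tendsto_eventually)
    qed
    show "\<forall>\<^sub>F y in at_top. AE x in lborel. norm (indicator {..- y} x *\<^sub>R f x) \<le> norm (f x)"
      by (intro always_eventually allI AE_I2) (simp add: indicator_def)
    show "(\<lambda>x. indicator {..- y} x *\<^sub>R f x) \<in> borel_measurable lborel" for y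
      using borel_measurable_integrable [OF int] by measurable
  qed (use int in auto)
  then show ?thesis
    unfolding filterlim_at_bot_mirror lower_integral_def set_lebesgue_integral_def by simp
qed

end

section \<open>The two first-order linear equations\<close>

text \<open>The bound is an explicit argument, so that norms of the solution operators can be stated
  and later used uniformly in all parameters.\<close>

definition bdd_cont :: "real \<Rightarrow> (real \<Rightarrow> real) \<Rightarrow> bool" where
  "bdd_cont B f \<longleftrightarrow> continuous_on UNIV f \<and> (\<forall>t. \<bar>f t\<bar> \<le> B)"

lemma bdd_contD: "bdd_cont B f \<Longrightarrow> continuous_on UNIV f" "bdd_cont B f \<Longrightarrow> \<bar>f t\<bar> \<le> B"
  by (auto simp: bdd_cont_def)

lemma bdd_cont_lincomb: "bdd_cont B f \<Longrightarrow> bdd_cont C g \<Longrightarrow> bdd_cont (\<bar>a\<bar> * B + \<bar>b\<bar> * C) (\<lambda>t. a * f t + b * g t)"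
  unfolding bdd_cont_def
  by (auto intro!: continuous_intros order_trans [OF abs_triangle_ineq] add_mono mult_left_mono simp:
      abs_mult)

text \<open>Comparison through derivatives: tail estimates follow from monotonicity and a limit at
  infinity, without integrating inequalities.\<close>

lemma nonneg_of_limit_at_bot:
  fixes D :: "real \<Rightarrow> real"
  assumes "\<And>t. (D has_real_derivative D' t) (at t)" "\<And>t. D' t \<ge> 0" "(D \<longlongrightarrow> 0) at_bot"
  shows "D t \<ge> 0"
proof (rule tendsto_upperbound [OF assms(3)])
  have "D s \<le> D t" if "s \<le> t" for s
    using that by (rule DERIV_nonneg_imp_nondecreasing) (use assms in blast)
  then show "\<forall>\<^sub>F s in at_bot. D s \<le> D t"
    using eventually_le_at_bot by (rule eventually_mono [rotated])
qed simp

lemma nonneg_of_limit_at_top: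
  fixes D :: "real \<Rightarrow> real"
  assumes "\<And>t. (D has_real_derivative D' t) (at t)" "\<And>t. D' t \<le> 0" "(D \<longlongrightarrow> 0) at_top"
  shows "D t \<ge> 0"
proof -
  have "((\<lambda>t. D (- t)) has_real_derivative - D' (- t)) (at t)" for t
    using DERIV_chain2 [where f = D, OF assms(1) DERIV_minus [OF DERIV_ident]] by simp
  moreover have "((\<lambda>t. D (- t)) \<longlongrightarrow> 0) at_bot"
    using assms(3) by (simp add: filterlim_at_bot_mirror)
  ultimately have "D (- (- t)) \<ge> 0"
    using assms(2) by (intro nonneg_of_limit_at_bot [of "\<lambda>t. D (- t)" "\<lambda>t. - D' (- t)"]) auto
  then show ?thesis by simp
qed

locale saddle =
  fixes k :: real
  assumes k_pos: "k > 0"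
begin

definition pairing :: "(real \<Rightarrow> real) \<Rightarrow> real" where
  "pairing f = (LINT t|lborel. sech (k * t) * f t)"

text \<open>\<open>fwd f\<close> solves \<open>v' + k * tanh (k * t) * v = f\<close> with \<open>v 0 = 0\<close>. \<open>bwd f\<close> is the bounded solution of
  \<open>y' - k * tanh (k * t) * y = f - m\<close>, where the constant \<open>m\<close> makes the right-hand side orthogonal to
  \<open>sech (k * t)\<close>; without it there would be none.\<close>

definition fwd :: "(real \<Rightarrow> real) \<Rightarrow> real \<Rightarrow> real" where
  "fwd f t = sech (k * t) * (LBINT s=0..t. cosh (k * s) * f s)"

definition bwd :: "(real \<Rightarrow> real) \<Rightarrow> real \<Rightarrow> real" where
  "bwd f t = cosh (k * t) * lower_integral (\<lambda>s. sech (k * s) * (f s - k / pi * pairing f)) t"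

lemma sech_bdd_cont_integrable: "bdd_cont B f \<Longrightarrow> integrable lborel (\<lambda>t. sech (k * t) * f t)"
  using integrable_sech_mult [OF k_pos] by (auto simp: bdd_cont_def)

lemma continuous_on_sech_mult: "bdd_cont B f \<Longrightarrow> continuous_on UNIV (\<lambda>t. sech (k * t) * f t)"
  by (auto simp: bdd_cont_def intro!: continuous_intros)

lemma pairing_lincomb:
  assumes "bdd_cont B f" "bdd_cont C g"
  shows "pairing (\<lambda>t. a * f t + b * g t) = a * pairing f + b * pairing g"
proof -
  have "pairing (\<lambda>t. a * f t + b * g t) = (LINT t|lborel. a * (sech (k * t) * f t) + b * (sech (k * t)
      * g t))"
    unfolding pairing_def by (simp add: algebra_simps)
  also have "\<dots> = a * pairing f + b * pairing g"
    unfolding pairing_def using sech_bdd_cont_integrable assms by simp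
  finally show ?thesis .
qed

lemma pairing_const: "pairing (\<lambda>t. a) = a * pi / k"
  using integral_sech [OF k_pos] integrable_sech [OF k_pos] by (simp add: pairing_def)

lemma pairing_bound: 
  assumes "bdd_cont B f" shows "\<bar>pairing f\<bar> \<le> B * pi / k"
proof -
  have "norm (LINT t|lborel. sech (k * t) * f t) \<le> (LINT t|lborel. sech (k * t) * B)"
    using integrable_sech [OF k_pos] integrable_norm [OF sech_bdd_cont_integrable [OF assms]]
        bdd_contD(2) [OF assms]
    by (intro integral_norm_bound [THEN order_trans] integral_mono) (auto simp: abs_mult intro!: mult_mono)
  then show ?thesis
    using integral_sech [OF k_pos] by (simp add: pairing_def mult.commute)
qed

text \<open>The bound is the integral of the majorant \<open>2 * B * exp (k * s)\<close> up to
  \<open>t\<close>; at the other end the mirrored majorant is integrated from \<open>t\<close>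
  on.\<close>

lemma lower_integral_sech_bounds:
  assumes "bdd_cont B f"
  defines "\<Phi> \<equiv> lower_integral (\<lambda>s. sech (k * s) * f s)"
  shows "\<bar>\<Phi> t\<bar> \<le> 2 * B / k * exp (k * t)" "\<bar>pairing f - \<Phi> t\<bar> \<le> 2 * B / k * exp (- k * t)"
proof -
  note int = continuous_on_sech_mult [OF assms(1)] sech_bdd_cont_integrable [OF assms(1)]
  have d: "(\<Phi> has_real_derivative sech (k * t) * f t) (at t)" for t
    unfolding \<Phi>_def by (rule lower_integral_deriv [OF int])
  have bd: "\<bar>sech (k * t) * f t\<bar> \<le> 2 * exp (k * t) * B" "\<bar>sech (k * t) * f t\<bar> \<le> 2 * exp (- k * t) * B" for t
    using sech_le_exp [of "k * t"] sech_le_exp [of "- (k * t)"] bdd_contD(2) [OF assms(1), of t]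
        sech_pos [of "k * t"]
    by (auto simp: abs_mult intro!: mult_mono)
  have e: "((\<lambda>t. exp (- k * t)) \<longlongrightarrow> 0) at_top"
    using k_pos by (intro filterlim_compose [OF exp_at_bot] filterlim_tendsto_neg_mult_at_bot [OF
        tendsto_const] filterlim_ident) auto
  then have e': "((\<lambda>t. exp (k * t)) \<longlongrightarrow> 0) at_bot"
    by (simp add: filterlim_at_bot_mirror)
  have t: "(\<Phi> \<longlongrightarrow> pairing f) at_top" and b: "(\<Phi> \<longlongrightarrow> 0) at_bot"
    unfolding \<Phi>_def pairing_def by (rule lower_integral_at_top [OF int] lower_integral_at_bot [OF int])+
  \<comment> \<open>The sign \<open>s\<close> produces both halves of the absolute value from one
    argument.\<close>
  have A: "2 * B / k * exp (k * t) + s * \<Phi> t \<ge> 0" if "\<bar>s\<bar> = 1" for s t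
  proof (rule nonneg_of_limit_at_bot [where D = "\<lambda>t. 2 * B / k * exp (k * t) + s * \<Phi> t"
        and D' = "\<lambda>t. 2 * exp (k * t) * B + s * (sech (k * t) * f t)"])
    show "((\<lambda>t. 2 * B / k * exp (k * t) + s * \<Phi> t) has_real_derivative 2 * exp (k * t) * B + s * (sech
        (k * t) * f t)) (at t)" for t
      using k_pos by (auto intro!: derivative_eq_intros d)
    show "2 * exp (k * t) * B + s * (sech (k * t) * f t) \<ge> 0" for t
      using bd(1) [of t] that by (auto simp: abs_if split: if_splits)
    show "((\<lambda>t. 2 * B / k * exp (k * t) + s * \<Phi> t) \<longlongrightarrow> 0) at_bot"
      using tendsto_add [OF tendsto_mult_left [OF e', of "2 * B / k"] tendsto_mult_left [OF b, of s]] by simp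
  qed
  show "\<bar>\<Phi> t\<bar> \<le> 2 * B / k * exp (k * t)"
    using A [of 1 t] A [of "- 1" t] by (simp add: abs_le_iff)
  have A: "2 * B / k * exp (- k * t) + s * (pairing f - \<Phi> t) \<ge> 0" if "\<bar>s\<bar> = 1" for s t
  proof (rule nonneg_of_limit_at_top [where D = "\<lambda>t. 2 * B / k * exp (- k * t) + s * (pairing f - \<Phi> t)"
        and D' = "\<lambda>t. - (2 * exp (- k * t) * B) - s * (sech (k * t) * f t)"])
    show "((\<lambda>t. 2 * B / k * exp (- k * t) + s * (pairing f - \<Phi> t)) has_real_derivative - (2 * exp (- k
        * t) * B) - s * (sech (k * t) * f t)) (at t)" for t
      using k_pos by (auto intro!: derivative_eq_intros d)
    show "- (2 * exp (- k * t) * B) - s * (sech (k * t) * f t) \<le> 0" for t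
      using bd(2) [of t] that by (auto simp: abs_if split: if_splits)
    show "((\<lambda>t. 2 * B / k * exp (- k * t) + s * (pairing f - \<Phi> t)) \<longlongrightarrow> 0) at_top"
      using tendsto_add [OF tendsto_mult_left [OF e, of "2 * B / k"]
        tendsto_mult_left [OF tendsto_diff [OF tendsto_const t, of "pairing f"], of s]] by simp
  qed
  show "\<bar>pairing f - \<Phi> t\<bar> \<le> 2 * B / k * exp (- k * t)"
    using A [of 1 t] A [of "- 1" t] by (simp add: abs_le_iff)
qed

lemma fwd_deriv:
  assumes "continuous_on UNIV f"
  shows "(fwd f has_real_derivative f t - k * tanh (k * t) * fwd f t) (at t)"
proof -
  define I where "I t = (LBINT s=0..t. cosh (k * s) * f s)" for t :: real
  define m where "m = \<bar>t\<bar> + 1"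
  have "(I has_vector_derivative cosh (k * t) * f t) (at t within {-m..m})"
    unfolding I_def zero_ereal_def 
    by (rule interval_integral_FTC2) (auto simp: m_def intro!: continuous_intros continuous_on_subset
        [OF assms])
  then have "(I has_vector_derivative cosh (k * t) * f t) (at t within {-m<..<m})"
    by (rule has_vector_derivative_within_subset) auto
  then have "(I has_real_derivative cosh (k * t) * f t) (at t)"
    unfolding has_real_derivative_iff_has_vector_derivative
    by (subst (asm) has_vector_derivative_within_open) (auto simp: m_def)
  moreover have "fwd f = (\<lambda>t. sech (k * t) * I t)"
    by (simp add: fun_eq_iff fwd_def I_def)
  moreover have "sech (k * t) * (cosh (k * t) * f t) = f t"
    by (simp flip: mult.assoc)
  ultimately show ?thesis
    by (auto intro!: derivative_eq_intros simp: algebra_simps)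
qed

lemma fwd_0 [simp]: "fwd f 0 = 0"
  unfolding fwd_def zero_ereal_def [symmetric] by simp

lemma const_of_deriv_0:
  fixes F :: "real \<Rightarrow> real"
  assumes "\<And>t. (F has_real_derivative 0) (at t)"
  shows "F t = F s"
  using DERIV_isconst_all assms by blast

text \<open>Multiplication by \<open>cosh (k * t)\<close> makes the difference of two solutions
  constant, so the homogeneous solutions are the multiples of \<open>sech (k * t)\<close>.\<close>

lemma fwd_unique:
  assumes "continuous_on UNIV f" "\<And>t. (v has_real_derivative f t - k * tanh (k * t) * v t) (at t)"
  shows "v t = v 0 * sech (k * t) + fwd f t"
proof -
  have "((\<lambda>t. cosh (k * t) * (v t - fwd f t)) has_real_derivative 0) (at t)" for t
    using assms(2) fwd_deriv [OF assms(1)] k_pos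
    by (auto intro!: derivative_eq_intros simp: tanh_def field_simps)
  from const_of_deriv_0 [OF this, of t 0] have "cosh (k * t) * (v t - fwd f t) = v 0"
    by simp
  then show ?thesis
    by (simp add: sech_def field_simps)
qed

lemma fwd_lincomb:
  assumes "continuous_on UNIV f" "continuous_on UNIV g"
  shows "fwd (\<lambda>t. a * f t + b * g t) t = a * fwd f t + b * fwd g t"
proof -
  have "a * fwd f t + b * fwd g t = (a * fwd f 0 + b * fwd g 0) * sech (k * t) + fwd (\<lambda>t. a * f t + b
      * g t) t"
    by (rule fwd_unique) (use assms in \<open>auto intro!: continuous_intros derivative_eq_intros fwd_deriv
        simp: algebra_simps\<close>)
  then show ?thesis by simp
qed

lemma fwd_bound:
  assumes "bdd_cont B f"
  shows "\<bar>fwd f t\<bar> \<le> B / k"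
proof -
  \<comment> \<open>Each \<open>D s\<close> is nondecreasing and vanishes at 0. This dominates the
    integral in \<open>fwd\<close> by \<open>B / k * |sinh (k * t)|\<close> on both sides of 0, and
    the quotient of \<open>sinh\<close> by \<open>cosh\<close> is at most 1 in absolute
    value.\<close>
  define D where "D s t = cosh (k * t) * (s * fwd f t) + B / k * sinh (k * t)" for s t
  have D0: "D s 0 = 0" for s
    by (simp add: D_def)
  have dD: "(D s has_real_derivative cosh (k * t) * (B + s * f t)) (at t)" for s t
    unfolding D_def using k_pos
    by (auto intro!: derivative_eq_intros fwd_deriv bdd_contD [OF assms] simp: tanh_def field_simps)
  have nn: "cosh (k * t) * (B + s * f t) \<ge> 0" if "\<bar>s\<bar> = 1" for s t
    using bdd_contD(2) [OF assms, of t] that by (auto simp: abs_if split: if_splits)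
  have mono: "D s x \<le> D s y" if "x \<le> y" "\<bar>s\<bar> = 1" for x y s
    using that(1) by (rule DERIV_nonneg_imp_nondecreasing) (use dD nn that(2) in blast)
  have B: "B \<ge> 0"
    using bdd_contD(2) [OF assms, of 0] by linarith
  have "cosh (k * t) * \<bar>fwd f t\<bar> \<le> B / k * \<bar>sinh (k * t)\<bar>"
  proof (cases "t \<ge> 0")
    case True
    then have "sinh (k * t) \<ge> 0" using k_pos by simp
    then show ?thesis
      using mono [OF True, of 1] mono [OF True, of "-1"] D0 by (auto simp: D_def abs_if)
  next
    case False
    then have "t \<le> 0" "sinh (k * t) \<le> 0" using k_pos by (auto simp: mult_le_0_iff)
    then show ?thesis
      using mono [of t 0 1] mono [of t 0 "-1"] D0 by (auto simp: D_def abs_if)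
  qed
  also have "\<dots> \<le> B / k * cosh (k * t)"
    using B k_pos by (intro mult_left_mono) (simp_all add: sinh_def cosh_def abs_if field_simps
        add_increasing)
  finally have "cosh (k * t) * \<bar>fwd f t\<bar> \<le> cosh (k * t) * (B / k)"
    by (simp add: mult.commute)
  then show ?thesis
    by (simp only: mult_le_cancel_left_pos [OF cosh_real_pos])
qed

text \<open>The mean with weight \<open>sech (k * t)\<close> is subtracted: \<open>k / pi\<close> is
  the reciprocal of the pairing with the constant 1. A mean is at most \<open>B\<close> in absolute
  value, hence the factor 2.\<close>

lemma bdd_cont_centered:
  assumes "bdd_cont B f" shows "bdd_cont (2 * B) (\<lambda>t. f t - k / pi * pairing f)" "pairing (\<lambda>t. f t - k
      / pi * pairing f) = 0"
proof -
  have c: "bdd_cont 1 (\<lambda>t. 1)"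
    by (simp add: bdd_cont_def)
  have "k / pi * \<bar>pairing f\<bar> \<le> k / pi * (B * pi / k)"
    using pairing_bound [OF assms] k_pos by (intro mult_left_mono) auto
  then have m: "\<bar>k / pi * pairing f\<bar> \<le> B"
    using k_pos by (simp add: abs_mult)
  have "\<bar>f t - k / pi * pairing f\<bar> \<le> 2 * B" for t
    using abs_triangle_ineq4 [of "f t" "k / pi * pairing f"] bdd_contD(2) [OF assms, of t] m
    by (metis add_mono mult_2 order_trans)
  then show "bdd_cont (2 * B) (\<lambda>t. f t - k / pi * pairing f)"
    unfolding bdd_cont_def using bdd_contD(1) [OF assms] by (auto intro!: continuous_intros)
  show "pairing (\<lambda>t. f t - k / pi * pairing f) = 0"
    using pairing_lincomb [OF assms c, of 1 "- (k / pi * pairing f)"] pairing_const [of 1] k_pos by simp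
qed

lemma bwd_deriv:
  assumes "bdd_cont B f"
  shows "(bwd f has_real_derivative f t + k * tanh (k * t) * bwd f t - k / pi * pairing f) (at t)"
proof -
  define \<Phi> where "\<Phi> = lower_integral (\<lambda>s. sech (k * s) * (f s - k / pi * pairing f))"
  note c = bdd_cont_centered [OF assms]
  have "(\<Phi> has_real_derivative sech (k * t) * (f t - k / pi * pairing f)) (at t)"
    unfolding \<Phi>_def by (rule lower_integral_deriv [OF continuous_on_sech_mult [OF c(1)]
        sech_bdd_cont_integrable [OF c(1)]])
  moreover have "bwd f = (\<lambda>t. cosh (k * t) * \<Phi> t)"
    by (simp add: fun_eq_iff bwd_def \<Phi>_def)
  moreover have "cosh (k * t) * (sech (k * t) * (f t - k / pi * pairing f)) = f t - k / pi * pairing f"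
    by (simp flip: mult.assoc)
  moreover have "sinh (k * t) * \<Phi> t = tanh (k * t) * (cosh (k * t) * \<Phi> t)"
    by (simp add: tanh_def)
  ultimately show ?thesis
    by (auto intro!: derivative_eq_intros simp: algebra_simps)
qed

text \<open>After centering, the integral from the left is minus the integral from the right, so it
  decays at both ends and balances the growth of \<open>cosh\<close>.\<close>

lemma bwd_bound:
  assumes "bdd_cont B f"
  shows "\<bar>bwd f t\<bar> \<le> 4 * B / k"
proof -
  note c = bdd_cont_centered [OF assms]
  define \<Phi> where "\<Phi> = lower_integral (\<lambda>s. sech (k * s) * (f s - k / pi * pairing f))"
  have "\<bar>\<Phi> t\<bar> \<le> 2 * (2 * B) / k * exp (k * t)" "\<bar>0 - \<Phi> t\<bar> \<le> 2 * (2 * B) / k * exp (- k * t)"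
    using lower_integral_sech_bounds [OF c(1), of t] c(2) by (simp_all add: \<Phi>_def)
  then have *: "\<bar>\<Phi> t\<bar> \<le> 4 * B / k * exp (k * t)" "\<bar>\<Phi> t\<bar> \<le> 4 * B / k * exp (- (k * t))"
    by simp_all
  have "B \<ge> 0"
    using bdd_contD(2) [OF assms, of 0] by linarith
  \<comment> \<open>Each exponential in \<open>cosh\<close> is paired with the tail bound for the
    end at which it grows.\<close>
  have "cosh (k * t) * \<bar>\<Phi> t\<bar> = 1 / 2 * (exp (k * t) * \<bar>\<Phi> t\<bar>) + 1 / 2 * (exp (- (k * t)) * \<bar>\<Phi> t\<bar>)"
    by (simp add: cosh_def algebra_simps)
  also have "\<dots> \<le> 1 / 2 * (exp (k * t) * (4 * B / k * exp (- (k * t)))) + 1 / 2 * (exp (- (k * t)) * (4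
      * B / k * exp (k * t)))"
    by (intro add_mono mult_left_mono *) auto
  also have "\<dots> = 4 * B / k"
    by (simp add: exp_minus field_simps)
  finally show ?thesis
    by (simp add: bwd_def \<Phi>_def abs_mult)
qed

text \<open>With the integrating factor \<open>sech (k * t)\<close>, the product
  \<open>sech (k * t) * y t\<close> is an antiderivative of \<open>sech (k * t) * f t\<close>.
  Boundedness of \<open>y\<close> makes it vanish at both ends: the left end fixes the constant, the
  right end gives the solvability condition.\<close>

lemma bwd_unique:
  assumes f: "bdd_cont B f" and y: "\<And>t. (y has_real_derivative f t + k * tanh (k * t) * y t) (at t)"
      "\<And>t. \<bar>y t\<bar> \<le> C"
  shows "pairing f = 0" "y t = bwd f t"
proof -
  note f' = continuous_on_sech_mult [OF f] sech_bdd_cont_integrable [OF f]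
  define \<Phi> where "\<Phi> = lower_integral (\<lambda>s. sech (k * s) * f s)"
  have "(\<Phi> has_real_derivative sech (k * t) * f t) (at t)" for t
    unfolding \<Phi>_def by (rule lower_integral_deriv [OF f'])
  then have "((\<lambda>t. sech (k * t) * y t - \<Phi> t) has_real_derivative 0) (at t)" for t
    by (auto intro!: derivative_eq_intros y simp: algebra_simps)
  then obtain c where c: "sech (k * t) * y t - \<Phi> t = c" for t
    using const_of_deriv_0 [of "\<lambda>t. sech (k * t) * y t - \<Phi> t" _ 0] by blast
  have t: "(\<Phi> \<longlongrightarrow> pairing f) at_top" and b: "(\<Phi> \<longlongrightarrow> 0) at_bot"
    unfolding \<Phi>_def pairing_def by (rule lower_integral_at_top [OF f'] lower_integral_at_bot [OF f'])+
  have lim: "((\<lambda>t. sech (k * t) * y t) \<longlongrightarrow> 0) F" if "((\<lambda>t. sech (k * t)) \<longlongrightarrow> 0) F" for F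
  proof (rule Lim_null_comparison)
    show "\<forall>\<^sub>F t in F. norm (sech (k * t) * y t) \<le> sech (k * t) * C"
      using y(2) by (auto simp: abs_mult intro!: always_eventually mult_mono)
    show "((\<lambda>t. sech (k * t) * C) \<longlongrightarrow> 0) F"
      using tendsto_mult_right [OF that, of C] by simp
  qed
  have "((\<lambda>t. sech (k * t) * y t - \<Phi> t) \<longlongrightarrow> 0 - 0) at_bot"
    by (intro tendsto_diff lim b sech_tendsto_0 k_pos)
  then have c0: "c = 0"
    unfolding c by (simp add: tendsto_const_iff)
  have "((\<lambda>t. sech (k * t) * y t - \<Phi> t) \<longlongrightarrow> 0 - pairing f) at_top"
    by (intro tendsto_diff lim t sech_tendsto_0 k_pos)
  then show 0: "pairing f = 0"
    unfolding c c0 by (simp add: tendsto_const_iff)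
  have "sech (k * t) * y t = \<Phi> t"
    using c [of t] c0 by simp
  then have "cosh (k * t) * (sech (k * t) * y t) = cosh (k * t) * \<Phi> t"
    by simp
  then have "y t = cosh (k * t) * \<Phi> t"
    by (simp flip: mult.assoc)
  then show "y t = bwd f t"
    by (simp add: bwd_def \<Phi>_def 0)
qed

lemma bwd_lincomb:
  assumes "bdd_cont B f" "bdd_cont C g"
  shows "bwd (\<lambda>t. a * f t + b * g t) t = a * bwd f t + b * bwd g t"
proof -
  define m where "m f = k / pi * pairing f" for f
  \<comment> \<open>The combination of the centered functions already has pairing zero, so
    \<open>bwd h\<close> involves no further correction and uniqueness identifies it.\<close>
  define h where "h t = a * (f t - m f) + b * (g t - m g)" for t
  have h: "bdd_cont (\<bar>a\<bar> * (2 * B) + \<bar>b\<bar> * (2 * C)) h"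
    unfolding h_def m_def by (intro bdd_cont_lincomb bdd_cont_centered assms)
  have "a * bwd f t + b * bwd g t = bwd h t" 
  proof (rule bwd_unique(2) [OF h])
    show "((\<lambda>t. a * bwd f t + b * bwd g t) has_real_derivative h t + k * tanh (k * t) * (a * bwd f t +
        b * bwd g t)) (at t)" for t
      by (auto intro!: derivative_eq_intros bwd_deriv assms simp: h_def m_def algebra_simps)
    show "\<bar>a * bwd f t + b * bwd g t\<bar> \<le> \<bar>a\<bar> * (4 * B / k) + \<bar>b\<bar> * (4 * C / k)" for t
      by (intro order_trans [OF abs_triangle_ineq] add_mono) (auto simp only: abs_mult intro!:
          bwd_bound assms mult_left_mono)
  qed
  moreover have "pairing h = 0"
    unfolding h_def m_def
    using pairing_lincomb [OF bdd_cont_centered(1) [OF assms(1)] bdd_cont_centered(1) [OF assms(2)]]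
        bdd_cont_centered(2) assms by simp
  moreover have "h t - k / pi * pairing h = a * f t + b * g t - m (\<lambda>t. a * f t + b * g t)" for t
    using \<open>pairing h = 0\<close> pairing_lincomb [OF assms] by (simp add: h_def m_def algebra_simps)
  ultimately show ?thesis
    by (simp add: bwd_def m_def)
qed

end

section \<open>Uniformly Lipschitz families and a fixed-point principle\<close>

lemma bdd_cont_nonneg: "bdd_cont B f \<Longrightarrow> B \<ge> 0"
  using bdd_contD(2) [of B f 0] by linarith

lemma bdd_cont_mono: "bdd_cont B f \<Longrightarrow> B \<le> C \<Longrightarrow> bdd_cont C f"
  unfolding bdd_cont_def by (meson order_trans)

lemma bdd_cont_mult: "bdd_cont B f \<Longrightarrow> bdd_cont C g \<Longrightarrow> bdd_cont (B * C) (\<lambda>t. f t * g t)"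
  using bdd_cont_nonneg [of B f] by (auto simp: bdd_cont_def abs_mult intro!: continuous_intros mult_mono)

lemma bdd_cont_cmult: "bdd_cont B f \<Longrightarrow> bdd_cont (\<bar>c\<bar> * B) (\<lambda>t. c * f t)"
  by (auto simp: bdd_cont_def abs_mult intro!: continuous_intros mult_mono)

lemma bdd_cont_add: "bdd_cont B f \<Longrightarrow> bdd_cont C g \<Longrightarrow> bdd_cont (B + C) (\<lambda>t. f t + g t)"
  using bdd_cont_lincomb [of B f C g 1 1] by simp

lemma bdd_cont_const: "bdd_cont \<bar>c\<bar> (\<lambda>t. c)"
  by (simp add: bdd_cont_def)

lemma apply_Bcontfun: "bdd_cont B f \<Longrightarrow> apply_bcontfun (Bcontfun f) = f"
  by (intro Bcontfun_inverse) (auto simp: bdd_cont_def bcontfun_def bounded_iff)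

text \<open>The second-order Taylor remainder of the sine at \<open>a\<close>, divided by
  \<open>e\<^sup>2\<close> to make it bounded uniformly in \<open>e\<close>. At \<open>e = 0\<close>
  division by zero gives the value 0.\<close>

definition sinrem :: "real \<Rightarrow> real \<Rightarrow> real \<Rightarrow> real" where
  "sinrem e a h = (sin (a + e * h) - sin a - e * h * cos a) / e\<^sup>2"

text \<open>For nonzero \<open>e\<close> the derivative in \<open>h\<close> is
  \<open>(cos (a + e * h) - cos a) / e\<close>, which is at most |h| in absolute value because the
  cosine has Lipschitz constant 1.\<close>

lemma sinrem_lipschitz:
  assumes "\<bar>h\<bar> \<le> B" "\<bar>h'\<bar> \<le> B"
  shows "\<bar>sinrem e a h - sinrem e a h'\<bar> \<le> B * \<bar>h - h'\<bar>"
proof (cases "e = 0")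
  case True
  then show ?thesis using assms by (simp add: sinrem_def)
next
  case False
  have "norm (sinrem e a h - sinrem e a h') \<le> B * norm (h - h')"
  proof (rule field_differentiable_bound)
    show "(sinrem e a has_real_derivative (cos (a + e * x) - cos a) / e) (at x within {-B..B})" for x
      unfolding sinrem_def [abs_def] using False
      by (auto intro!: derivative_eq_intros simp: power2_eq_square field_simps)
    show "norm ((cos (a + e * x) - cos a) / e) \<le> B" if "x \<in> {-B..B}" for x
    proof -
      have "\<bar>cos (a + e * x) - cos a\<bar> \<le> 1 * \<bar>(a + e * x) - a\<bar>"
        using field_differentiable_bound [of UNIV cos "\<lambda>x. - sin x" 1 "a + e * x" a]
        by (auto intro: derivative_eq_intros)
      then show ?thesis
        using that False by (auto simp: abs_mult divide_le_eq mult.commute intro: order_trans mult_left_mono)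
    qed
  qed (use assms in auto)
  then show ?thesis by simp
qed

lemma sinrem_bound: "\<bar>sinrem e a h\<bar> \<le> h\<^sup>2"
  using sinrem_lipschitz [of h "\<bar>h\<bar>" 0 e a] by (simp add: sinrem_def power2_eq_square)

lemma sin_expand: "sin (a + e * h) = sin a + e * h * cos a + e\<^sup>2 * sinrem e a h"
  by (simp add: sinrem_def)

text \<open>One constant serves all parameters in (0, 1] and all points of \<open>S\<close>. Closure
  under algebraic operations and under the linear solution operators replaces every explicit
  contraction estimate.\<close>

definition lip_family :: "'x::metric_space set \<Rightarrow> (real \<Rightarrow> 'x \<Rightarrow> real \<Rightarrow> real) \<Rightarrow> bool" where
  "lip_family S N \<longleftrightarrow> (\<exists>M. \<forall>\<eta>\<in>{0<..1}. \<forall>x\<in>S. bdd_cont M (N \<eta> x) \<and>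
     (\<forall>x'\<in>S. \<forall>t. \<bar>N \<eta> x t - N \<eta> x' t\<bar> \<le> M * dist x x'))"

lemma lip_familyE:
  assumes "lip_family S N"
  obtains M where "M \<ge> 0" "\<And>\<eta> x. 0 < \<eta> \<Longrightarrow> \<eta> \<le> 1 \<Longrightarrow> x \<in> S \<Longrightarrow> bdd_cont M (N \<eta> x)"
    "\<And>\<eta> x x' t. 0 < \<eta> \<Longrightarrow> \<eta> \<le> 1 \<Longrightarrow> x \<in> S \<Longrightarrow> x' \<in> S \<Longrightarrow> \<bar>N \<eta> x t - N \<eta> x' t\<bar> \<le> M * dist x x'"
proof -
  from assms obtain M where M: "\<And>\<eta> x. \<eta> \<in> {0<..1} \<Longrightarrow> x \<in> S \<Longrightarrow> bdd_cont M (N \<eta> x)"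
    "\<And>\<eta> x x' t. \<eta> \<in> {0<..1} \<Longrightarrow> x \<in> S \<Longrightarrow> x' \<in> S \<Longrightarrow> \<bar>N \<eta> x t - N \<eta> x' t\<bar> \<le> M * dist x x'"
    unfolding lip_family_def by blast
  show thesis
  proof (rule that [of "\<bar>M\<bar>"])
    show "bdd_cont \<bar>M\<bar> (N \<eta> x)" if "0 < \<eta>" "\<eta> \<le> 1" "x \<in> S" for \<eta> x
      using M(1) [of \<eta> x] that by (auto intro: bdd_cont_mono)
    show "\<bar>N \<eta> x t - N \<eta> x' t\<bar> \<le> \<bar>M\<bar> * dist x x'" if "0 < \<eta>" "\<eta> \<le> 1" "x \<in> S" "x' \<in> S" for \<eta> x x' t
      using M(2) [of \<eta> x x' t] that mult_right_mono [OF abs_ge_self [of M] zero_le_dist [of x x']] by auto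
  qed simp
qed

lemma lip_familyI:
  assumes "\<And>\<eta> x. 0 < \<eta> \<Longrightarrow> \<eta> \<le> 1 \<Longrightarrow> x \<in> S \<Longrightarrow> bdd_cont B (N \<eta> x)"
    "\<And>\<eta> x x' t. 0 < \<eta> \<Longrightarrow> \<eta> \<le> 1 \<Longrightarrow> x \<in> S \<Longrightarrow> x' \<in> S \<Longrightarrow> \<bar>N \<eta> x t - N \<eta> x' t\<bar> \<le> L * dist x x'"
  shows "lip_family S N"
  unfolding lip_family_def
proof (intro exI ballI conjI allI)
  fix \<eta> :: real and x assume "\<eta> \<in> {0<..1}" "x \<in> S"
  then show "bdd_cont (max B L) (N \<eta> x)"
    using assms(1) [of \<eta> x] by (auto intro: bdd_cont_mono)
next
  fix \<eta> :: real and x x' t assume "\<eta> \<in> {0<..1}" "x \<in> S" "x' \<in> S"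
  then have "\<bar>N \<eta> x t - N \<eta> x' t\<bar> \<le> L * dist x x'"
    using assms(2) by simp
  also have "\<dots> \<le> max B L * dist x x'"
    by (intro mult_right_mono) auto
  finally show "\<bar>N \<eta> x t - N \<eta> x' t\<bar> \<le> max B L * dist x x'" .
qed

lemma lip_family_fun: "bdd_cont B f \<Longrightarrow> lip_family S (\<lambda>\<eta> x t. f t)"
  by (rule lip_familyI [where L = 0]) auto

lemma lip_family_const: "lip_family S (\<lambda>\<eta> x t. c)"
  by (rule lip_family_fun [OF bdd_cont_const])

lemma lip_family_param: "lip_family S (\<lambda>\<eta> x t. \<eta>)"
  by (rule lip_familyI [where B = 1 and L = 0]) (auto simp: bdd_cont_def)

lemma lip_family_add:
  assumes "lip_family S M" "lip_family S N"
  shows "lip_family S (\<lambda>\<eta> x t. M \<eta> x t + N \<eta> x t)"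
proof -
  from assms(1) obtain A where A: "A \<ge> 0" "\<And>\<eta> x. 0 < \<eta> \<Longrightarrow> \<eta> \<le> 1 \<Longrightarrow> x \<in> S \<Longrightarrow> bdd_cont A (M \<eta> x)"
    "\<And>\<eta> x x' t. 0 < \<eta> \<Longrightarrow> \<eta> \<le> 1 \<Longrightarrow> x \<in> S \<Longrightarrow> x' \<in> S \<Longrightarrow> \<bar>M \<eta> x t - M \<eta> x' t\<bar> \<le> A * dist x x'"
    by (rule lip_familyE) blast
  from assms(2) obtain B where B: "B \<ge> 0" "\<And>\<eta> x. 0 < \<eta> \<Longrightarrow> \<eta> \<le> 1 \<Longrightarrow> x \<in> S \<Longrightarrow> bdd_cont B (N \<eta> x)"
    "\<And>\<eta> x x' t. 0 < \<eta> \<Longrightarrow> \<eta> \<le> 1 \<Longrightarrow> x \<in> S \<Longrightarrow> x' \<in> S \<Longrightarrow> \<bar>N \<eta> x t - N \<eta> x' t\<bar> \<le> B * dist x x'"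
    by (rule lip_familyE) blast
  show ?thesis
  proof (rule lip_familyI)
    fix \<eta> :: real and x x' t assume h: "0 < \<eta>" "\<eta> \<le> 1" "x \<in> S" "x' \<in> S"
    show "\<bar>M \<eta> x t + N \<eta> x t - (M \<eta> x' t + N \<eta> x' t)\<bar> \<le> (A + B) * dist x x'"
      using A(3) [OF h, of t] B(3) [OF h, of t] unfolding distrib_right by linarith
  qed (auto intro: bdd_cont_add A B)
qed

lemma lip_family_mult:
  assumes "lip_family S M" "lip_family S N"
  shows "lip_family S (\<lambda>\<eta> x t. M \<eta> x t * N \<eta> x t)"
proof -
  from assms(1) obtain A where A: "A \<ge> 0" "\<And>\<eta> x. 0 < \<eta> \<Longrightarrow> \<eta> \<le> 1 \<Longrightarrow> x \<in> S \<Longrightarrow> bdd_cont A (M \<eta> x)"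
    "\<And>\<eta> x x' t. 0 < \<eta> \<Longrightarrow> \<eta> \<le> 1 \<Longrightarrow> x \<in> S \<Longrightarrow> x' \<in> S \<Longrightarrow> \<bar>M \<eta> x t - M \<eta> x' t\<bar> \<le> A * dist x x'"
    by (rule lip_familyE) blast
  from assms(2) obtain B where B: "B \<ge> 0" "\<And>\<eta> x. 0 < \<eta> \<Longrightarrow> \<eta> \<le> 1 \<Longrightarrow> x \<in> S \<Longrightarrow> bdd_cont B (N \<eta> x)"
    "\<And>\<eta> x x' t. 0 < \<eta> \<Longrightarrow> \<eta> \<le> 1 \<Longrightarrow> x \<in> S \<Longrightarrow> x' \<in> S \<Longrightarrow> \<bar>N \<eta> x t - N \<eta> x' t\<bar> \<le> B * dist x x'"
    by (rule lip_familyE) blast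
  show ?thesis
  proof (rule lip_familyI)
    fix \<eta> :: real and x x' t assume h: "0 < \<eta>" "\<eta> \<le> 1" "x \<in> S" "x' \<in> S"
    have "M \<eta> x t * N \<eta> x t - M \<eta> x' t * N \<eta> x' t
        = M \<eta> x t * (N \<eta> x t - N \<eta> x' t) + (M \<eta> x t - M \<eta> x' t) * N \<eta> x' t"
      by (simp add: algebra_simps)
    also have "\<bar>\<dots>\<bar> \<le> A * (B * dist x x') + (A * dist x x') * B"
      using A(1) B(1) bdd_contD(2) [OF A(2) [OF h(1-3)], of t] bdd_contD(2) [OF B(2) [OF h(1,2,4)], of
          t] A(3) [OF h, of t] B(3) [OF h, of t]
      by (intro order_trans [OF abs_triangle_ineq] add_mono) (auto simp: abs_mult intro!: mult_mono)
    finally show "\<bar>M \<eta> x t * N \<eta> x t - M \<eta> x' t * N \<eta> x' t\<bar> \<le> (2 * A * B) * dist x x'"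
      by (simp add: algebra_simps)
  qed (auto intro: bdd_cont_mult A B)
qed

lemma lip_family_uminus: "lip_family S N \<Longrightarrow> lip_family S (\<lambda>\<eta> x t. - N \<eta> x t)"
  using lip_family_mult [OF lip_family_const [of S "- 1"], of N] by simp

lemma lip_family_diff: "lip_family S M \<Longrightarrow> lip_family S N \<Longrightarrow> lip_family S (\<lambda>\<eta> x t. M \<eta> x t - N \<eta> x t)"
  using lip_family_add [of S M "\<lambda>\<eta> x t. - N \<eta> x t"] lip_family_uminus [of S N] by simp

lemma lip_family_power: "lip_family S N \<Longrightarrow> lip_family S (\<lambda>\<eta> x t. N \<eta> x t ^ n)"
  by (induction n) (auto intro: lip_family_const lip_family_mult)

lemma lip_family_sinrem:
  assumes "lip_family S N" "continuous_on UNIV A"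
  shows "lip_family S (\<lambda>\<eta> x t. sinrem (s * \<eta> ^ 3) (A t) (N \<eta> x t))"
proof -
  from assms(1) obtain B where B: "B \<ge> 0" "\<And>\<eta> x. 0 < \<eta> \<Longrightarrow> \<eta> \<le> 1 \<Longrightarrow> x \<in> S \<Longrightarrow> bdd_cont B (N \<eta> x)"
    "\<And>\<eta> x x' t. 0 < \<eta> \<Longrightarrow> \<eta> \<le> 1 \<Longrightarrow> x \<in> S \<Longrightarrow> x' \<in> S \<Longrightarrow> \<bar>N \<eta> x t - N \<eta> x' t\<bar> \<le> B * dist x x'"
    by (rule lip_familyE) blast
  show ?thesis
  proof (rule lip_familyI)
    fix \<eta> :: real and x assume h: "0 < \<eta>" "\<eta> \<le> 1" "x \<in> S"
    note b = B(2) [OF h]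
    have "(N \<eta> x t)\<^sup>2 \<le> B\<^sup>2" for t
      using bdd_contD(2) [OF b, of t] by (simp add: abs_le_square_iff [symmetric] B(1))
    then show "bdd_cont (B\<^sup>2) (\<lambda>t. sinrem (s * \<eta> ^ 3) (A t) (N \<eta> x t))"
      \<comment> \<open>Division is rewritten as multiplication by a constant inverse, so continuity
        carries no side condition that the parameter be nonzero.\<close>
      unfolding bdd_cont_def sinrem_def [abs_def] divide_inverse
      by (auto intro!: continuous_intros assms(2) bdd_contD(1) [OF b]
          simp: sinrem_bound [THEN order_trans, unfolded sinrem_def divide_inverse])
  next
    fix \<eta> :: real and x x' t assume h: "0 < \<eta>" "\<eta> \<le> 1" "x \<in> S" "x' \<in> S"
    have "\<bar>sinrem (s * \<eta> ^ 3) (A t) (N \<eta> x t) - sinrem (s * \<eta> ^ 3) (A t) (N \<eta> x' t)\<bar> \<le> B * \<bar>N \<eta> x t -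
        N \<eta> x' t\<bar>"
      by (intro sinrem_lipschitz bdd_contD B h)
    also have "\<dots> \<le> B * (B * dist x x')"
      by (intro mult_left_mono B h)
    finally show "\<bar>sinrem (s * \<eta> ^ 3) (A t) (N \<eta> x t) - sinrem (s * \<eta> ^ 3) (A t) (N \<eta> x' t)\<bar> \<le> B\<^sup>2 *
        dist x x'"
      by (simp add: power2_eq_square mult.assoc)
  qed
qed

text \<open>For a linear operator the sup-norm bound, applied to a difference, is already the
  Lipschitz estimate. Linearity is asked only in the form that differences require, with
  coefficients 1 and -1.\<close>

lemma lip_family_linear_image:
  assumes N: "lip_family S N"
    and bound: "\<And>B f. bdd_cont B f \<Longrightarrow> bdd_cont (K * B) (J f)"
    and lin: "\<And>B C f g t. bdd_cont B f \<Longrightarrow> bdd_cont C g \<Longrightarrow> J (\<lambda>t. 1 * f t + (- 1) * g t) t = 1 * J f t +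
        (- 1) * J g t"
  shows "lip_family S (\<lambda>\<eta> x. J (N \<eta> x))"
proof -
  from N obtain B where B: "B \<ge> 0" "\<And>\<eta> x. 0 < \<eta> \<Longrightarrow> \<eta> \<le> 1 \<Longrightarrow> x \<in> S \<Longrightarrow> bdd_cont B (N \<eta> x)"
    "\<And>\<eta> x x' t. 0 < \<eta> \<Longrightarrow> \<eta> \<le> 1 \<Longrightarrow> x \<in> S \<Longrightarrow> x' \<in> S \<Longrightarrow> \<bar>N \<eta> x t - N \<eta> x' t\<bar> \<le> B * dist x x'"
    by (rule lip_familyE) blast
  show ?thesis
  proof (rule lip_familyI)
    fix \<eta> :: real and x x' t assume h: "0 < \<eta>" "\<eta> \<le> 1" "x \<in> S" "x' \<in> S"
    have "bdd_cont (B * dist x x') (\<lambda>t. 1 * N \<eta> x t + (- 1) * N \<eta> x' t)"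
      using bdd_cont_lincomb [OF B(2) [OF h(1-3)] B(2) [OF h(1,2,4)], of 1 "- 1"] B(3) [OF h] by (simp
          add: bdd_cont_def)
    from bdd_contD(2) [OF bound [OF this], of t] 
    show "\<bar>J (N \<eta> x) t - J (N \<eta> x') t\<bar> \<le> (K * B) * dist x x'"
      unfolding lin [OF B(2) [OF h(1-3)] B(2) [OF h(1,2,4)]] by (simp add: mult.assoc)
  qed (auto intro: bound B)
qed

section \<open>The state space and the contraction principle\<close>

type_synonym state = "real \<times> (real \<Rightarrow>\<^sub>C real) \<times> (real \<Rightarrow>\<^sub>C real) \<times> (real \<Rightarrow>\<^sub>C real)"

lemma dist_state_le:
  fixes x y :: state
  shows "dist x y \<le> dist (fst x) (fst y) + dist (fst (snd x)) (fst (snd y))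
    + dist (fst (snd (snd x))) (fst (snd (snd y))) + dist (snd (snd (snd x))) (snd (snd (snd y)))"
proof -
  have *: "dist u v \<le> dist (fst u) (fst v) + dist (snd u) (snd v)" for u v :: "'a::metric_space \<times>
      'b::metric_space"
    unfolding dist_prod_def by (intro sqrt_sum_squares_le_sum) auto
  show ?thesis
    using * [of x y] * [of "snd x" "snd y"] * [of "snd (snd x)" "snd (snd y)"] by linarith
qed

lemma dist_state_ge:
  fixes x y :: state
  shows "\<bar>fst x - fst y\<bar> \<le> dist x y" "\<bar>fst (snd x) t - fst (snd y) t\<bar> \<le> dist x y"
    "\<bar>fst (snd (snd x)) t - fst (snd (snd y)) t\<bar> \<le> dist x y"
    "\<bar>snd (snd (snd x)) t - snd (snd (snd y)) t\<bar> \<le> dist x y"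
proof -
  note f = dist_fst_le and s = dist_snd_le
  show "\<bar>fst x - fst y\<bar> \<le> dist x y"
    using f [of x y] by (simp add: dist_real_def)
  show "\<bar>fst (snd x) t - fst (snd y) t\<bar> \<le> dist x y"
    using dist_bounded [of "fst (snd x)" t "fst (snd y)"] f [of "snd x" "snd y"] s [of x y] by (simp
        add: dist_real_def)
  show "\<bar>fst (snd (snd x)) t - fst (snd (snd y)) t\<bar> \<le> dist x y"
    using dist_bounded [of "fst (snd (snd x))" t "fst (snd (snd y))"] f [of "snd (snd x)" "snd (snd
        y)"] s [of "snd x" "snd y"] s [of x y]
    by (simp add: dist_real_def)
  show "\<bar>snd (snd (snd x)) t - snd (snd (snd y)) t\<bar> \<le> dist x y"
    using dist_bounded [of "snd (snd (snd x))" t "snd (snd (snd y))"] s [of "snd (snd x)" "snd (snd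
        y)"] s [of "snd x" "snd y"] s [of x y]
    by (simp add: dist_real_def)
qed

lemma lip_family_coords:
  fixes a0 :: real
  defines "x0 \<equiv> (a0, 0, 0, 0) :: state"
  shows "lip_family (cball x0 R) (\<lambda>\<eta> x t. fst x)"
    "lip_family (cball x0 R) (\<lambda>\<eta> x t. apply_bcontfun (fst (snd x)) t)"
    "lip_family (cball x0 R) (\<lambda>\<eta> x t. apply_bcontfun (fst (snd (snd x))) t)"
    "lip_family (cball x0 R) (\<lambda>\<eta> x t. apply_bcontfun (snd (snd (snd x))) t)"
proof -
  note d = dist_state_ge
  have *: "\<bar>fst x\<bar> \<le> \<bar>a0\<bar> + R" "\<bar>fst (snd x) t\<bar> \<le> R" "\<bar>fst (snd (snd x)) t\<bar> \<le> R" "\<bar>snd (snd (snd x)) t\<bar> \<le> R"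
    if "x \<in> cball x0 R" for x :: state and t
    using d(1) [of x0 x] d(2-) [of x0 t x] that by (auto simp: x0_def zero_bcontfun.rep_eq)
  show "lip_family (cball x0 R) (\<lambda>\<eta> x t. fst x)"
    by (rule lip_familyI [where L = 1 and B = "\<bar>a0\<bar> + R"]) (use * d in \<open>auto simp: bdd_cont_def\<close>)
  show "lip_family (cball x0 R) (\<lambda>\<eta> x t. apply_bcontfun (fst (snd x)) t)"
    by (rule lip_familyI [where L = 1 and B = R]) (use * d in \<open>auto simp: bdd_cont_def\<close>)
  show "lip_family (cball x0 R) (\<lambda>\<eta> x t. apply_bcontfun (fst (snd (snd x))) t)"
    by (rule lip_familyI [where L = 1 and B = R]) (use * d in \<open>auto simp: bdd_cont_def\<close>)
  show "lip_family (cball x0 R) (\<lambda>\<eta> x t. apply_bcontfun (snd (snd (snd x))) t)"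
    by (rule lip_familyI [where L = 1 and B = R]) (use * d in \<open>auto simp: bdd_cont_def\<close>)
qed

text \<open>Every component carries a factor \<eta>, so the map contracts for small \<eta>.
  \<open>N1\<close> is read at time 0 because families consist of functions of \<open>t\<close>,
  while the first coordinate of a state is a number.\<close>

lemma lip_family_fixpoint:
  fixes a0 :: real
  defines "x0 \<equiv> (a0, 0, 0, 0) :: state"
  assumes R: "R > 0"
    and N: "lip_family (cball x0 R) N1" "lip_family (cball x0 R) N2" "lip_family (cball x0 R) N3"
        "lip_family (cball x0 R) N4"
  shows "\<exists>\<delta>>0. \<forall>\<eta>. 0 < \<eta> \<and> \<eta> < \<delta> \<longrightarrow> (\<exists>!x. x \<in> cball x0 R \<and> fst x = a0 + \<eta> * N1 \<eta> x 0 \<and>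
    (\<forall>t. fst (snd x) t = \<eta> * N2 \<eta> x t) \<and> (\<forall>t. fst (snd (snd x)) t = \<eta> * N3 \<eta> x t) \<and>
    (\<forall>t. snd (snd (snd x)) t = \<eta> * N4 \<eta> x t))"
proof -
  let ?S = "cball x0 R"
  have "\<exists>M>0. \<forall>\<eta> x. 0 < \<eta> \<longrightarrow> \<eta> \<le> 1 \<longrightarrow> x \<in> ?S \<longrightarrow> bdd_cont M (N \<eta> x) \<and>
    (\<forall>x' t. x' \<in> ?S \<longrightarrow> \<bar>N \<eta> x t - N \<eta> x' t\<bar> \<le> M * dist x x')" if n: "lip_family ?S N" for N
  proof -
    from n obtain M where M: "M \<ge> 0" "\<And>\<eta> x. 0 < \<eta> \<Longrightarrow> \<eta> \<le> 1 \<Longrightarrow> x \<in> ?S \<Longrightarrow> bdd_cont M (N \<eta> x)"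
      "\<And>\<eta> x x' t. 0 < \<eta> \<Longrightarrow> \<eta> \<le> 1 \<Longrightarrow> x \<in> ?S \<Longrightarrow> x' \<in> ?S \<Longrightarrow> \<bar>N \<eta> x t - N \<eta> x' t\<bar> \<le> M * dist x x'"
      by (rule lip_familyE) blast
    show ?thesis
    proof (intro exI [of _ "M + 1"] conjI allI impI)
      fix \<eta> :: real and x x' t assume h: "0 < \<eta>" "\<eta> \<le> 1" "x \<in> ?S" "x' \<in> ?S"
      show "\<bar>N \<eta> x t - N \<eta> x' t\<bar> \<le> (M + 1) * dist x x'"
        using M(3) [OF h, of t] by (simp add: distrib_right add_increasing2)
    qed (use M in \<open>auto intro!: bdd_cont_mono [OF M(2)]\<close>)
  qed
  note ex = this
  obtain M1 where M1: "M1 > 0" "\<And>\<eta> x. 0 < \<eta> \<Longrightarrow> \<eta> \<le> 1 \<Longrightarrow> x \<in> ?S \<Longrightarrow> bdd_cont M1 (N1 \<eta> x)"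
    "\<And>\<eta> x x' t. 0 < \<eta> \<Longrightarrow> \<eta> \<le> 1 \<Longrightarrow> x \<in> ?S \<Longrightarrow> x' \<in> ?S \<Longrightarrow> \<bar>N1 \<eta> x t - N1 \<eta> x' t\<bar> \<le> M1 * dist x x'"
    using ex [OF N(1)] by blast
  obtain M2 where M2: "M2 > 0" "\<And>\<eta> x. 0 < \<eta> \<Longrightarrow> \<eta> \<le> 1 \<Longrightarrow> x \<in> ?S \<Longrightarrow> bdd_cont M2 (N2 \<eta> x)"
    "\<And>\<eta> x x' t. 0 < \<eta> \<Longrightarrow> \<eta> \<le> 1 \<Longrightarrow> x \<in> ?S \<Longrightarrow> x' \<in> ?S \<Longrightarrow> \<bar>N2 \<eta> x t - N2 \<eta> x' t\<bar> \<le> M2 * dist x x'"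
    using ex [OF N(2)] by blast
  obtain M3 where M3: "M3 > 0" "\<And>\<eta> x. 0 < \<eta> \<Longrightarrow> \<eta> \<le> 1 \<Longrightarrow> x \<in> ?S \<Longrightarrow> bdd_cont M3 (N3 \<eta> x)"
    "\<And>\<eta> x x' t. 0 < \<eta> \<Longrightarrow> \<eta> \<le> 1 \<Longrightarrow> x \<in> ?S \<Longrightarrow> x' \<in> ?S \<Longrightarrow> \<bar>N3 \<eta> x t - N3 \<eta> x' t\<bar> \<le> M3 * dist x x'"
    using ex [OF N(3)] by blast
  obtain M4 where M4: "M4 > 0" "\<And>\<eta> x. 0 < \<eta> \<Longrightarrow> \<eta> \<le> 1 \<Longrightarrow> x \<in> ?S \<Longrightarrow> bdd_cont M4 (N4 \<eta> x)"
    "\<And>\<eta> x x' t. 0 < \<eta> \<Longrightarrow> \<eta> \<le> 1 \<Longrightarrow> x \<in> ?S \<Longrightarrow> x' \<in> ?S \<Longrightarrow> \<bar>N4 \<eta> x t - N4 \<eta> x' t\<bar> \<le> M4 * dist x x'"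
    using ex [OF N(4)] by blast
  define M where "M = M1 + M2 + M3 + M4"
  have M: "M > 0"
    using M1(1) M2(1) M3(1) M4(1) by (simp add: M_def)
  \<comment> \<open>\<open>R / M\<close> keeps the image inside the ball, \<open>1 / (2 * M)\<close>
    gives contraction factor 1/2, and 1 is the range in which the uniform bounds hold.\<close>
  define \<delta> where "\<delta> = min 1 (min (R / M) (1 / (2 * M)))"
  show ?thesis
  proof (intro exI conjI allI impI)
    show "\<delta> > 0"
      using M R by (simp add: \<delta>_def)
    fix \<eta> assume \<eta>: "0 < \<eta> \<and> \<eta> < \<delta>"
    then have h: "0 < \<eta>" "\<eta> \<le> 1" and \<eta>R: "\<eta> * M \<le> R" and \<eta>2: "\<eta> * M \<le> 1 / 2"
      using M by (auto simp: \<delta>_def field_simps)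
    define T where "T x = (a0 + \<eta> * N1 \<eta> x 0, Bcontfun (\<lambda>t. \<eta> * N2 \<eta> x t),
        Bcontfun (\<lambda>t. \<eta> * N3 \<eta> x t), Bcontfun (\<lambda>t. \<eta> * N4 \<eta> x t))" for x :: state
    have app: "fst (snd (T x)) t = \<eta> * N2 \<eta> x t" "fst (snd (snd (T x))) t = \<eta> * N3 \<eta> x t"
      "snd (snd (snd (T x))) t = \<eta> * N4 \<eta> x t" if "x \<in> ?S" for x t
      using apply_Bcontfun [OF bdd_cont_cmult [OF M2(2) [OF h that]]] apply_Bcontfun [OF
          bdd_cont_cmult [OF M3(2) [OF h that]]]
        apply_Bcontfun [OF bdd_cont_cmult [OF M4(2) [OF h that]]] by (simp_all add: T_def)
    have sc: "dist (\<eta> * u) (\<eta> * v) \<le> \<eta> * K" if "\<bar>u - v\<bar> \<le> K" for u v K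
      using that h by (simp add: dist_real_def abs_mult flip: right_diff_distrib)
    have into: "T x \<in> ?S" if "x \<in> ?S" for x
    proof -
      have "dist x0 (T x) \<le> \<eta> * M1 + \<eta> * M2 + \<eta> * M3 + \<eta> * M4"
        using bdd_contD(2) [OF M1(2) [OF h that]] bdd_contD(2) [OF M2(2) [OF h that]] bdd_contD(2) [OF
            M3(2) [OF h that]] bdd_contD(2) [OF M4(2) [OF h that]] h
        by (intro dist_state_le [THEN order_trans] add_mono dist_bound)
          (auto simp: app [OF that] x0_def zero_bcontfun.rep_eq dist_real_def abs_mult, auto simp:
              T_def abs_mult)
      also have "\<dots> \<le> R"
        using \<eta>R by (simp add: M_def algebra_simps)
      finally show ?thesis by simp
    qed
    have contr: "dist (T x) (T y) \<le> 1 / 2 * dist x y" if "x \<in> ?S" "y \<in> ?S" for x y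
    proof -
      have "dist (T x) (T y) \<le> \<eta> * (M1 * dist x y) + \<eta> * (M2 * dist x y) + \<eta> * (M3 * dist x y) + \<eta> *
          (M4 * dist x y)"
      proof (intro dist_state_le [THEN order_trans] add_mono dist_bound)
        show "dist (fst (T x)) (fst (T y)) \<le> \<eta> * (M1 * dist x y)"
          using sc [OF M1(3) [OF h that]] by (simp add: T_def)
      qed (unfold app [OF that(1)] app [OF that(2)], (intro sc M2 M3 M4 h that)+)
      also have "\<dots> = (\<eta> * M) * dist x y"
        by (simp add: M_def algebra_simps)
      also have "\<dots> \<le> 1 / 2 * dist x y"
        using \<eta>2 by (intro mult_right_mono) auto
      finally show ?thesis .
    qed
    have "\<exists>!x. x \<in> ?S \<and> T x = x"
    proof (rule Banach_fix [where c = "1 / 2"])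
      show "?S \<noteq> {}"
        using R centre_in_cball [of x0 R] by (metis empty_iff less_imp_le)
    qed (use into contr in \<open>simp_all add: complete_eq_closed image_subset_iff\<close>)
    moreover have "T x = x \<longleftrightarrow> fst x = a0 + \<eta> * N1 \<eta> x 0 \<and>
      (\<forall>t. fst (snd x) t = \<eta> * N2 \<eta> x t) \<and> (\<forall>t. fst (snd (snd x)) t = \<eta> * N3 \<eta> x t) \<and>
      (\<forall>t. snd (snd (snd x)) t = \<eta> * N4 \<eta> x t)" if "x \<in> ?S" for x
    proof -
      have "T x = x \<longleftrightarrow> fst (T x) = fst x \<and> fst (snd (T x)) = fst (snd x) \<and>
          fst (snd (snd (T x))) = fst (snd (snd x)) \<and> snd (snd (snd (T x))) = snd (snd (snd x))"
        by (auto simp: prod_eq_iff)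
      moreover have "f = g \<longleftrightarrow> (\<forall>t. g t = f t)" for f g :: "real \<Rightarrow>\<^sub>C real"
        by (auto intro: bcontfun_eqI)
      moreover have "fst (T x) = a0 + \<eta> * N1 \<eta> x 0"
        by (simp add: T_def)
      ultimately show ?thesis
        using app [OF that] by auto
    qed
    ultimately show "\<exists>!x. x \<in> ?S \<and> fst x = a0 + \<eta> * N1 \<eta> x 0 \<and>
      (\<forall>t. fst (snd x) t = \<eta> * N2 \<eta> x t) \<and> (\<forall>t. fst (snd (snd x)) t = \<eta> * N3 \<eta> x t) \<and>
      (\<forall>t. snd (snd (snd x)) t = \<eta> * N4 \<eta> x t)"
      by (metis (no_types, lifting))
  qed
qed

context saddle begin

lemma lip_family_fwd:
  assumes "lip_family S N"
  shows "lip_family S (\<lambda>\<eta> x. fwd (N \<eta> x))"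
proof (rule lip_family_linear_image [OF assms, where K = "1 / k"])
  show "bdd_cont (1 / k * B) (fwd f)" if "bdd_cont B f" for B f
    using fwd_bound [OF that] fwd_deriv [OF bdd_contD(1) [OF that]]
    by (auto simp: bdd_cont_def intro!: DERIV_continuous_on)
qed (rule fwd_lincomb, auto dest: bdd_contD)

lemma lip_family_bwd:
  assumes "lip_family S N"
  shows "lip_family S (\<lambda>\<eta> x. bwd (N \<eta> x))"
proof (rule lip_family_linear_image [OF assms, where K = "4 / k"])
  show "bdd_cont (4 / k * B) (bwd f)" if "bdd_cont B f" for B f
    using bwd_bound [OF that] bwd_deriv [OF that]
    by (auto simp: bdd_cont_def intro!: DERIV_continuous_on)
qed (rule bwd_lincomb)

lemma lip_family_pairing:
  assumes "lip_family S N"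
  shows "lip_family S (\<lambda>\<eta> x t. pairing (N \<eta> x))"
proof (rule lip_family_linear_image [OF assms, where K = "pi / k" and J = "\<lambda>f t. pairing f"])
  show "bdd_cont (pi / k * B) (\<lambda>t. pairing f)" if "bdd_cont B f" for B f
    using pairing_bound [OF that] by (simp add: bdd_cont_def mult.commute)
qed (rule pairing_lincomb)

end

section \<open>The bifurcation equation\<close>

text \<open>The data after a time shift: \<open>k\<close> stands for \<open>2 * c\<close>,
  \<open>g\<close> for \<gamma> shifted by \<alpha>0, \<open>z0\<close> for the leading value of
  \<open>z\<close>, and \<sigma> selects one of the two heteroclinic orbits.\<close>

locale melnikov = saddle k for k :: real +
  fixes \<sigma> z0 \<Gamma> :: real and g g' :: "real \<Rightarrow> real"
  assumes \<sigma>: "\<sigma> = 1 \<or> \<sigma> = - 1" and z0: "z0 \<noteq> 0"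
    and g: "bdd_cont \<Gamma> g" and g': "bdd_cont \<Gamma> g'" and g_deriv: "\<And>t. (g has_real_derivative g' t) (at t)"
    and melnikov_zero: "pairing g = 0" and melnikov_simple: "pairing g' \<noteq> 0"
begin

text \<open>Half of the heteroclinic orbit: the energy factors through half angles, and sine and
  cosine of this half angle are \<open>sech\<close> and a signed \<open>tanh\<close>.\<close>

definition A :: "real \<Rightarrow> real" where
  "A t = pi / 2 + \<sigma> * arctan (sinh (k * t))"

lemma \<sigma>_sq [simp]: "\<sigma> * \<sigma> = 1" "\<sigma> * (\<sigma> * x) = x"
  using \<sigma> by auto

lemma sqrt_1_sinh: "sqrt (1 + (sinh x)\<^sup>2) = cosh (x :: real)"
  by (metis add.commute cosh_real_nonneg cosh_square_eq real_sqrt_unique)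

lemma sin_A: "sin (A t) = sech (k * t)"
proof -
  have "sin (A t) = cos (\<sigma> * arctan (sinh (k * t)))"
    by (simp add: A_def sin_add)
  also have "\<dots> = cos (arctan (sinh (k * t)))"
    using \<sigma> by auto
  finally show ?thesis
    by (simp add: cos_arctan sqrt_1_sinh sech_def)
qed

lemma cos_A: "cos (A t) = - (\<sigma> * tanh (k * t))"
proof -
  have "cos (A t) = - sin (\<sigma> * arctan (sinh (k * t)))"
    by (simp add: A_def cos_add)
  also have "\<dots> = - (\<sigma> * sin (arctan (sinh (k * t))))"
    using \<sigma> by auto
  finally show ?thesis
    by (simp add: sin_arctan sqrt_1_sinh tanh_def)
qed

lemma A_deriv: "(A has_real_derivative \<sigma> * k * sech (k * t)) (at t)"
  using DERIV_add [OF DERIV_const DERIV_cmult [OF has_real_derivative_arctan_sinh [of k t], of \<sigma>], of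
      "pi / 2"]
  by (simp add: A_def [abs_def] mult.assoc)

lemma A_cont: "continuous_on X A"
  by (meson A_deriv DERIV_continuous_on has_field_derivative_at_within)

text \<open>\<open>ys\<close>, \<open>vs\<close>, \<open>ws\<close> solve the system for \<open>y\<close>, \<open>v\<close>, \<open>w\<close> at \<open>\<epsilon> = 0\<close>, with \<open>vs 0 = 0\<close>.\<close>

definition ys :: "real \<Rightarrow> real" where
  "ys = bwd (\<lambda>t. 4 * z0 * g t)"

definition vs :: "real \<Rightarrow> real" where
  "vs = fwd ys"

definition ws :: "real \<Rightarrow> real" where
  "ws t = k * \<sigma> * sech (k * t) * ys t / (2 * z0)"

lemma ys_deriv: "(ys has_real_derivative 4 * z0 * g t + k * tanh (k * t) * ys t) (at t)"
proof -
  have b: "bdd_cont (\<bar>4 * z0\<bar> * \<Gamma>) (\<lambda>t. 4 * z0 * g t)"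
    by (rule bdd_cont_cmult [OF g])
  have "pairing (\<lambda>t. 4 * z0 * g t) = 0"
    using pairing_lincomb [OF g g, of "4 * z0" 0] melnikov_zero by simp
  then show ?thesis
    using bwd_deriv [OF b] unfolding ys_def by simp
qed

lemma ys_bdd_cont: "\<exists>B. bdd_cont B ys"
  unfolding bdd_cont_def
  using bwd_bound [OF bdd_cont_cmult [OF g]] DERIV_continuous_on [OF has_field_derivative_at_within
      [OF ys_deriv]]
  unfolding ys_def by blast

lemma vs_deriv: "(vs has_real_derivative ys t - k * tanh (k * t) * vs t) (at t)"
  unfolding vs_def using fwd_deriv ys_bdd_cont bdd_contD(1) by blast

lemma vs_bdd_cont: "\<exists>B. bdd_cont B vs"
proof -
  obtain B where "bdd_cont B ys" using ys_bdd_cont by blast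
  from fwd_bound [OF this] show ?thesis
    unfolding bdd_cont_def
    using DERIV_continuous_on [OF has_field_derivative_at_within [OF vs_deriv]]
    unfolding vs_def by blast
qed

lemma sech_bdd_cont: "bdd_cont 1 (\<lambda>t. sech (k * t))"
  using sech_le_1 by (auto simp: bdd_cont_def intro!: continuous_intros)

lemma tanh_bdd_cont: "bdd_cont 1 (\<lambda>t. tanh (k * t))"
  using tanh_real_lt_1 tanh_real_gt_neg1
  by (auto simp: bdd_cont_def abs_le_iff minus_le_iff intro!: continuous_intros less_imp_le)

lemma ws_bdd_cont: "\<exists>B. bdd_cont B ws"
proof -
  obtain B where B: "bdd_cont B ys" using ys_bdd_cont by blast
  show ?thesis
    using bdd_cont_cmult [OF bdd_cont_mult [OF sech_bdd_cont B], of "k * \<sigma> / (2 * z0)"]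
    unfolding ws_def [abs_def] by (auto simp: mult.assoc)
qed

text \<open>Up to the factor \<open>k * \<sigma> / 2\<close>, this is the slope of the bifurcation equation in the free
  parameter; the antiderivative used here converts it into the Melnikov integral of \<open>g'\<close>.\<close>

lemma pairing_ys:
  "pairing (\<lambda>t. sech (k * t) * (sech (k * t) * ys t)) = - (4 * z0 / k\<^sup>2) * pairing g'"
proof -
  obtain B where B: "bdd_cont B ys" using ys_bdd_cont by blast
  define f where "f t = 1 * (sech (k * t) * (sech (k * t) * ys t)) + 4 * z0 / k\<^sup>2 * g' t" for t
  \<comment> \<open>\<open>Y\<close> is the derivative of \<open>ys\<close> divided by
    \<open>k\<^sup>2\<close>. Differentiating the equation for \<open>ys\<close> in time shows that
    \<open>Y\<close> is a bounded solution of the equation with the same homogeneous part and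
    right-hand side \<open>f\<close>, so \<open>f\<close> must satisfy the solvability
    condition.\<close>
  define Y where "Y t = 1 / k * (tanh (k * t) * ys t) + 4 * z0 / k\<^sup>2 * g t" for t
  note b = bdd_cont_mult [OF sech_bdd_cont bdd_cont_mult [OF sech_bdd_cont B]]
  have f: "bdd_cont (\<bar>1\<bar> * (1 * (1 * B)) + \<bar>4 * z0 / k\<^sup>2\<bar> * \<Gamma>) f"
    unfolding f_def by (rule bdd_cont_lincomb [OF b g'])
  have Y: "bdd_cont (\<bar>1 / k\<bar> * (1 * B) + \<bar>4 * z0 / k\<^sup>2\<bar> * \<Gamma>) Y"
    unfolding Y_def by (rule bdd_cont_lincomb [OF bdd_cont_mult [OF tanh_bdd_cont B] g])
  have "((\<lambda>t. tanh (k * t)) has_real_derivative (1 - tanh (k * t) ^ 2) * k) (at t)" for t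
    by (auto intro!: derivative_eq_intros)
  note DERIV_add [OF DERIV_cmult [OF DERIV_mult [OF this ys_deriv], of "1 / k"] DERIV_cmult [OF
      g_deriv, of "4 * z0 / k\<^sup>2"]]
  then have "(Y has_real_derivative 1 / k * ((1 - tanh (k * t) ^ 2) * k * ys t + (4 * z0 * g t + k *
      tanh (k * t) * ys t) * tanh (k * t))
       + 4 * z0 / k\<^sup>2 * g' t) (at t)" for t
    unfolding Y_def [abs_def] .
  moreover have "1 / k * ((1 - tanh (k * t) ^ 2) * k * ys t + (4 * z0 * g t + k * tanh (k * t) * ys t)
      * tanh (k * t))
       + 4 * z0 / k\<^sup>2 * g' t = f t + k * tanh (k * t) * Y t" for t
    unfolding one_minus_tanh_square f_def Y_def using k_pos by (simp add: field_simps power2_eq_square)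
  ultimately have "pairing f = 0"
    using bwd_unique(1) [OF f] bdd_contD(2) [OF Y] by metis
  then show ?thesis
    unfolding f_def pairing_lincomb [OF b g'] by simp
qed

text \<open>For \<open>v = vs + a * sech (k * t)\<close>, \<open>y = ys\<close>,
  \<open>w = ws\<close> the solvability condition at order zero is \<open>b0 + a * b1 = 0\<close>;
  \<open>a0\<close> is its root.\<close>

definition b1 :: real where
  "b1 = k * \<sigma> / 2 * pairing (\<lambda>t. sech (k * t) * (sech (k * t) * ys t))"

definition b0 :: real where
  "b0 = pairing (\<lambda>t. k * \<sigma> / 2 * sech (k * t) * vs t * ys t + 4 * g t * ws t)"

definition a0 :: real where
  "a0 = - b0 / b1"

lemma b1_nz: "b1 \<noteq> 0"
  unfolding b1_def pairing_ys using k_pos \<sigma> z0 melnikov_simple by auto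

section \<open>The system in the scaled variables\<close>

definition sin2 :: "real \<Rightarrow> real \<Rightarrow> real \<Rightarrow> real" where
  "sin2 e t v = sinrem e (A t) (v / 2)"

text \<open>The phase shift by \<open>pi / 2\<close> lets the cosine reuse the remainder of the
  sine.\<close>

definition cos2 :: "real \<Rightarrow> real \<Rightarrow> real \<Rightarrow> real" where
  "cos2 e t v = sinrem e (A t + pi / 2) (v / 2)"

lemma sin_A_plus: "sin (A t + e * v / 2) = sech (k * t) + e * (- (\<sigma> * tanh (k * t) * v / 2) + e * sin2 e t v)"
  using sin_expand [of "A t" e "v / 2"] by (simp add: sin_A cos_A sin2_def power2_eq_square algebra_simps)

lemma cos_A_plus: "cos (A t + e * v / 2) = - (\<sigma> * tanh (k * t)) + e * (- (sech (k * t) * v / 2) + e *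
    cos2 e t v)"
proof -
  have "cos (A t + e * v / 2) = sin ((A t + e * v / 2) + pi / 2)"
    by (simp only: sin_add) simp
  also have "(A t + e * v / 2) + pi / 2 = (A t + pi / 2) + e * (v / 2)"
    by simp
  also have "sin \<dots> = sin (A t + pi / 2) + e * (v / 2) * cos (A t + pi / 2) + e\<^sup>2 * sinrem e (A t + pi
      / 2) (v / 2)"
    by (rule sin_expand)
  also have "sin (A t + pi / 2) = cos (A t)"
    by (simp add: sin_add)
  also have "cos (A t + pi / 2) = - sin (A t)"
    by (simp add: cos_add)
  finally show ?thesis
    by (simp add: sin_A cos_A cos2_def power2_eq_square algebra_simps)
qed

text \<open>\<open>P\<close>, \<open>Q\<close> and \<open>H\<close> are what is left of the
  equations for \<open>v\<close> and \<open>y\<close> and of the level set once the terms of order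
  zero are removed and a factor \<open>e\<close> is split off. They are exact; nothing is
  truncated.\<close>

definition P :: "real \<Rightarrow> real \<Rightarrow> real \<Rightarrow> real" where
  "P e t v = 2 * k * \<sigma> * sin2 e t v"

definition Q :: "real \<Rightarrow> real \<Rightarrow> real \<Rightarrow> real \<Rightarrow> real \<Rightarrow> real" where
  "Q e t v y w = k * \<sigma> / 2 * sech (k * t) * v * y - e * k * \<sigma> * cos2 e t v * y + 4 * g t * w"

definition H :: "real \<Rightarrow> real \<Rightarrow> real \<Rightarrow> real \<Rightarrow> real \<Rightarrow> real" where
  "H e t v y w = y\<^sup>2 / 4 + k * \<sigma> * (- (\<sigma> * tanh (k * t) * v / 2) + e * sin2 e t v) * y - w\<^sup>2"

text \<open>The system for \<open>v = (\<psi> - 2 * A) / e\<close>, \<open>y = (\<psi>' - 2 * k * \<sigma> * sin (\<psi> / 2)) / e\<close> and \<open>w = (z - z0) / e\<close>;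
  the last equation is the level set, kept polynomial in \<open>w\<close> to avoid a square root.\<close>

definition scaled_solution :: "real \<Rightarrow> (real \<Rightarrow> real) \<Rightarrow> (real \<Rightarrow> real) \<Rightarrow> (real \<Rightarrow> real) \<Rightarrow> bool" where
  "scaled_solution e v y w \<longleftrightarrow> continuous_on UNIV w \<and> (\<forall>t.
     (v has_real_derivative y t + e * P e t (v t) - k * tanh (k * t) * v t) (at t) \<and>
     (y has_real_derivative 4 * z0 * g t + e * Q e t (v t) (y t) (w t) + k * tanh (k * t) * y t) (at t) \<and>
     2 * z0 * w t = k * \<sigma> * sech (k * t) * y t + e * H e t (v t) (y t) (w t))"

section \<open>The fixed-point map and its uniform Lipschitz bounds\<close>

lemma lip_family_base:
  "lip_family S (\<lambda>\<eta> x. ys)" "lip_family S (\<lambda>\<eta> x. vs)" "lip_family S (\<lambda>\<eta> x. ws)" "lip_family S (\<lambda>\<eta> x. g)"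
  "lip_family S (\<lambda>\<eta> x t. sech (k * t))" "lip_family S (\<lambda>\<eta> x t. tanh (k * t))"
  using ys_bdd_cont vs_bdd_cont ws_bdd_cont g sech_bdd_cont tanh_bdd_cont by (blast intro: lip_family_fun)+

lemmas lip_family_rules = lip_family_base lip_family_const lip_family_param lip_family_add
    lip_family_mult lip_family_diff lip_family_uminus lip_family_power lip_family_fwd lip_family_bwd
    lip_family_pairing

lemma lip_family_half: "lip_family S N \<Longrightarrow> lip_family S (\<lambda>\<eta> x t. N \<eta> x t / 2)"
  using lip_family_mult [OF _ lip_family_const, of S N "1 / 2"] by simp

lemma lip_family_sin2: "lip_family S V \<Longrightarrow> lip_family S (\<lambda>\<eta> x t. sin2 (s * \<eta> ^ 3) t (V \<eta> x t))"
  unfolding sin2_def by (intro lip_family_sinrem lip_family_half A_cont)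

lemma lip_family_cos2: "lip_family S V \<Longrightarrow> lip_family S (\<lambda>\<eta> x t. cos2 (s * \<eta> ^ 3) t (V \<eta> x t))"
  unfolding cos2_def by (intro lip_family_sinrem lip_family_half continuous_intros A_cont)

lemma lip_family_P: "lip_family S V \<Longrightarrow> lip_family S (\<lambda>\<eta> x t. P (s * \<eta> ^ 3) t (V \<eta> x t))"
  unfolding P_def by (intro lip_family_rules lip_family_sin2)

lemma lip_family_Q: "lip_family S V \<Longrightarrow> lip_family S Y \<Longrightarrow> lip_family S W \<Longrightarrow>
    lip_family S (\<lambda>\<eta> x t. Q (s * \<eta> ^ 3) t (V \<eta> x t) (Y \<eta> x t) (W \<eta> x t))"
  unfolding Q_def by (intro lip_family_rules lip_family_cos2)

lemma lip_family_H: "lip_family S V \<Longrightarrow> lip_family S Y \<Longrightarrow> lip_family S W \<Longrightarrow>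
    lip_family S (\<lambda>\<eta> x t. H (s * \<eta> ^ 3) t (V \<eta> x t) (Y \<eta> x t) (W \<eta> x t))"
  unfolding H_def divide_inverse by (intro lip_family_rules lip_family_sin2)

abbreviation pc :: "state \<Rightarrow> real \<Rightarrow> real" where "pc x \<equiv> apply_bcontfun (fst (snd x))"
abbreviation rc :: "state \<Rightarrow> real \<Rightarrow> real" where "rc x \<equiv> apply_bcontfun (fst (snd (snd x)))"
abbreviation uc :: "state \<Rightarrow> real \<Rightarrow> real" where "uc x \<equiv> apply_bcontfun (snd (snd (snd x)))"

text \<open>Here \<open>e = s * \<eta> ^ 3\<close> with \<open>s = 1\<close> or \<open>s = - 1\<close>. The remainders carry different powers of \<open>\<eta>\<close> so that all
  four components of the fixed-point map have Lipschitz constants of order \<open>\<eta>\<close>.\<close>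

definition V :: "real \<Rightarrow> state \<Rightarrow> real \<Rightarrow> real" where
  "V \<eta> x t = vs t + fst x * sech (k * t) + \<eta> * pc x t"

definition Y :: "real \<Rightarrow> state \<Rightarrow> real \<Rightarrow> real" where
  "Y \<eta> x t = ys t + \<eta>\<^sup>2 * rc x t"

definition W :: "real \<Rightarrow> state \<Rightarrow> real \<Rightarrow> real" where
  "W \<eta> x t = ws t + \<eta> * uc x t"

text \<open>\<open>Q\<close> without its order-zero part, divided by \<eta>. At \<eta> = 0 only the
  terms with \<open>pc\<close> and \<open>uc\<close> survive: this is the order-one response of the
  free parameter to the corrections of \<open>v\<close> and \<open>w\<close>.\<close>

definition E :: "real \<Rightarrow> real \<Rightarrow> state \<Rightarrow> real \<Rightarrow> real" where
  "E s \<eta> x t = k * \<sigma> / 2 * sech (k * t) * ((vs t + fst x * sech (k * t)) * \<eta> * rc x t + pc x t * Y \<eta> x t)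
     - s * \<eta>\<^sup>2 * k * \<sigma> * cos2 (s * \<eta> ^ 3) t (V \<eta> x t) * Y \<eta> x t + 4 * g t * uc x t"

text \<open>Obtained by solving \<open>b0 + fst x * b1 + \<eta> * pairing (E s \<eta> x) = 0\<close>
  for \<open>fst x\<close>.\<close>

definition N1 :: "real \<Rightarrow> real \<Rightarrow> state \<Rightarrow> real \<Rightarrow> real" where
  "N1 s \<eta> x t = - (1 / b1) * pairing (E s \<eta> x)"

definition N2 :: "real \<Rightarrow> real \<Rightarrow> state \<Rightarrow> real \<Rightarrow> real" where
  "N2 s \<eta> x = fwd (\<lambda>t. rc x t + s * \<eta> * P (s * \<eta> ^ 3) t (V \<eta> x t))"

text \<open>The factor \<open>\<eta>\<^sup>2\<close> in \<open>Y\<close>, the factor \<eta> in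
  \<open>fixed\<close> and the sign \<open>s\<close> here multiply to the full parameter
  \<open>s * \<eta> ^ 3\<close>.\<close>

definition N3 :: "real \<Rightarrow> real \<Rightarrow> state \<Rightarrow> real \<Rightarrow> real" where
  "N3 s \<eta> x t = s * bwd (\<lambda>t. Q (s * \<eta> ^ 3) t (V \<eta> x t) (Y \<eta> x t) (W \<eta> x t)) t"

definition N4 :: "real \<Rightarrow> real \<Rightarrow> state \<Rightarrow> real \<Rightarrow> real" where
  "N4 s \<eta> x t = 1 / (2 * z0) * (k * \<sigma> * sech (k * t) * rc x t
     + s * \<eta> * H (s * \<eta> ^ 3) t (V \<eta> x t) (Y \<eta> x t) (W \<eta> x t))"

definition fixed :: "real \<Rightarrow> real \<Rightarrow> state \<Rightarrow> bool" where
  "fixed s \<eta> x \<longleftrightarrow> fst x = a0 + \<eta> * N1 s \<eta> x 0 \<and> (\<forall>t. pc x t = \<eta> * N2 s \<eta> x t) \<and>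
     (\<forall>t. rc x t = \<eta> * N3 s \<eta> x t) \<and> (\<forall>t. uc x t = \<eta> * N4 s \<eta> x t)"

abbreviation x0 :: state where "x0 \<equiv> (a0, 0, 0, 0)"

lemmas lip_family_x = lip_family_coords [where ?a0.0 = a0]

lemma lip_family_VYW: "lip_family (cball x0 R) V" "lip_family (cball x0 R) Y" "lip_family (cball x0 R) W"
  unfolding V_def Y_def W_def by (intro lip_family_rules lip_family_x)+

lemma lip_family_N: "lip_family (cball x0 R) (N1 s)" "lip_family (cball x0 R) (N2 s)" "lip_family
    (cball x0 R) (N3 s)" "lip_family (cball x0 R) (N4 s)"
  "lip_family (cball x0 R) (E s)"
proof -
  show "lip_family (cball x0 R) (E s)"
    unfolding E_def by (intro lip_family_rules lip_family_x lip_family_VYW lip_family_cos2)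
  then show "lip_family (cball x0 R) (N1 s)"
    unfolding N1_def by (intro lip_family_rules)
  show "lip_family (cball x0 R) (N2 s)"
    unfolding N2_def by (intro lip_family_rules lip_family_x lip_family_VYW lip_family_P)
  show "lip_family (cball x0 R) (N3 s)"
    unfolding N3_def by (intro lip_family_rules lip_family_x lip_family_VYW lip_family_Q)
  show "lip_family (cball x0 R) (N4 s)"
    unfolding N4_def by (intro lip_family_rules lip_family_x lip_family_VYW lip_family_H)
qed

lemma unique_fixed:
  assumes "R > 0"
  shows "\<exists>\<delta>>0. \<forall>\<eta>. 0 < \<eta> \<and> \<eta> < \<delta> \<longrightarrow> (\<exists>!x. x \<in> cball x0 R \<and> fixed s \<eta> x)"
  using lip_family_fixpoint [OF assms lip_family_N(1-4)] unfolding fixed_def by simp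

text \<open>The terms of order zero in \<open>\<eta>\<close> of the solvability condition are affine in the free
  parameter \<open>fst x\<close>, because \<open>ys\<close> and \<open>ws\<close> do not depend on it.\<close>

lemma pairing_Q:
  assumes E: "bdd_cont M (E s \<eta> x)"
  shows "pairing (\<lambda>t. Q (s * \<eta> ^ 3) t (V \<eta> x t) (Y \<eta> x t) (W \<eta> x t)) = b0 + fst x * b1 + \<eta> * pairing
      (E s \<eta> x)"
proof -
  obtain B where B: "bdd_cont B ys" using ys_bdd_cont by blast
  obtain Bv where Bv: "bdd_cont Bv vs" using vs_bdd_cont by blast
  obtain Bw where Bw: "bdd_cont Bw ws" using ws_bdd_cont by blast
  note B' = bdd_cont_add [OF bdd_cont_mult [OF bdd_cont_mult [OF bdd_cont_cmult [OF sech_bdd_cont, of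
      "k * \<sigma> / 2"] Bv] B] bdd_cont_mult [OF bdd_cont_cmult [OF g, of 4] Bw]]
  note b = bdd_cont_mult [OF sech_bdd_cont bdd_cont_mult [OF sech_bdd_cont B]]
  have "Q (s * \<eta> ^ 3) t (V \<eta> x t) (Y \<eta> x t) (W \<eta> x t) =
     1 * (1 * (k * \<sigma> / 2 * sech (k * t) * vs t * ys t + 4 * g t * ws t)
        + (fst x * (k * \<sigma> / 2)) * (sech (k * t) * (sech (k * t) * ys t))) + \<eta> * E s \<eta> x t" for t
  proof -
    \<comment> \<open>Keeping the cosine remainder opaque stops the expansion of \<open>V\<close>
      from reaching its argument; the identity is then polynomial.\<close>
    define c where "c = cos2 (s * \<eta> ^ 3) t (V \<eta> x t)"
    show ?thesis
      unfolding Q_def E_def c_def [symmetric] unfolding V_def Y_def W_def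
      by (simp add: field_simps power2_eq_square power3_eq_cube)
  qed
  then have "(\<lambda>t. Q (s * \<eta> ^ 3) t (V \<eta> x t) (Y \<eta> x t) (W \<eta> x t)) =
     (\<lambda>t. 1 * (1 * (k * \<sigma> / 2 * sech (k * t) * vs t * ys t + 4 * g t * ws t)
        + (fst x * (k * \<sigma> / 2)) * (sech (k * t) * (sech (k * t) * ys t))) + \<eta> * E s \<eta> x t)"
    by (rule ext)
  then show ?thesis
    by (simp only: pairing_lincomb [OF bdd_cont_lincomb [OF B' b] E] pairing_lincomb [OF B' b] b0_def
        b1_def) simp
qed

lemma fixed_imp_scaled_solution:
  assumes x: "x \<in> cball x0 R" and \<eta>: "0 < \<eta>" "\<eta> \<le> 1" and s: "s * s = 1" and fx: "fixed s \<eta> x"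
  shows "scaled_solution (s * \<eta> ^ 3) (V \<eta> x) (Y \<eta> x) (W \<eta> x)"
proof -
  define e where "e = s * \<eta> ^ 3"
  define q where "q t = Q e t (V \<eta> x t) (Y \<eta> x t) (W \<eta> x t)" for t
  define f where "f t = rc x t + s * \<eta> * P e t (V \<eta> x t)" for t
  obtain B where B: "bdd_cont B q"
    unfolding q_def e_def by (rule lip_familyE [OF lip_family_Q [OF lip_family_VYW]]) (use x \<eta> in blast)
  obtain M where M: "bdd_cont M (E s \<eta> x)"
    by (rule lip_familyE [OF lip_family_N(5)]) (use x \<eta> in blast)
  obtain M2 where "bdd_cont M2 f"
    unfolding f_def e_def by (rule lip_familyE [OF lip_family_add [OF lip_family_x(3) lip_family_mult
        [OF lip_family_mult [OF lip_family_const lip_family_param] lip_family_P [OF lip_family_VYW(1)]]]])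
      (use x \<eta> in blast)
  note f = bdd_contD(1) [OF this]
  \<comment> \<open>\<open>bwd\<close> solves its equation only up to the constant
    \<open>k / pi * pairing q\<close>. The equation for the first coordinate is exactly what makes
    this constant vanish.\<close>
  have pq: "pairing q = 0"
  proof -
    have "pairing q = b0 + fst x * b1 + \<eta> * pairing (E s \<eta> x)"
      unfolding q_def e_def by (rule pairing_Q [OF M])
    also have "fst x = - b0 / b1 - \<eta> / b1 * pairing (E s \<eta> x)"
      using fx by (simp add: fixed_def N1_def a0_def)
    finally show ?thesis
      using b1_nz by (simp add: field_simps)
  qed
  have pc: "pc x t = \<eta> * fwd f t" for t
    using fx by (simp add: fixed_def N2_def f_def [abs_def] e_def)
  have rc: "rc x t = \<eta> * (s * bwd q t)" for t
    using fx by (simp add: fixed_def N3_def q_def [abs_def] e_def)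
  have uc: "2 * z0 * uc x t = \<eta> * (k * \<sigma> * sech (k * t) * rc x t + s * \<eta> * H e t (V \<eta> x t) (Y \<eta> x t)
      (W \<eta> x t))" for t
    using fx z0 by (simp add: fixed_def N4_def e_def)
  have V: "V \<eta> x = (\<lambda>t. vs t + fst x * sech (k * t) + \<eta>\<^sup>2 * fwd f t)"
    by (simp add: fun_eq_iff V_def pc power2_eq_square)
  have Y: "Y \<eta> x = (\<lambda>t. ys t + e * bwd q t)"
    by (simp add: fun_eq_iff Y_def rc e_def power2_eq_square power3_eq_cube)
  have eqf: "\<eta>\<^sup>2 * f t = e * bwd q t + e * P e t (V \<eta> x t)" for t
    by (simp add: f_def rc e_def power2_eq_square power3_eq_cube algebra_simps)
  have "(V \<eta> x has_real_derivative (ys t - k * tanh (k * t) * vs t) + fst x * (- (tanh (k * t) * sech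
      (k * t)) * k)
      + \<eta>\<^sup>2 * (f t - k * tanh (k * t) * fwd f t)) (at t)" for t
    unfolding V by (auto intro!: derivative_eq_intros vs_deriv fwd_deriv f)
  moreover have "(ys t - k * tanh (k * t) * vs t) + fst x * (- (tanh (k * t) * sech (k * t)) * k)
      + \<eta>\<^sup>2 * (f t - k * tanh (k * t) * fwd f t) = Y \<eta> x t + e * P e t (V \<eta> x t) - k * tanh (k * t) *
          V \<eta> x t" for t
  proof -
    have "(ys t - k * tanh (k * t) * vs t) + fst x * (- (tanh (k * t) * sech (k * t)) * k)
      + \<eta>\<^sup>2 * (f t - k * tanh (k * t) * fwd f t) = ys t + \<eta>\<^sup>2 * f t - k * tanh (k * t) * (vs t + fst x
          * sech (k * t) + \<eta>\<^sup>2 * fwd f t)"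
      by (simp add: algebra_simps)
    then show ?thesis
      unfolding eqf by (simp add: fun_cong [OF V] fun_cong [OF Y])
  qed
  ultimately have v': "(V \<eta> x has_real_derivative Y \<eta> x t + e * P e t (V \<eta> x t) - k * tanh (k * t) * V
      \<eta> x t) (at t)" for t
    by metis
  have "(Y \<eta> x has_real_derivative (4 * z0 * g t + k * tanh (k * t) * ys t) + e * (q t + k * tanh (k *
      t) * bwd q t - k / pi * pairing q)) (at t)" for t
    unfolding Y by (auto intro!: derivative_eq_intros ys_deriv bwd_deriv B)
  moreover have "(4 * z0 * g t + k * tanh (k * t) * ys t) + e * (q t + k * tanh (k * t) * bwd q t - k
      / pi * pairing q)
      = 4 * z0 * g t + e * q t + k * tanh (k * t) * Y \<eta> x t" for t
    unfolding Y pq by (simp add: algebra_simps)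
  ultimately have y': "(Y \<eta> x has_real_derivative 4 * z0 * g t + e * q t + k * tanh (k * t) * Y \<eta> x t)
      (at t)" for t
    by metis
  have w: "2 * z0 * W \<eta> x t = k * \<sigma> * sech (k * t) * Y \<eta> x t + e * H e t (V \<eta> x t) (Y \<eta> x t) (W \<eta> x t)" for t
  proof -
    have "2 * z0 * W \<eta> x t = 2 * z0 * ws t + \<eta> * (2 * z0 * uc x t)"
      by (simp add: W_def algebra_simps)
    also have "2 * z0 * ws t = k * \<sigma> * sech (k * t) * ys t"
      using z0 by (simp add: ws_def)
    finally show ?thesis
      unfolding uc by (simp add: Y_def e_def power2_eq_square power3_eq_cube algebra_simps)
  qed
  obtain C where "bdd_cont C (W \<eta> x)"
    by (rule lip_familyE [OF lip_family_VYW(3)]) (use x \<eta> in blast)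
  with v' y' w show ?thesis
    unfolding scaled_solution_def q_def e_def by (auto dest: bdd_contD)
qed

text \<open>Boundedness forces the solvability condition, after which \<open>bwd\<close> and
  \<open>fwd\<close> reconstruct the remainders. The free parameter is \<open>v 0\<close>, because
  \<open>vs\<close> and every \<open>fwd\<close> vanish at 0. The radius is chosen before the sign,
  \<eta> and the solution, so uniqueness in one ball covers all solutions with the bound
  \<open>B\<close>.\<close>

lemma scaled_solution_imp_fixed:
  assumes "B > 0"
  shows "\<exists>R>0. \<forall>s \<eta> v y w. (s = 1 \<or> s = - 1) \<longrightarrow> 0 < \<eta> \<longrightarrow> \<eta> \<le> 1 \<longrightarrow> scaled_solution (s * \<eta> ^ 3) v y w \<longrightarrow>
    (\<forall>t. \<bar>v t\<bar> \<le> B \<and> \<bar>y t\<bar> \<le> B \<and> \<bar>w t\<bar> \<le> B) \<longrightarrow>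
    (\<exists>x\<in>cball x0 R. fixed s \<eta> x \<and> v = V \<eta> x \<and> y = Y \<eta> x \<and> w = W \<eta> x)"
proof -
  \<comment> \<open>The functions \<open>v\<close>, \<open>y\<close>, \<open>w\<close> themselves
    will be packed into a state with a dummy first coordinate, so that the uniform family bounds
    apply to them; \<open>3 * B\<close> adds up their three sup norms.\<close>
  define S where "S = cball ((0, 0, 0, 0) :: state) (3 * B)"
  define r where "r s \<eta> x t = \<eta> * (s * bwd (\<lambda>t. Q (s * \<eta> ^ 3) t (pc x t) (rc x t) (uc x t)) t)" for s \<eta> x t
  define p where "p s \<eta> x t = \<eta> * fwd (\<lambda>t. r s \<eta> x t + s * \<eta> * P (s * \<eta> ^ 3) t (pc x t)) t" for s \<eta> x t
  define u where "u s \<eta> x t = \<eta> * (1 / (2 * z0) * (k * \<sigma> * sech (k * t) * r s \<eta> x t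
     + s * \<eta> * H (s * \<eta> ^ 3) t (pc x t) (rc x t) (uc x t)))" for s \<eta> x t
  note co = lip_family_coords [where ?a0.0 = 0 and R = "3 * B", folded S_def]
  have nr: "lip_family S (r s)" for s
    unfolding r_def [abs_def] by (intro lip_family_rules lip_family_Q co)
  have np: "lip_family S (p s)" for s
    unfolding p_def [abs_def] by (intro lip_family_rules lip_family_P co nr)
  have nu: "lip_family S (u s)" for s
    unfolding u_def [abs_def] by (intro lip_family_rules lip_family_H co nr)
  have bd: "\<exists>M\<ge>0. \<forall>s \<eta> x. (s = 1 \<or> s = - 1) \<longrightarrow> 0 < \<eta> \<longrightarrow> \<eta> \<le> 1 \<longrightarrow> x \<in> S \<longrightarrow> bdd_cont M (N s \<eta> x)"
    if n: "\<And>s. lip_family S (N s)" for N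
  proof -
    obtain M1 where M1: "M1 \<ge> 0" "\<And>\<eta> x. 0 < \<eta> \<Longrightarrow> \<eta> \<le> 1 \<Longrightarrow> x \<in> S \<Longrightarrow> bdd_cont M1 (N 1 \<eta> x)"
      by (rule lip_familyE [OF n [of 1]]) blast
    obtain M2 where M2: "M2 \<ge> 0" "\<And>\<eta> x. 0 < \<eta> \<Longrightarrow> \<eta> \<le> 1 \<Longrightarrow> x \<in> S \<Longrightarrow> bdd_cont M2 (N (- 1) \<eta> x)"
      by (rule lip_familyE [OF n [of "- 1"]]) blast
    show ?thesis
    proof (intro exI [of _ "M1 + M2"] conjI allI impI)
      show "bdd_cont (M1 + M2) (N s \<eta> x)" if "s = 1 \<or> s = - 1" "0 < \<eta>" "\<eta> \<le> 1" "x \<in> S" for s \<eta> x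
        using that(1) M1(1) M2(1) bdd_cont_mono [OF M1(2) [OF that(2-4)], of "M1 + M2"] bdd_cont_mono
            [OF M2(2) [OF that(2-4)], of "M1 + M2"]
        by auto
    qed (use M1 M2 in auto)
  qed
  obtain Mr where Mr: "Mr \<ge> 0" "\<And>s \<eta> x. s = 1 \<or> s = - 1 \<Longrightarrow> 0 < \<eta> \<Longrightarrow> \<eta> \<le> 1 \<Longrightarrow> x \<in> S \<Longrightarrow> bdd_cont Mr (r s \<eta> x)"
    using bd [of r, OF nr] by blast
  obtain Mp where Mp: "Mp \<ge> 0" "\<And>s \<eta> x. s = 1 \<or> s = - 1 \<Longrightarrow> 0 < \<eta> \<Longrightarrow> \<eta> \<le> 1 \<Longrightarrow> x \<in> S \<Longrightarrow> bdd_cont Mp (p s \<eta> x)"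
    using bd [of p, OF np] by blast
  obtain Mu where Mu: "Mu \<ge> 0" "\<And>s \<eta> x. s = 1 \<or> s = - 1 \<Longrightarrow> 0 < \<eta> \<Longrightarrow> \<eta> \<le> 1 \<Longrightarrow> x \<in> S \<Longrightarrow> bdd_cont Mu (u s \<eta> x)"
    using bd [of u, OF nu] by blast
  \<comment> \<open>\<open>|a0| + B\<close> covers the distance from \<open>a0\<close> to
    \<open>v 0\<close>; the other summands bound the three reconstructed remainders.\<close>
  define R where "R = \<bar>a0\<bar> + B + Mp + Mr + Mu"
  show ?thesis
  proof (intro exI [of _ R] conjI allI impI)
    show "R > 0"
      using assms Mr(1) Mp(1) Mu(1) by (simp add: R_def)
    fix s \<eta> v y w
    assume s: "s = 1 \<or> s = - 1" and \<eta>: "0 < \<eta>" "\<eta> \<le> 1" and sol: "scaled_solution (s * \<eta> ^ 3) v y w"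
      and b: "\<forall>t. \<bar>v t\<bar> \<le> B \<and> \<bar>y t\<bar> \<le> B \<and> \<bar>w t\<bar> \<le> B"
    define e where "e = s * \<eta> ^ 3"
    have e: "e \<noteq> 0"
      using s \<eta> by (auto simp: e_def)
    have v': "(v has_real_derivative y t + e * P e t (v t) - k * tanh (k * t) * v t) (at t)"
      and y': "(y has_real_derivative 4 * z0 * g t + e * Q e t (v t) (y t) (w t) + k * tanh (k * t) *
          y t) (at t)"
      and w: "2 * z0 * w t = k * \<sigma> * sech (k * t) * y t + e * H e t (v t) (y t) (w t)" for t
      using sol by (auto simp: scaled_solution_def e_def)
    have bv: "bdd_cont B v" and "by": "bdd_cont B y" and bw: "bdd_cont B w"
      using b sol DERIV_continuous_on [OF has_field_derivative_at_within [OF v']]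
        DERIV_continuous_on [OF has_field_derivative_at_within [OF y']]
      by (auto simp: bdd_cont_def scaled_solution_def)
    define X :: state where "X = (0, Bcontfun v, Bcontfun y, Bcontfun w)"
    have X: "pc X = v" "rc X = y" "uc X = w"
      by (simp_all add: X_def apply_Bcontfun [OF bv] apply_Bcontfun [OF "by"] apply_Bcontfun [OF bw])
    have "dist (0, 0, 0, 0) X \<le> 0 + B + B + B"
      using b by (intro dist_state_le [THEN order_trans] add_mono dist_bound)
        (auto simp: X [unfolded X_def, simplified] X_def zero_bcontfun.rep_eq dist_real_def)
    then have XS: "X \<in> S"
      by (simp add: S_def)
    define q where "q t = Q e t (v t) (y t) (w t)" for t
    obtain M where M: "bdd_cont M q"
      unfolding q_def e_def X [symmetric] by (rule lip_familyE [OF lip_family_Q [OF co(2-4)]]) (use XS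
          \<eta> in blast)
    note gb = bdd_cont_lincomb [OF g M, of "4 * z0" e]
    have pq: "pairing q = 0" and yq: "y t = ys t + e * bwd q t" for t
    proof -
      have d: "(y has_real_derivative (4 * z0 * g t + e * q t) + k * tanh (k * t) * y t) (at t)" for t
        using y' by (simp add: q_def)
      from bwd_unique(1) [OF gb d] b have "pairing (\<lambda>t. 4 * z0 * g t + e * q t) = 0"
        by blast
      then show "pairing q = 0"
        unfolding pairing_lincomb [OF g M] melnikov_zero using e by simp
      from bwd_unique(2) [OF gb d] b have "y t = bwd (\<lambda>t. 4 * z0 * g t + e * q t) t" for t
        by blast
      then show "y t = ys t + e * bwd q t" for t
        using bwd_lincomb [OF bdd_cont_cmult [OF g, of "4 * z0"] M, of 1 e] by (simp add: ys_def)
    qed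
    have rq: "r s \<eta> X t = \<eta> * (s * bwd q t)" for t
      by (simp add: r_def X q_def [abs_def] e_def)
    define f where "f t = r s \<eta> X t + s * \<eta> * P e t (v t)" for t
    have fp: "p s \<eta> X t = \<eta> * fwd f t" for t
      by (simp add: p_def X f_def [abs_def] e_def)
    have f: "continuous_on UNIV f"
    proof -
      obtain M where "bdd_cont M f"
        unfolding f_def e_def X [symmetric] by (rule lip_familyE [OF lip_family_add [OF nr
            lip_family_mult [OF lip_family_mult [OF lip_family_const lip_family_param] lip_family_P
            [OF co(2)]]]])
          (use XS \<eta> in blast)
      then show ?thesis by (rule bdd_contD)
    qed
    have yf: "y t + e * P e t (v t) = 1 * ys t + \<eta>\<^sup>2 * f t" for t
      unfolding yq f_def rq by (simp add: e_def power2_eq_square power3_eq_cube algebra_simps)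
    have vq: "v t = vs t + v 0 * sech (k * t) + \<eta> * p s \<eta> X t" for t
    proof -
      have c: "continuous_on UNIV ys"
        using ys_bdd_cont bdd_contD by blast
      have "v t = v 0 * sech (k * t) + fwd (\<lambda>t. 1 * ys t + \<eta>\<^sup>2 * f t) t"
        using v' unfolding yf by (intro fwd_unique continuous_intros c f)
      then show ?thesis
        unfolding fwd_lincomb [OF c f] fp by (simp add: vs_def power2_eq_square)
    qed
    have wq: "w t = ws t + \<eta> * u s \<eta> X t" for t
    proof -
      have "2 * z0 * w t = k * \<sigma> * sech (k * t) * ys t + \<eta> * (\<eta> * (k * \<sigma> * sech (k * t) * r s \<eta> X t +
          s * \<eta> * H e t (v t) (y t) (w t)))"
        unfolding w yq [of t] rq by (simp add: e_def power2_eq_square power3_eq_cube algebra_simps)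
      also have "\<dots> = 2 * z0 * (ws t + \<eta> * u s \<eta> X t)"
        using z0 by (simp add: ws_def u_def X e_def field_simps)
      finally show ?thesis
        using z0 by simp
    qed
    define x :: state where "x = (v 0, Bcontfun (p s \<eta> X), Bcontfun (r s \<eta> X), Bcontfun (u s \<eta> X))"
    note br = Mr(2) [OF s \<eta> XS] and bp = Mp(2) [OF s \<eta> XS] and bu = Mu(2) [OF s \<eta> XS]
    have x: "fst x = v 0" "pc x = p s \<eta> X" "rc x = r s \<eta> X" "uc x = u s \<eta> X"
      by (simp_all add: x_def apply_Bcontfun [OF bp] apply_Bcontfun [OF br] apply_Bcontfun [OF bu])
    have "dist x0 x \<le> (\<bar>a0\<bar> + B) + Mp + Mr + Mu"
    proof (intro dist_state_le [THEN order_trans] add_mono dist_bound)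
      show "dist (fst x0) (fst x) \<le> \<bar>a0\<bar> + B"
        using b [rule_format, of 0] by (auto simp: x dist_real_def)
    qed (use bdd_contD(2) [OF bp] bdd_contD(2) [OF br] bdd_contD(2) [OF bu] in \<open>simp_all add: x
        zero_bcontfun.rep_eq dist_real_def\<close>)
    then have xR: "x \<in> cball x0 R"
      by (simp add: R_def)
    have VYW: "v = V \<eta> x" "y = Y \<eta> x" "w = W \<eta> x"
    proof -
      show "v = V \<eta> x"
        unfolding V_def [abs_def] x by (rule ext) (rule vq)
      show "w = W \<eta> x"
        unfolding W_def [abs_def] x by (rule ext) (rule wq)
      show "y = Y \<eta> x"
        unfolding Y_def [abs_def] x rq using yq
        by (simp add: fun_eq_iff e_def power2_eq_square power3_eq_cube)
    qed
    obtain ME where ME: "bdd_cont ME (E s \<eta> x)"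
      by (rule lip_familyE [OF lip_family_N(5)]) (use xR \<eta> in blast)
    have "0 = b0 + fst x * b1 + \<eta> * pairing (E s \<eta> x)"
      using pairing_Q [OF ME] pq unfolding q_def e_def VYW by simp
    then have "fst x = a0 + \<eta> * N1 s \<eta> x 0"
      using b1_nz by (simp add: a0_def N1_def field_simps)
    moreover have "pc x t = \<eta> * N2 s \<eta> x t" for t
      unfolding N2_def VYW [symmetric] x using fp [of t] by (simp add: f_def [abs_def] e_def)
    moreover have "rc x t = \<eta> * N3 s \<eta> x t" for t
      unfolding N3_def VYW [symmetric] x rq by (simp add: q_def [abs_def] e_def)
    moreover have "uc x t = \<eta> * N4 s \<eta> x t" for t
      unfolding N4_def VYW [symmetric] x by (simp add: u_def X)
    ultimately show "\<exists>x\<in>cball x0 R. fixed s \<eta> x \<and> v = V \<eta> x \<and> y = Y \<eta> x \<and> w = W \<eta> x"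
      unfolding fixed_def using xR VYW by blast
  qed
qed

section \<open>Existence and uniqueness for the scaled system\<close>

lemma signed_cube_root:
  fixes e :: real
  assumes "e \<noteq> 0"
  obtains s \<eta> where "s = 1 \<or> s = - 1" "0 < \<eta>" "\<eta> ^ 3 = \<bar>e\<bar>" "e = s * \<eta> ^ 3"
proof (rule that)
  show "sgn e = 1 \<or> sgn e = - 1"
    using assms by (auto simp: sgn_if)
  show "0 < root 3 \<bar>e\<bar>"
    using assms by simp
  show "root 3 \<bar>e\<bar> ^ 3 = \<bar>e\<bar>"
    by (simp add: real_root_pow_pos2)
  then show "e = sgn e * root 3 \<bar>e\<bar> ^ 3"
    by (simp add: sgn_mult_abs)
qed

lemma unique_fixed_both:
  assumes "R > 0"
  obtains \<delta> where "0 < \<delta>" "\<delta> \<le> 1"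
    "\<And>s \<eta>. s = 1 \<or> s = - 1 \<Longrightarrow> 0 < \<eta> \<Longrightarrow> \<eta> ^ 3 < \<delta> \<Longrightarrow> \<eta> \<le> 1 \<and> (\<exists>!x. x \<in> cball x0 R \<and> fixed s \<eta> x)"
proof -
  obtain \<delta>1 where 1: "\<delta>1 > 0" "\<forall>\<eta>. 0 < \<eta> \<and> \<eta> < \<delta>1 \<longrightarrow> (\<exists>!x. x \<in> cball x0 R \<and> fixed 1 \<eta> x)"
    using unique_fixed [OF assms, of 1] by (elim exE conjE) (rule that)
  obtain \<delta>2 where 2: "\<delta>2 > 0" "\<forall>\<eta>. 0 < \<eta> \<and> \<eta> < \<delta>2 \<longrightarrow> (\<exists>!x. x \<in> cball x0 R \<and> fixed (- 1) \<eta> x)"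
    using unique_fixed [OF assms, of "- 1"] by (elim exE conjE) (rule that)
  define m where "m = min 1 (min \<delta>1 \<delta>2)"
  have m: "m > 0" "m \<le> 1" "m \<le> \<delta>1" "m \<le> \<delta>2"
    using 1(1) 2(1) by (auto simp: m_def)
  show thesis
  \<comment> \<open>The threshold for \<eta> becomes a threshold for its cube |e|, common to both
    signs.\<close>
  proof (rule that [of "m ^ 3"])
    show "0 < m ^ 3" "m ^ 3 \<le> 1"
      using m by (auto intro: power_le_one)
    fix s \<eta> :: real assume s: "s = 1 \<or> s = - 1" and \<eta>: "0 < \<eta>" "\<eta> ^ 3 < m ^ 3"
    then have "\<eta> < m"
      using m by (intro power_less_imp_less_base [of \<eta> 3 m]) auto
    then have "\<eta> \<le> 1" "\<eta> < \<delta>1" "\<eta> < \<delta>2"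
      using m by auto
    then show "\<eta> \<le> 1 \<and> (\<exists>!x. x \<in> cball x0 R \<and> fixed s \<eta> x)"
      using s 1(2) [rule_format, OF conjI, OF \<eta>(1)] 2(2) [rule_format, OF conjI, OF \<eta>(1)] by (elim
          disjE) simp_all
  qed
qed

text \<open>The unit ball is an arbitrary choice: fixing any radius gives a bound \<open>B\<close>
  that does not depend on \<open>e\<close>.\<close>

lemma scaled_solution_exists:
  "\<exists>B>0. \<exists>\<delta>>0. \<forall>e. e \<noteq> 0 \<and> \<bar>e\<bar> < \<delta> \<longrightarrow>
     (\<exists>v y w. scaled_solution e v y w \<and> (\<forall>t. \<bar>v t\<bar> \<le> B \<and> \<bar>y t\<bar> \<le> B \<and> \<bar>w t\<bar> \<le> B))"
proof -
  obtain \<delta> where \<delta>: "0 < \<delta>" "\<delta> \<le> 1"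
    "\<And>s \<eta>. s = 1 \<or> s = - 1 \<Longrightarrow> 0 < \<eta> \<Longrightarrow> \<eta> ^ 3 < \<delta> \<Longrightarrow> \<eta> \<le> 1 \<and> (\<exists>!x. x \<in> cball x0 1 \<and> fixed s \<eta> x)"
    using unique_fixed_both [of 1] by auto
  obtain B1 where B1: "B1 \<ge> 0" "\<And>\<eta> x. 0 < \<eta> \<Longrightarrow> \<eta> \<le> 1 \<Longrightarrow> x \<in> cball x0 1 \<Longrightarrow> bdd_cont B1 (V \<eta> x)"
    by (rule lip_familyE [OF lip_family_VYW(1)]) blast
  obtain B2 where B2: "B2 \<ge> 0" "\<And>\<eta> x. 0 < \<eta> \<Longrightarrow> \<eta> \<le> 1 \<Longrightarrow> x \<in> cball x0 1 \<Longrightarrow> bdd_cont B2 (Y \<eta> x)"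
    by (rule lip_familyE [OF lip_family_VYW(2)]) blast
  obtain B3 where B3: "B3 \<ge> 0" "\<And>\<eta> x. 0 < \<eta> \<Longrightarrow> \<eta> \<le> 1 \<Longrightarrow> x \<in> cball x0 1 \<Longrightarrow> bdd_cont B3 (W \<eta> x)"
    by (rule lip_familyE [OF lip_family_VYW(3)]) blast
  define B where "B = B1 + B2 + B3 + 1"
  show ?thesis
  proof (rule exI [of _ B], intro conjI exI [of _ \<delta>] allI impI)
    fix e assume e: "e \<noteq> 0 \<and> \<bar>e\<bar> < \<delta>"
    then obtain s \<eta> where s: "s = 1 \<or> s = - 1" and \<eta>: "0 < \<eta>" "\<eta> ^ 3 = \<bar>e\<bar>" and es: "e = s * \<eta> ^ 3"
      using signed_cube_root by metis
    then have \<eta>1: "\<eta> \<le> 1" and "\<exists>!x. x \<in> cball x0 1 \<and> fixed s \<eta> x"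
      using \<delta>(3) [OF s \<eta>(1)] e by simp_all
    then obtain x where x: "x \<in> cball x0 1" "fixed s \<eta> x"
      by (elim ex1E conjE) (rule that)
    have "scaled_solution e (V \<eta> x) (Y \<eta> x) (W \<eta> x)"
      unfolding es using s by (intro fixed_imp_scaled_solution [OF x(1) \<eta>(1) \<eta>1 _ x(2)]) auto
    moreover have "\<bar>V \<eta> x t\<bar> \<le> B" "\<bar>Y \<eta> x t\<bar> \<le> B" "\<bar>W \<eta> x t\<bar> \<le> B" for t
      using bdd_contD(2) [OF B1(2) [OF \<eta>(1) \<eta>1 x(1)], of t] bdd_contD(2) [OF B2(2) [OF \<eta>(1) \<eta>1 x(1)], of t]
        bdd_contD(2) [OF B3(2) [OF \<eta>(1) \<eta>1 x(1)], of t] B1(1) B2(1) B3(1) by (auto simp: B_def)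
    ultimately show "\<exists>v y w. scaled_solution e v y w \<and> (\<forall>t. \<bar>v t\<bar> \<le> B \<and> \<bar>y t\<bar> \<le> B \<and> \<bar>w t\<bar> \<le> B)"
      by blast
  qed (use \<delta> B1 B2 B3 in \<open>auto simp: B_def\<close>)
qed

lemma scaled_solution_unique:
  assumes "B > 0"
  shows "\<exists>\<delta>>0. \<forall>e v y w v' y' w'. e \<noteq> 0 \<longrightarrow> \<bar>e\<bar> < \<delta> \<longrightarrow> scaled_solution e v y w \<longrightarrow> scaled_solution e v' y' w' \<longrightarrow>
     (\<forall>t. \<bar>v t\<bar> \<le> B \<and> \<bar>y t\<bar> \<le> B \<and> \<bar>w t\<bar> \<le> B) \<longrightarrow> (\<forall>t. \<bar>v' t\<bar> \<le> B \<and> \<bar>y' t\<bar> \<le> B \<and> \<bar>w' t\<bar> \<le> B) \<longrightarrow>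
     v = v' \<and> w = w'"
proof -
  obtain R where R: "R > 0" "\<And>s \<eta> v y w. s = 1 \<or> s = - 1 \<Longrightarrow> 0 < \<eta> \<Longrightarrow> \<eta> \<le> 1 \<Longrightarrow> scaled_solution (s * \<eta> ^ 3) v y w \<Longrightarrow>
    \<forall>t. \<bar>v t\<bar> \<le> B \<and> \<bar>y t\<bar> \<le> B \<and> \<bar>w t\<bar> \<le> B \<Longrightarrow>
    \<exists>x\<in>cball x0 R. fixed s \<eta> x \<and> v = V \<eta> x \<and> y = Y \<eta> x \<and> w = W \<eta> x"
    using scaled_solution_imp_fixed [OF assms] by blast
  obtain \<delta> where \<delta>: "0 < \<delta>" "\<delta> \<le> 1"
    "\<And>s \<eta>. s = 1 \<or> s = - 1 \<Longrightarrow> 0 < \<eta> \<Longrightarrow> \<eta> ^ 3 < \<delta> \<Longrightarrow> \<eta> \<le> 1 \<and> (\<exists>!x. x \<in> cball x0 R \<and> fixed s \<eta> x)"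
    using unique_fixed_both [OF R(1)] by auto
  show ?thesis
  proof (intro exI [of _ \<delta>] conjI allI impI \<delta>(1))
    fix e v y w v' y' w'
    assume e: "e \<noteq> 0" "\<bar>e\<bar> < \<delta>" and sol: "scaled_solution e v y w" "scaled_solution e v' y' w'"
      and b: "\<forall>t. \<bar>v t\<bar> \<le> B \<and> \<bar>y t\<bar> \<le> B \<and> \<bar>w t\<bar> \<le> B" "\<forall>t. \<bar>v' t\<bar> \<le> B \<and> \<bar>y' t\<bar> \<le> B \<and> \<bar>w' t\<bar> \<le> B"
    obtain s \<eta> where s: "s = 1 \<or> s = - 1" and \<eta>: "0 < \<eta>" "\<eta> ^ 3 = \<bar>e\<bar>" and es: "e = s * \<eta> ^ 3"
      using signed_cube_root [OF e(1)] by metis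
    then have \<eta>1: "\<eta> \<le> 1" and un: "\<exists>!x. x \<in> cball x0 R \<and> fixed s \<eta> x"
      using \<delta>(3) [OF s \<eta>(1)] e by simp_all
    from R(2) [OF s \<eta>(1) \<eta>1 sol(1) [unfolded es] b(1)] R(2) [OF s \<eta>(1) \<eta>1 sol(2) [unfolded es] b(2)] un
    show "v = v'" "w = w'"
      by metis+
  qed
qed

end

section \<open>Solutions near the heteroclinic orbits\<close>

text \<open>A Landau-type interpolation on a unit interval: the mean value theorem finds a slope of
  size at most \<open>2 * C\<close>, and the slope changes by at most \<open>M\<close> on the way
  there.\<close>

lemma bounded_derivative_of_bounded_second:
  fixes v :: "real \<Rightarrow> real"
  assumes "\<And>t. (v has_real_derivative v1 t) (at t)" "\<And>t. (v1 has_real_derivative v2 t) (at t)"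
    "\<And>t. \<bar>v t\<bar> \<le> C" "\<And>t. \<bar>v2 t\<bar> \<le> M"
  shows "\<bar>v1 t\<bar> \<le> 2 * C + M"
proof -
  obtain x where x: "t < x" "x < t + 1" "v (t + 1) - v t = (t + 1 - t) * v1 x"
    using MVT2 [of t "t + 1" v v1] assms(1) by auto
  obtain y where y: "v1 x - v1 t = (x - t) * v2 y"
    using MVT2 [of t x v1 v2] assms(2) x by auto
  have "\<bar>(x - t) * v2 y\<bar> \<le> 1 * M"
    unfolding abs_mult using x assms(4) by (intro mult_mono) auto
  then show ?thesis
    using x(3) y assms(3) [of t] assms(3) [of "t + 1"] by auto
qed

context melnikov begin

section \<open>Passing between the original and the scaled system\<close>

definition solution :: "real \<Rightarrow> (real \<Rightarrow> real) \<Rightarrow> (real \<Rightarrow> real) \<Rightarrow> (real \<Rightarrow> real) \<Rightarrow> bool" where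
  "solution e \<psi> D z \<longleftrightarrow> (\<forall>t. (\<psi> has_real_derivative D t) (at t) \<and>
     (D has_real_derivative k\<^sup>2 * sin (\<psi> t) + 4 * e * g t * z t) (at t) \<and>
     (z has_real_derivative e * g t * D t) (at t) \<and>
     (D t)\<^sup>2 / 2 - k\<^sup>2 * (1 - cos (\<psi> t)) - 2 * (z t)\<^sup>2 = - 2 * z0\<^sup>2)"

lemma half_angle: "sin x = 2 * sin (x / 2) * cos (x / 2)" "1 - cos x = 2 * (sin (x / 2))\<^sup>2" for x :: real
  using sin_double [of "x / 2"] cos_double_sin [of "x / 2"] by simp_all

text \<open>Each factor vanishes on one of the two heteroclinic orbits.\<close>

lemma energy_factor:
  "D\<^sup>2 / 2 - k\<^sup>2 * (1 - cos x) = (D - 2 * k * \<sigma> * sin (x / 2)) * (D + 2 * k * \<sigma> * sin (x / 2)) / 2"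
proof -
  have "(D - 2 * k * \<sigma> * S) * (D + 2 * k * \<sigma> * S) / 2 = D\<^sup>2 / 2 - 2 * (\<sigma> * \<sigma>) * k\<^sup>2 * S\<^sup>2" for S
    by (simp del: \<sigma>_sq add: power2_eq_square algebra_simps diff_divide_distrib)
  then show ?thesis
    by (simp add: half_angle(2))
qed

text \<open>The defect of the level set is \<open>2 * e\<close> times the defect of the equation for
  \<open>w\<close>, so the two are equivalent for nonzero \<open>e\<close>.\<close>

lemma H_eq:
  "e \<noteq> 0 \<Longrightarrow> 2 * z0 * w = k * \<sigma> * sech (k * t) * y + e * H e t v y w \<longleftrightarrow>
     e * y * (e * y + 4 * k * \<sigma> * sin (A t + e * v / 2)) / 2 - 2 * (z0 + e * w)\<^sup>2 = - 2 * z0\<^sup>2"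
proof -
  assume e: "e \<noteq> 0"
  have "e * y * (e * y + 4 * k * \<sigma> * sin (A t + e * v / 2)) / 2 - 2 * (z0 + e * w)\<^sup>2 - (- 2 * z0\<^sup>2)
     = 2 * e * (k * \<sigma> * sech (k * t) * y + e * H e t v y w - 2 * z0 * w)"
    by (simp add: sin_A_plus H_def power2_eq_square algebra_simps add_divide_distrib diff_divide_distrib)
  then show ?thesis
    using e by (metis (no_types, opaque_lifting) add_diff_cancel_right' diff_0_right eq_iff_diff_eq_0
        mult_eq_0_iff zero_neq_numeral)
qed

lemma v_field:
  "2 * k * \<sigma> * sin (A t + e * v / 2) + e * y = 2 * (\<sigma> * k * sech (k * t)) + e * (y + e * P e t v - k *
      tanh (k * t) * v)"
  by (simp add: sin_A_plus P_def algebra_simps)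

text \<open>The right-hand side is the derivative of \<psi>' minus
  \<open>2 * k * \<sigma> * sin (\<psi> / 2)\<close>: by the double-angle formula the pendulum force
  cancels against the derivative of the subtracted term.\<close>

lemma y_field:
  "e * (4 * z0 * g t + e * Q e t v y w + k * tanh (k * t) * y) = 4 * e * g t * (z0 + e * w) - k * \<sigma> *
      cos (A t + e * v / 2) * (e * y)"
  by (simp add: cos_A_plus Q_def algebra_simps)

text \<open>In a scaled solution \<open>w\<close> is merely continuous and tied to the level set, so
  the equation for \<open>z\<close> must be recovered. The smallness assumption keeps
  \<open>z\<close> nonzero with the sign of \<open>z0\<close>, and on this branch the level set can
  be solved for \<open>z\<close> and differentiated.\<close>

lemma solution_of_scaled:
  assumes sol: "scaled_solution e v y w" and e: "e \<noteq> 0" and small: "\<And>t. \<bar>e * w t\<bar> < \<bar>z0\<bar>"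
  shows "\<exists>D. solution e (\<lambda>t. 2 * A t + e * v t) D (\<lambda>t. z0 + e * w t)"
proof -
  define \<psi> where "\<psi> t = 2 * A t + e * v t" for t
  define z where "z t = z0 + e * w t" for t
  define D where "D t = 2 * k * \<sigma> * sin (\<psi> t / 2) + e * y t" for t
  have half: "\<psi> t / 2 = A t + e * v t / 2" for t
    by (simp add: \<psi>_def add_divide_distrib)
  have v': "(v has_real_derivative y t + e * P e t (v t) - k * tanh (k * t) * v t) (at t)"
    and y': "(y has_real_derivative 4 * z0 * g t + e * Q e t (v t) (y t) (w t) + k * tanh (k * t) * y
        t) (at t)"
    and w: "2 * z0 * w t = k * \<sigma> * sech (k * t) * y t + e * H e t (v t) (y t) (w t)" for t
    using sol by (auto simp: scaled_solution_def)
  have "(\<psi> has_real_derivative 2 * (\<sigma> * k * sech (k * t)) + e * (y t + e * P e t (v t) - k * tanh (k *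
      t) * v t)) (at t)" for t
    unfolding \<psi>_def by (intro DERIV_add DERIV_cmult A_deriv v')
  then have \<psi>': "(\<psi> has_real_derivative D t) (at t)" for t
    unfolding v_field [symmetric] D_def half .
  have "((\<lambda>t. \<psi> t / 2) has_real_derivative D t / 2) (at t)" for t
    by (intro DERIV_cdivide \<psi>')
  then have "((\<lambda>t. sin (\<psi> t / 2)) has_real_derivative cos (\<psi> t / 2) * (D t / 2)) (at t)" for t
    by (rule DERIV_chain2 [OF DERIV_sin])
  then have "(D has_real_derivative 2 * k * \<sigma> * (cos (\<psi> t / 2) * (D t / 2))
      + e * (4 * z0 * g t + e * Q e t (v t) (y t) (w t) + k * tanh (k * t) * y t)) (at t)" for t
    unfolding D_def [abs_def] by (intro DERIV_add DERIV_cmult y') (simp add: D_def)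
  moreover have "2 * k * \<sigma> * (cos (\<psi> t / 2) * (D t / 2)) + e * (4 * z0 * g t + e * Q e t (v t) (y t)
      (w t) + k * tanh (k * t) * y t)
      = k\<^sup>2 * sin (\<psi> t) + 4 * e * g t * z t" for t
    unfolding y_field half_angle(1) [of "\<psi> t"] half [symmetric] D_def z_def
    by (simp add: algebra_simps power2_eq_square)
  ultimately have D': "(D has_real_derivative k\<^sup>2 * sin (\<psi> t) + 4 * e * g t * z t) (at t)" for t
    by metis
  have level: "(D t)\<^sup>2 / 2 - k\<^sup>2 * (1 - cos (\<psi> t)) - 2 * (z t)\<^sup>2 = - 2 * z0\<^sup>2" for t
  proof -
    have "(D t - 2 * k * \<sigma> * sin (\<psi> t / 2)) * (D t + 2 * k * \<sigma> * sin (\<psi> t / 2))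
        = e * y t * (e * y t + 4 * k * \<sigma> * sin (A t + e * v t / 2))"
      by (simp add: D_def half algebra_simps)
    then show ?thesis
      using w [of t] unfolding H_eq [OF e] energy_factor z_def by simp
  qed
  \<comment> \<open>This is the square of \<open>z\<close> expressed through \<psi> and
    \<open>D\<close> alone, hence differentiable before \<open>z\<close> is known to be.\<close>
  define F where "F t = z0\<^sup>2 + ((D t)\<^sup>2 / 2 - k\<^sup>2 * (1 - cos (\<psi> t))) / 2" for t
  have Fz: "F t = (z t)\<^sup>2" for t
    using level [of t] by (simp add: F_def field_simps)
  have zpos: "sgn z0 * z t > 0" for t
    using small [of t] z0 by (auto simp: z_def sgn_if abs_if split: if_splits)
  have zF: "z t = sgn z0 * sqrt (F t)" for t
    using zpos [of t] by (auto simp: Fz sgn_if split: if_splits)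
  have "((\<lambda>t. (D t)\<^sup>2) has_real_derivative 2 * D t * (k\<^sup>2 * sin (\<psi> t) + 4 * e * g t * z t)) (at t)" for t
    by (auto intro!: derivative_eq_intros D')
  moreover have "((\<lambda>t. cos (\<psi> t)) has_real_derivative - sin (\<psi> t) * D t) (at t)" for t
    by (rule DERIV_chain2 [OF DERIV_cos \<psi>'])
  ultimately have F': "(F has_real_derivative 0 + (2 * D t * (k\<^sup>2 * sin (\<psi> t) + 4 * e * g t * z t) / 2
      - k\<^sup>2 * (0 - (- sin (\<psi> t) * D t))) / 2) (at t)" for t
    unfolding F_def [abs_def] by (intro DERIV_add DERIV_const DERIV_cdivide DERIV_diff DERIV_cmult)
  have "0 + (2 * D t * (k\<^sup>2 * sin (\<psi> t) + 4 * e * g t * z t) / 2 - k\<^sup>2 * (0 - (- sin (\<psi> t) * D t))) /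
      2 = 2 * z t * (e * g t * D t)" for t
    by (simp add: algebra_simps)
  with F' have F'': "(F has_real_derivative 2 * z t * (e * g t * D t)) (at t)" for t
    by metis
  have "(z has_real_derivative e * g t * D t) (at t)" for t
  proof -
    have "F t > 0"
      using zpos [of t] by (auto simp: Fz)
    have "((\<lambda>t. sgn z0 * sqrt (F t)) has_real_derivative sgn z0 * (inverse (sqrt (F t)) / 2 * (2 * z t
        * (e * g t * D t)))) (at t)"
      by (intro DERIV_cmult DERIV_chain2 [OF DERIV_real_sqrt F''] \<open>F t > 0\<close>)
    moreover have "sgn z0 * (inverse (sqrt (F t)) / 2 * (2 * z t * (e * g t * D t))) = e * g t * D t"
    proof -
      have "sgn z0 * sgn z0 = 1"
        using z0 by (auto simp: sgn_if)
      then show ?thesis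
        unfolding zF [of t] using \<open>F t > 0\<close> by (simp add: field_simps)
    qed
    moreover have "z = (\<lambda>t. sgn z0 * sqrt (F t))"
      by (rule ext) (rule zF)
    ultimately show ?thesis
      by metis
  qed
  then show ?thesis
    using \<psi>' D' level unfolding solution_def \<psi>_def z_def by blast
qed

lemma scaled_of_solution:
  assumes sol: "solution e \<psi> D z" and e: "e \<noteq> 0"
  shows "scaled_solution e (\<lambda>t. (\<psi> t - 2 * A t) / e) (\<lambda>t. (D t - 2 * k * \<sigma> * sin (\<psi> t / 2)) / e) (\<lambda>t.
      (z t - z0) / e)"
proof -
  define v where "v t = (\<psi> t - 2 * A t) / e" for t
  define y where "y t = (D t - 2 * k * \<sigma> * sin (\<psi> t / 2)) / e" for t
  define w where "w t = (z t - z0) / e" for t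
  have half: "\<psi> t / 2 = A t + e * v t / 2" and D: "D t = 2 * k * \<sigma> * sin (A t + e * v t / 2) + e * y t"
    and z: "z t = z0 + e * w t" for t
    using e by (simp_all add: v_def y_def w_def field_simps)
  have \<psi>': "(\<psi> has_real_derivative D t) (at t)"
    and D': "(D has_real_derivative k\<^sup>2 * sin (\<psi> t) + 4 * e * g t * z t) (at t)"
    and z': "(z has_real_derivative e * g t * D t) (at t)"
    and level: "(D t)\<^sup>2 / 2 - k\<^sup>2 * (1 - cos (\<psi> t)) - 2 * (z t)\<^sup>2 = - 2 * z0\<^sup>2" for t
    using sol by (auto simp: solution_def)
  have "(v has_real_derivative (D t - 2 * (\<sigma> * k * sech (k * t))) / e) (at t)" for t
    unfolding v_def [abs_def] by (intro DERIV_cdivide DERIV_diff DERIV_cmult \<psi>' A_deriv)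
  moreover have "(D t - 2 * (\<sigma> * k * sech (k * t))) / e = y t + e * P e t (v t) - k * tanh (k * t) * v
      t" for t
    using e v_field [of t e "v t" "y t"] by (simp add: D)
  ultimately have v': "(v has_real_derivative y t + e * P e t (v t) - k * tanh (k * t) * v t) (at t)" for t
    by metis
  have "((\<lambda>t. \<psi> t / 2) has_real_derivative D t / 2) (at t)" for t
    by (intro DERIV_cdivide \<psi>')
  then have "((\<lambda>t. sin (\<psi> t / 2)) has_real_derivative cos (\<psi> t / 2) * (D t / 2)) (at t)" for t
    by (rule DERIV_chain2 [OF DERIV_sin])
  then have "(y has_real_derivative (k\<^sup>2 * sin (\<psi> t) + 4 * e * g t * z t - 2 * k * \<sigma> * (cos (\<psi> t / 2)
      * (D t / 2))) / e) (at t)" for t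
    unfolding y_def [abs_def] by (intro DERIV_cdivide DERIV_diff DERIV_cmult D')
  moreover have "k\<^sup>2 * sin (\<psi> t) + 4 * e * g t * z t - 2 * k * \<sigma> * (cos (\<psi> t / 2) * (D t / 2))
      = e * (4 * z0 * g t + e * Q e t (v t) (y t) (w t) + k * tanh (k * t) * y t)" for t
    unfolding y_field half_angle(1) [of "\<psi> t"] half D z
    by (simp add: algebra_simps power2_eq_square)
  ultimately have y': "(y has_real_derivative 4 * z0 * g t + e * Q e t (v t) (y t) (w t) + k * tanh (k
      * t) * y t) (at t)" for t
    using e by simp
  have w: "2 * z0 * w t = k * \<sigma> * sech (k * t) * y t + e * H e t (v t) (y t) (w t)" for t
    unfolding H_eq [OF e] using level [of t] unfolding energy_factor half z
    by (simp add: D algebra_simps)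
  have "continuous_on UNIV w"
    unfolding w_def [abs_def] using e DERIV_continuous_on [OF has_field_derivative_at_within [OF z']]
    by (intro continuous_intros) auto
  then show ?thesis
    using v' y' w unfolding scaled_solution_def v_def y_def w_def by blast
qed

text \<open>The equation bounds the second derivative of \<open>v\<close>, interpolation then bounds
  the first, and \<open>y\<close> differs from that by a term controlled by the Lipschitz constant
  of the sine.\<close>

lemma scaled_bound_of_close:
  assumes sol: "solution e \<psi> D z" and e: "e \<noteq> 0" "\<bar>e\<bar> \<le> 1"
    and close: "\<And>t. \<bar>\<psi> t - 2 * A t\<bar> \<le> C * \<bar>e\<bar>" "\<And>t. \<bar>z t - z0\<bar> \<le> C * \<bar>e\<bar>"
  shows "\<bar>(D t - 2 * k * \<sigma> * sin (\<psi> t / 2)) / e\<bar> \<le> 2 * C + (k\<^sup>2 * C + 4 * \<Gamma> * (\<bar>z0\<bar> + C)) + k * C"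
proof -
  define v where "v t = (\<psi> t - 2 * A t) / e" for t
  define v1 where "v1 t = (D t - 2 * (\<sigma> * k * sech (k * t))) / e" for t
  define v2 where "v2 t = (k\<^sup>2 * sin (\<psi> t) + 4 * e * g t * z t - 2 * (\<sigma> * k * (- (tanh (k * t) * sech
      (k * t)) * k))) / e" for t
  have \<psi>': "(\<psi> has_real_derivative D t) (at t)"
    and D': "(D has_real_derivative k\<^sup>2 * sin (\<psi> t) + 4 * e * g t * z t) (at t)" for t
    using sol by (auto simp: solution_def)
  have v: "(v has_real_derivative v1 t) (at t)" for t
    unfolding v_def [abs_def] v1_def by (intro DERIV_cdivide DERIV_diff DERIV_cmult \<psi>' A_deriv)
  have "((\<lambda>t. sech (k * t)) has_real_derivative - (tanh (k * t) * sech (k * t)) * k) (at t)" for t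
    by (auto intro!: derivative_eq_intros)
  then have v1: "(v1 has_real_derivative v2 t) (at t)" for t
    unfolding v1_def [abs_def] v2_def by (intro DERIV_cdivide DERIV_diff DERIV_cmult D')
  have C: "C \<ge> 0"
    using close(1) [of 0] e by (metis abs_ge_zero order_trans zero_le_mult_iff zero_less_abs_iff not_le)
  have vC: "\<bar>v t\<bar> \<le> C" for t
    using close(1) [of t] e by (simp add: v_def pos_divide_le_eq)
  have lip: "\<bar>sin a - sin b\<bar> \<le> \<bar>a - b\<bar>" for a b :: real
    using field_differentiable_bound [of UNIV sin cos 1 a b] by (auto intro: derivative_eq_intros)
  have "\<bar>v2 t\<bar> \<le> k\<^sup>2 * C + 4 * \<Gamma> * (\<bar>z0\<bar> + C)" for t
  proof -
    have "v2 t * e = k\<^sup>2 * sin (\<psi> t) + 4 * e * g t * z t - 2 * (\<sigma> * k * (- (tanh (k * t) * sech (k *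
        t)) * k))"
      using e by (simp add: v2_def)
    \<comment> \<open>\<open>2 * A\<close> solves the unperturbed pendulum equation, so its second
      derivative can be written as \<open>k\<^sup>2 * sin (2 * A t)\<close> and subtracted from the
      pendulum force.\<close>
    also have "\<dots> = k\<^sup>2 * (sin (\<psi> t) - sin (2 * A t)) + e * (4 * g t * z t)"
      by (simp add: sin_double sin_A cos_A power2_eq_square algebra_simps)
    finally have "v2 t * e = k\<^sup>2 * (sin (\<psi> t) - sin (2 * A t)) + e * (4 * g t * z t)" .
    then have "\<bar>v2 t\<bar> * \<bar>e\<bar> \<le> k\<^sup>2 * \<bar>sin (\<psi> t) - sin (2 * A t)\<bar> + \<bar>e\<bar> * (4 * \<bar>g t\<bar> * \<bar>z t\<bar>)"
      using abs_triangle_ineq [of "k\<^sup>2 * (sin (\<psi> t) - sin (2 * A t))" "e * (4 * g t * z t)"]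
      by (simp add: abs_mult flip: abs_mult [of "v2 t"])
    also have "\<dots> \<le> k\<^sup>2 * (C * \<bar>e\<bar>) + \<bar>e\<bar> * (4 * \<Gamma> * (\<bar>z0\<bar> + C))"
    proof (intro add_mono mult_left_mono mult_mono)
      show "\<bar>sin (\<psi> t) - sin (2 * A t)\<bar> \<le> C * \<bar>e\<bar>"
        using lip close(1) order_trans by blast
      have "C * \<bar>e\<bar> \<le> C * 1"
        using C e by (intro mult_left_mono)
      then show "\<bar>z t\<bar> \<le> \<bar>z0\<bar> + C"
        using close(2) [of t] by linarith
    qed (use bdd_contD(2) [OF g] bdd_cont_nonneg [OF g] in auto)
    also have "\<dots> = (k\<^sup>2 * C + 4 * \<Gamma> * (\<bar>z0\<bar> + C)) * \<bar>e\<bar>"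
      by (simp add: algebra_simps)
    finally show ?thesis
      using e by simp
  qed
  from bounded_derivative_of_bounded_second [OF v v1 vC this]
  have "\<bar>v1 t\<bar> \<le> 2 * C + (k\<^sup>2 * C + 4 * \<Gamma> * (\<bar>z0\<bar> + C))" .
  moreover have "\<bar>(D t - 2 * k * \<sigma> * sin (\<psi> t / 2)) / e - v1 t\<bar> \<le> k * C"
  proof -
    have "(D t - 2 * k * \<sigma> * sin (\<psi> t / 2)) / e - v1 t = 2 * k * \<sigma> * (sin (A t) - sin (\<psi> t / 2)) / e"
      using e by (simp add: v1_def sin_A field_simps)
    then have "\<bar>(D t - 2 * k * \<sigma> * sin (\<psi> t / 2)) / e - v1 t\<bar> = 2 * k * \<bar>sin (A t) - sin (\<psi> t / 2)\<bar> / \<bar>e\<bar>"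
      using k_pos \<sigma> by (auto simp: abs_mult)
    also have "\<dots> \<le> 2 * k * (C * \<bar>e\<bar> / 2) / \<bar>e\<bar>"
    proof (intro divide_right_mono mult_left_mono)
      have "\<bar>A t - \<psi> t / 2\<bar> = \<bar>\<psi> t - 2 * A t\<bar> / 2"
        by (auto simp: abs_if field_simps)
      then show "\<bar>sin (A t) - sin (\<psi> t / 2)\<bar> \<le> C * \<bar>e\<bar> / 2"
        using lip [of "A t" "\<psi> t / 2"] close(1) [of t] by simp
    qed (use k_pos in auto)
    finally show ?thesis
      using e by simp
  qed
  ultimately show ?thesis
    by linarith
qed

lemma solution_exists_unique:
  "\<exists>C0>0. \<forall>C\<ge>C0. \<exists>\<delta>>0. \<forall>e. e \<noteq> 0 \<and> \<bar>e\<bar> < \<delta> \<longrightarrow>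
    (\<exists>\<psi> D z. solution e \<psi> D z \<and> (\<forall>t. dist (\<psi> t, z t) (2 * A t, z0) \<le> C * \<bar>e\<bar>)) \<and>
    (\<forall>\<psi> D z \<psi>' D' z'. solution e \<psi> D z \<longrightarrow> solution e \<psi>' D' z' \<longrightarrow>
      (\<forall>t. dist (\<psi> t, z t) (2 * A t, z0) \<le> C * \<bar>e\<bar>) \<longrightarrow>
      (\<forall>t. dist (\<psi>' t, z' t) (2 * A t, z0) \<le> C * \<bar>e\<bar>) \<longrightarrow> \<psi> = \<psi>' \<and> z = z')"
proof -
  obtain B \<delta>1 where B: "B > 0" and \<delta>1: "\<delta>1 > 0" and
    ex: "\<And>e. e \<noteq> 0 \<Longrightarrow> \<bar>e\<bar> < \<delta>1 \<Longrightarrow> \<exists>v y w. scaled_solution e v y w \<and> (\<forall>t. \<bar>v t\<bar> \<le> B \<and> \<bar>y t\<bar> \<le> B \<and> \<bar>w t\<bar> \<le> B)"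
    using scaled_solution_exists by blast
  show ?thesis
  \<comment> \<open>\<open>v\<close> and \<open>w\<close> contribute at most \<open>B * |e|\<close>
    each to the distance, hence \<open>2 * B\<close>.\<close>
  proof (rule exI [of _ "2 * B"], intro conjI allI impI)
    show "2 * B > 0"
      using B by simp
    fix C assume C: "2 * B \<le> C"
    \<comment> \<open>The bound for \<open>y\<close> implied by closeness; \<open>C + K\<close> then
      bounds \<open>v\<close>, \<open>y\<close> and \<open>w\<close> at once. It depends on
      \<open>C\<close>, and so does the threshold for \<open>e\<close>.\<close>
    define K where "K = 2 * C + (k\<^sup>2 * C + 4 * \<Gamma> * (\<bar>z0\<bar> + C)) + k * C"
    have C0: "C > 0" and K: "K \<ge> 0"
      using B C k_pos bdd_cont_nonneg [OF g] by (auto simp: K_def intro!: add_nonneg_nonneg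
          mult_nonneg_nonneg)
    obtain \<delta>2 where \<delta>2: "\<delta>2 > 0" and un: "\<And>e v y w v' y' w'. e \<noteq> 0 \<Longrightarrow> \<bar>e\<bar> < \<delta>2 \<Longrightarrow>
        scaled_solution e v y w \<Longrightarrow> scaled_solution e v' y' w' \<Longrightarrow>
        \<forall>t. \<bar>v t\<bar> \<le> C + K \<and> \<bar>y t\<bar> \<le> C + K \<and> \<bar>w t\<bar> \<le> C + K \<Longrightarrow>
        \<forall>t. \<bar>v' t\<bar> \<le> C + K \<and> \<bar>y' t\<bar> \<le> C + K \<and> \<bar>w' t\<bar> \<le> C + K \<Longrightarrow> v = v' \<and> w = w'"
      using scaled_solution_unique [of "C + K"] C0 K by (auto simp: add_pos_nonneg)
    \<comment> \<open>Below \<open>|z0| / B\<close> the function \<open>z0 + e * w\<close> cannot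
      change sign, as the recovery of the equation for \<open>z\<close> requires.\<close>
    define \<delta> where "\<delta> = min (min 1 (\<bar>z0\<bar> / B)) (min \<delta>1 \<delta>2)"
    show "\<exists>\<delta>>0. \<forall>e. e \<noteq> 0 \<and> \<bar>e\<bar> < \<delta> \<longrightarrow>
      (\<exists>\<psi> D z. solution e \<psi> D z \<and> (\<forall>t. dist (\<psi> t, z t) (2 * A t, z0) \<le> C * \<bar>e\<bar>)) \<and>
      (\<forall>\<psi> D z \<psi>' D' z'. solution e \<psi> D z \<longrightarrow> solution e \<psi>' D' z' \<longrightarrow>
        (\<forall>t. dist (\<psi> t, z t) (2 * A t, z0) \<le> C * \<bar>e\<bar>) \<longrightarrow>
        (\<forall>t. dist (\<psi>' t, z' t) (2 * A t, z0) \<le> C * \<bar>e\<bar>) \<longrightarrow> \<psi> = \<psi>' \<and> z = z')"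
    proof (rule exI [of _ \<delta>], intro conjI [of "\<delta> > 0"] allI impI)
      show "\<delta> > 0"
        using z0 B \<delta>1 \<delta>2 by (simp add: \<delta>_def)
      fix e assume "e \<noteq> 0 \<and> \<bar>e\<bar> < \<delta>"
      then have e: "e \<noteq> 0" "\<bar>e\<bar> \<le> 1" "\<bar>e\<bar> < \<bar>z0\<bar> / B" "\<bar>e\<bar> < \<delta>1" "\<bar>e\<bar> < \<delta>2"
        by (auto simp: \<delta>_def)
      show "(\<exists>\<psi> D z. solution e \<psi> D z \<and> (\<forall>t. dist (\<psi> t, z t) (2 * A t, z0) \<le> C * \<bar>e\<bar>)) \<and>
        (\<forall>\<psi> D z \<psi>' D' z'. solution e \<psi> D z \<longrightarrow> solution e \<psi>' D' z' \<longrightarrow>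
          (\<forall>t. dist (\<psi> t, z t) (2 * A t, z0) \<le> C * \<bar>e\<bar>) \<longrightarrow>
          (\<forall>t. dist (\<psi>' t, z' t) (2 * A t, z0) \<le> C * \<bar>e\<bar>) \<longrightarrow> \<psi> = \<psi>' \<and> z = z')"
      proof (intro conjI allI impI)
        obtain v y w where s: "scaled_solution e v y w" and b: "\<And>t. \<bar>v t\<bar> \<le> B" "\<And>t. \<bar>w t\<bar> \<le> B"
          using ex [OF e(1,4)] by blast
        have "\<bar>e * w t\<bar> < \<bar>z0\<bar>" for t
        proof -
          have "\<bar>e * w t\<bar> \<le> \<bar>e\<bar> * B"
            using b(2) by (auto simp: abs_mult intro: mult_left_mono)
          also have "\<dots> < \<bar>z0\<bar>"
            using e(3) B by (simp add: pos_less_divide_eq)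
          finally show ?thesis .
        qed
        from solution_of_scaled [OF s e(1) this] obtain D where
          "solution e (\<lambda>t. 2 * A t + e * v t) D (\<lambda>t. z0 + e * w t)" ..
        moreover have "dist (2 * A t + e * v t, z0 + e * w t) (2 * A t, z0) \<le> C * \<bar>e\<bar>" for t
        proof -
          have "dist (2 * A t + e * v t, z0 + e * w t) (2 * A t, z0) \<le> \<bar>e\<bar> * \<bar>v t\<bar> + \<bar>e\<bar> * \<bar>w t\<bar>"
            using sqrt_sum_squares_le_sum_abs [of "e * v t" "e * w t"]
            unfolding dist_Pair_Pair dist_real_def add_diff_cancel_left' power2_abs abs_mult [symmetric] .
          also have "\<dots> \<le> \<bar>e\<bar> * B + \<bar>e\<bar> * B"
            using b by (intro add_mono mult_left_mono) auto
          also have "\<dots> \<le> C * \<bar>e\<bar>"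
            using mult_right_mono [OF C, of "\<bar>e\<bar>"] by (simp add: algebra_simps)
          finally show ?thesis .
        qed
        ultimately show "\<exists>\<psi> D z. solution e \<psi> D z \<and> (\<forall>t. dist (\<psi> t, z t) (2 * A t, z0) \<le> C * \<bar>e\<bar>)"
          by blast
      next
        fix \<psi> D z \<psi>' D' z'
        assume s: "solution e \<psi> D z" "solution e \<psi>' D' z'"
          and "\<forall>t. dist (\<psi> t, z t) (2 * A t, z0) \<le> C * \<bar>e\<bar>" "\<forall>t. dist (\<psi>' t, z' t) (2 * A t, z0) \<le> C * \<bar>e\<bar>"
        then have c: "\<bar>\<psi> t - 2 * A t\<bar> \<le> C * \<bar>e\<bar>" "\<bar>z t - z0\<bar> \<le> C * \<bar>e\<bar>"
          "\<bar>\<psi>' t - 2 * A t\<bar> \<le> C * \<bar>e\<bar>" "\<bar>z' t - z0\<bar> \<le> C * \<bar>e\<bar>" for t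
          using dist_fst_le [of "(\<psi> t, z t)" "(2 * A t, z0)"] dist_snd_le [of "(\<psi> t, z t)" "(2 * A t, z0)"]
            dist_fst_le [of "(\<psi>' t, z' t)" "(2 * A t, z0)"] dist_snd_le [of "(\<psi>' t, z' t)" "(2 * A t, z0)"]
          by (auto simp: dist_real_def intro: order_trans)
        have d: "\<bar>u / e\<bar> \<le> C + K" if "\<bar>u\<bar> \<le> C * \<bar>e\<bar>" for u
        proof -
          have "\<bar>u / e\<bar> \<le> C"
            using that e(1) by (simp add: pos_divide_le_eq)
          then show ?thesis using K by simp
        qed
        have y: "\<bar>(D t - 2 * k * \<sigma> * sin (\<psi> t / 2)) / e\<bar> \<le> C + K" "\<bar>(D' t - 2 * k * \<sigma> * sin (\<psi>' t /
            2)) / e\<bar> \<le> C + K" for t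
          using scaled_bound_of_close [OF s(1) e(1,2) c(1,2), of t] scaled_bound_of_close [OF s(2)
              e(1,2) c(3,4), of t] C0
          by (simp_all add: K_def)
        have "(\<lambda>t. (\<psi> t - 2 * A t) / e) = (\<lambda>t. (\<psi>' t - 2 * A t) / e) \<and> (\<lambda>t. (z t - z0) / e) = (\<lambda>t. (z'
            t - z0) / e)"
          using c d y by (intro un [OF e(1,5) scaled_of_solution [OF s(1) e(1)] scaled_of_solution [OF
              s(2) e(1)]] allI conjI) blast+
        then show "\<psi> = \<psi>'" "z = z'"
          using e(1) by (auto simp: fun_eq_iff)
      qed
    qed
  qed
qed

end

section \<open>Return to the original forcing and time\<close>

lemma periodic_bdd_cont:
  fixes f :: "real \<Rightarrow> real"
  assumes per: "\<And>t. f (t + 1) = f t" and cont: "continuous_on UNIV f"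
  shows "\<exists>B. bdd_cont B f"
proof -
  interpret periodic_fun_simple' f
    by standard (rule per)
  have "bounded (f ` {0..1})"
    by (intro compact_imp_bounded compact_continuous_image continuous_on_subset [OF cont]) auto
  then obtain B where "\<forall>y\<in>f ` {0..1}. norm y \<le> B"
    unfolding bounded_iff by blast
  then have B: "\<bar>f x\<bar> \<le> B" if "x \<in> {0..1}" for x
    using that by auto
  have "\<bar>f t\<bar> \<le> B" for t
  proof -
    have "f t = f (frac t + of_int \<lfloor>t\<rfloor>)"
      by (simp add: frac_def)
    also have "\<dots> = f (frac t)"
      by (rule plus_of_int)
    finally show ?thesis
      using B [of "frac t"] frac_ge_0 [of t] frac_lt_1 [of t] by simp
  qed
  then show ?thesis
    using cont by (auto simp: bdd_cont_def)
qed

lemma bdd_cont_shift: "bdd_cont B f \<Longrightarrow> bdd_cont B (\<lambda>t. f (t + a))"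
  unfolding bdd_cont_def by (auto intro!: continuous_on_compose2 [of UNIV f] continuous_intros)

lemma DERIV_shift_at: "(f has_real_derivative D) (at (t + a)) \<Longrightarrow> ((\<lambda>t. f (t + a)) has_real_derivative
    D) (at t)"
  by (simp add: DERIV_shift)

text \<open>A time shift by \<alpha>0 centers the orbit at 0 and moves \<alpha>0 into the forcing.
  Solutions and distances correspond under the shift, and the level becomes
  \<open>d = - 2 * z0\<^sup>2\<close>.\<close>

lemma heteroclinic_solution_exists_unique:
  fixes c d \<alpha>0 :: real and \<gamma> :: "real \<Rightarrow> real"
  assumes c: "c > 0" and d: "d < 0"
    and per: "\<forall>t. \<gamma> (t + 1) = \<gamma> t"
    and C2: "C2_real \<gamma>"
    and M0: "(\<integral>t. \<gamma> (t + \<alpha>0) * sech (2 * c * t) \<partial>lborel) = 0"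
    and M1: "(\<integral>t. deriv \<gamma> (t + \<alpha>0) * sech (2 * c * t) \<partial>lborel) \<noteq> 0"
    and \<sigma>: "\<sigma>1 \<in> {1, -1}" "\<sigma>2 \<in> {1, -1}"
  shows "\<exists>C0>0. \<forall>C\<ge>C0. \<exists>\<delta>>0. \<forall>\<epsilon>. \<epsilon> \<noteq> 0 \<and> \<bar>\<epsilon>\<bar> < \<delta> \<longrightarrow>
       (\<exists>!s. global_solution c \<gamma> \<epsilon> s \<and> on_level_set c d s \<and>
            uniformly_within (C * \<bar>\<epsilon>\<bar>) (leading_term c d \<alpha>0 \<sigma>1 \<sigma>2) s)"
proof -
  define z0 where "z0 = \<sigma>2 * sqrt (- d / 2)"
  have z0_nz: "z0 \<noteq> 0" and z0_sq: "2 * z0\<^sup>2 = - d"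
    using d \<sigma>(2) by (auto simp: z0_def power_mult_distrib)
  have \<gamma>': "(\<gamma> has_real_derivative deriv \<gamma> t) (at t)" for t
    using C2 by (simp add: C2_real_def DERIV_deriv_iff_real_differentiable)
  have "continuous_on UNIV (deriv \<gamma>)"
    using C2 by (auto simp: C2_real_def intro!: continuous_at_imp_continuous_on
        differentiable_imp_continuous_within)
  moreover have "deriv \<gamma> (t + 1) = deriv \<gamma> t" for t
  proof -
    have "(\<lambda>t. \<gamma> (t + 1)) = \<gamma>"
      using per by auto
    then show ?thesis
      using DERIV_shift_at [OF \<gamma>' [of "t + 1"]] by (simp add: DERIV_imp_deriv)
  qed
  ultimately obtain B1 where B1: "bdd_cont B1 (deriv \<gamma>)"
    using periodic_bdd_cont by blast
  obtain B0 where B0: "bdd_cont B0 \<gamma>"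
    using periodic_bdd_cont [of \<gamma>] per DERIV_continuous_on [OF has_field_derivative_at_within [OF \<gamma>']]
        by blast
  interpret melnikov "2 * c" \<sigma>1 z0 "max B0 B1" "\<lambda>t. \<gamma> (t + \<alpha>0)" "\<lambda>t. deriv \<gamma> (t + \<alpha>0)"
  proof unfold_locales
    show "saddle.pairing (2 * c) (\<lambda>t. \<gamma> (t + \<alpha>0)) = 0"
      using c M0 by (subst saddle.pairing_def) (auto simp: saddle_def mult.commute)
    show "saddle.pairing (2 * c) (\<lambda>t. deriv \<gamma> (t + \<alpha>0)) \<noteq> 0"
      using c M1 by (subst saddle.pairing_def) (auto simp: saddle_def mult.commute)
    show "bdd_cont (max B0 B1) (\<lambda>t. \<gamma> (t + \<alpha>0))" "bdd_cont (max B0 B1) (\<lambda>t. deriv \<gamma> (t + \<alpha>0))"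
      using bdd_cont_mono [OF bdd_cont_shift [OF B0]] bdd_cont_mono [OF bdd_cont_shift [OF B1]] by auto
    show "((\<lambda>t. \<gamma> (t + \<alpha>0)) has_real_derivative deriv \<gamma> (t + \<alpha>0)) (at t)" for t
      by (rule DERIV_shift_at [OF \<gamma>'])
  qed (use c \<sigma> z0_nz in auto)
  let ?good = "\<lambda>C \<epsilon> s. global_solution c \<gamma> \<epsilon> s \<and> on_level_set c d s \<and>
            uniformly_within (C * \<bar>\<epsilon>\<bar>) (leading_term c d \<alpha>0 \<sigma>1 \<sigma>2) s"
  let ?close = "\<lambda>C \<epsilon> \<psi> z. \<forall>t. dist (\<psi> t, z t) (2 * A t, z0) \<le> C * \<bar>\<epsilon>\<bar>"
  have lead: "leading_term c d \<alpha>0 \<sigma>1 \<sigma>2 (t + \<alpha>0) = (2 * A t, z0)" for t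
    by (simp add: leading_term_def A_def z0_def distrib_left)
  have to: "solution \<epsilon> (\<lambda>t. \<psi> (t + \<alpha>0)) (\<lambda>t. deriv \<psi> (t + \<alpha>0)) (\<lambda>t. z (t + \<alpha>0)) \<and>
      ?close C \<epsilon> (\<lambda>t. \<psi> (t + \<alpha>0)) (\<lambda>t. z (t + \<alpha>0))" if "?good C \<epsilon> (\<psi>, z)" for C \<epsilon> \<psi> z
  proof -
    have \<psi>: "(\<psi> has_real_derivative deriv \<psi> t) (at t)"
      and D: "(deriv \<psi> has_real_derivative 4 * (c\<^sup>2 * sin (\<psi> t) + \<epsilon> * \<gamma> t * z t)) (at t)"
      and z: "(z has_real_derivative \<epsilon> * \<gamma> t * deriv \<psi> t) (at t)"
      and l: "(deriv \<psi> t)\<^sup>2 / 2 - 4 * c\<^sup>2 * (1 - cos (\<psi> t)) - 2 * (z t)\<^sup>2 = d"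
      and u: "dist (\<psi> t, z t) (leading_term c d \<alpha>0 \<sigma>1 \<sigma>2 t) \<le> C * \<bar>\<epsilon>\<bar>" for t
      using that by (auto simp: global_solution_def on_level_set_def uniformly_within_def
          DERIV_deriv_iff_real_differentiable)
    have "4 * (c\<^sup>2 * sin (\<psi> t) + \<epsilon> * \<gamma> t * z t) = (2 * c)\<^sup>2 * sin (\<psi> t) + 4 * \<epsilon> * \<gamma> t * z t" for t
      by (simp add: power2_eq_square algebra_simps)
    note D' = D [unfolded this]
    have "solution \<epsilon> (\<lambda>t. \<psi> (t + \<alpha>0)) (\<lambda>t. deriv \<psi> (t + \<alpha>0)) (\<lambda>t. z (t + \<alpha>0))"
      unfolding solution_def
    proof (intro allI conjI)
      fix t
      show "((\<lambda>t. \<psi> (t + \<alpha>0)) has_real_derivative deriv \<psi> (t + \<alpha>0)) (at t)"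
        by (rule DERIV_shift_at [OF \<psi>])
      show "((\<lambda>t. deriv \<psi> (t + \<alpha>0)) has_real_derivative (2 * c)\<^sup>2 * sin (\<psi> (t + \<alpha>0)) + 4 * \<epsilon> * \<gamma> (t +
          \<alpha>0) * z (t + \<alpha>0)) (at t)"
        by (rule DERIV_shift_at [OF D'])
      show "((\<lambda>t. z (t + \<alpha>0)) has_real_derivative \<epsilon> * \<gamma> (t + \<alpha>0) * deriv \<psi> (t + \<alpha>0)) (at t)"
        by (rule DERIV_shift_at [OF z])
      show "(deriv \<psi> (t + \<alpha>0))\<^sup>2 / 2 - (2 * c)\<^sup>2 * (1 - cos (\<psi> (t + \<alpha>0))) - 2 * (z (t + \<alpha>0))\<^sup>2 = - 2 * z0\<^sup>2"
        using l [of "t + \<alpha>0"] z0_sq by (simp add: power_mult_distrib)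
    qed
    moreover have "?close C \<epsilon> (\<lambda>t. \<psi> (t + \<alpha>0)) (\<lambda>t. z (t + \<alpha>0))"
      using u lead by metis
    ultimately show ?thesis ..
  qed
  have "from": "?good C \<epsilon> (\<lambda>t. \<psi> (t + - \<alpha>0), \<lambda>t. z (t + - \<alpha>0))" if s: "solution \<epsilon> \<psi> D z" and u:
      "?close C \<epsilon> \<psi> z" for C \<epsilon> \<psi> D z
  proof -
    define \<Psi> where "\<Psi> t = \<psi> (t + - \<alpha>0)" for t
    define Z where "Z t = z (t + - \<alpha>0)" for t
    have s\<psi>: "(\<psi> has_real_derivative D t) (at t)"
      and sD: "(D has_real_derivative (2 * c)\<^sup>2 * sin (\<psi> t) + 4 * \<epsilon> * \<gamma> (t + \<alpha>0) * z t) (at t)"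
      and sz: "(z has_real_derivative \<epsilon> * \<gamma> (t + \<alpha>0) * D t) (at t)" for t
      using s unfolding solution_def by blast+
    have \<psi>: "(\<Psi> has_real_derivative D (t + - \<alpha>0)) (at t)" for t
      unfolding \<Psi>_def by (rule DERIV_shift_at [OF s\<psi>])
    then have D: "deriv \<Psi> = (\<lambda>t. D (t + - \<alpha>0))"
      by (auto intro!: ext DERIV_imp_deriv)
    have "((\<lambda>t. D (t + - \<alpha>0)) has_real_derivative (2 * c)\<^sup>2 * sin (\<Psi> t) + 4 * \<epsilon> * \<gamma> (t + - \<alpha>0 + \<alpha>0) *
        Z t) (at t)" for t
      unfolding \<Psi>_def Z_def by (rule DERIV_shift_at [OF sD])
    moreover have "(2 * c)\<^sup>2 * sin (\<Psi> t) + 4 * \<epsilon> * \<gamma> (t + - \<alpha>0 + \<alpha>0) * Z t = 4 * (c\<^sup>2 * sin (\<Psi> t) + \<epsilon>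
        * \<gamma> t * Z t)" for t
      by (simp add: power2_eq_square algebra_simps)
    ultimately have D': "(deriv \<Psi> has_real_derivative 4 * (c\<^sup>2 * sin (\<Psi> t) + \<epsilon> * \<gamma> t * Z t)) (at t)" for t
      unfolding D by metis
    have "(Z has_real_derivative \<epsilon> * \<gamma> (t + - \<alpha>0 + \<alpha>0) * D (t + - \<alpha>0)) (at t)" for t
      unfolding Z_def by (rule DERIV_shift_at [OF sz])
    then have z: "(Z has_real_derivative \<epsilon> * \<gamma> t * deriv \<Psi> t) (at t)" for t
      unfolding D by simp
    have "(deriv \<Psi> t)\<^sup>2 / 2 - (2 * c)\<^sup>2 * (1 - cos (\<Psi> t)) - 2 * (Z t)\<^sup>2 = - 2 * z0\<^sup>2" for t
      using s unfolding D \<Psi>_def Z_def solution_def by blast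
    then have "(deriv \<Psi> t)\<^sup>2 / 2 - 4 * c\<^sup>2 * (1 - cos (\<Psi> t)) - 2 * (Z t)\<^sup>2 = d" for t
      using z0_sq by (simp add: power_mult_distrib)
    moreover have "dist (\<Psi> t, Z t) (leading_term c d \<alpha>0 \<sigma>1 \<sigma>2 t) \<le> C * \<bar>\<epsilon>\<bar>" for t
      using u [rule_format, of "t + - \<alpha>0"] lead [of "t + - \<alpha>0"] by (simp add: \<Psi>_def Z_def)
    moreover have "\<Psi> differentiable (at t)" for t
      using \<psi> real_differentiable_def by blast
    ultimately have "?good C \<epsilon> (\<Psi>, Z)"
      using D' z by (auto simp: global_solution_def on_level_set_def uniformly_within_def)
    then show ?thesis
      by (simp add: \<Psi>_def [abs_def] Z_def [abs_def])
  qed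
  obtain C0 where C0: "C0 > 0" and main: "\<forall>C\<ge>C0. \<exists>\<delta>>0. \<forall>e. e \<noteq> 0 \<and> \<bar>e\<bar> < \<delta> \<longrightarrow>
    (\<exists>\<psi> D z. solution e \<psi> D z \<and> ?close C e \<psi> z) \<and>
    (\<forall>\<psi> D z \<psi>' D' z'. solution e \<psi> D z \<longrightarrow> solution e \<psi>' D' z' \<longrightarrow>
      ?close C e \<psi> z \<longrightarrow> ?close C e \<psi>' z' \<longrightarrow> \<psi> = \<psi>' \<and> z = z')"
    using solution_exists_unique by (elim exE conjE) (rule that)
  show ?thesis
  proof (rule exI [of _ C0], intro conjI C0 allI impI)
    fix C assume "C0 \<le> C"
    from main [rule_format, OF this] obtain \<delta> where \<delta>: "\<delta> > 0" and
      \<delta>': "\<forall>e. e \<noteq> 0 \<and> \<bar>e\<bar> < \<delta> \<longrightarrow> (\<exists>\<psi> D z. solution e \<psi> D z \<and> ?close C e \<psi> z) \<and>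
        (\<forall>\<psi> D z \<psi>' D' z'. solution e \<psi> D z \<longrightarrow> solution e \<psi>' D' z' \<longrightarrow>
          ?close C e \<psi> z \<longrightarrow> ?close C e \<psi>' z' \<longrightarrow> \<psi> = \<psi>' \<and> z = z')"
      by (elim exE conjE) (rule that)
    show "\<exists>\<delta>>0. \<forall>\<epsilon>. \<epsilon> \<noteq> 0 \<and> \<bar>\<epsilon>\<bar> < \<delta> \<longrightarrow> (\<exists>!s. ?good C \<epsilon> s)"
    proof (rule exI [of _ \<delta>], intro conjI \<delta> allI impI)
      fix \<epsilon> assume e: "\<epsilon> \<noteq> 0 \<and> \<bar>\<epsilon>\<bar> < \<delta>"
      note ex = conjunct1 [OF \<delta>' [rule_format, OF e]]
        and un = conjunct2 [OF \<delta>' [rule_format, OF e], rule_format]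
      show "\<exists>!s. ?good C \<epsilon> s"
      proof (rule ex_ex1I)
        show "\<exists>s. ?good C \<epsilon> s"
        proof -
          obtain \<psi> D z where "solution \<epsilon> \<psi> D z" "?close C \<epsilon> \<psi> z"
            using ex by (elim exE conjE) (rule that)
          from "from" [OF this] show ?thesis by blast
        qed
        fix s s' assume s: "?good C \<epsilon> s" "?good C \<epsilon> s'"
        obtain \<psi> z \<psi>' z' where ss: "s = (\<psi>, z)" "s' = (\<psi>', z')"
          by (metis surj_pair)
        have eq: "(\<lambda>t. \<psi> (t + \<alpha>0)) = (\<lambda>t. \<psi>' (t + \<alpha>0)) \<and> (\<lambda>t. z (t + \<alpha>0)) = (\<lambda>t. z' (t + \<alpha>0))"
          by (rule un [OF conjunct1 [OF to] conjunct1 [OF to]]; use s to in \<open>auto simp: ss\<close>)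
        have "\<psi> t = \<psi>' t \<and> z t = z' t" for t
          using fun_cong [OF conjunct1 [OF eq], of "t - \<alpha>0"] fun_cong [OF conjunct2 [OF eq], of "t -
              \<alpha>0"] by simp
        then show "s = s'"
          by (auto simp: ss)
      qed
    qed
  qed
qed

section \<open>Boundedness and separation of the four solutions\<close>

lemma bounded_solution_of_close:
  assumes "on_level_set c d s" "uniformly_within r (leading_term c d \<alpha>0 \<sigma>1 \<sigma>2) s"
  shows "bounded_solution s"
proof -
  obtain \<psi> z where s: "s = (\<psi>, z)" by fastforce
  have l: "(deriv \<psi> t)\<^sup>2 / 2 - 4 * c\<^sup>2 * (1 - cos (\<psi> t)) - 2 * (z t)\<^sup>2 = d"
    and u: "dist (\<psi> t, z t) (leading_term c d \<alpha>0 \<sigma>1 \<sigma>2 t) \<le> r" for t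
    using assms by (auto simp: s on_level_set_def uniformly_within_def)
  define K where "K = pi + \<bar>\<sigma>1\<bar> * pi"
  define Z where "Z = \<bar>\<sigma>2 * sqrt (- d / 2)\<bar> + r"
  have "\<bar>\<psi> t\<bar> \<le> K + r" "\<bar>z t\<bar> \<le> Z" for t
  proof -
    define a where "a = arctan (sinh (2 * c * (t - \<alpha>0)))"
    have "\<bar>a\<bar> \<le> pi / 2"
      using arctan_bounded [of "sinh (2 * c * (t - \<alpha>0))"] unfolding a_def by linarith
    then have "\<bar>\<sigma>1\<bar> * \<bar>a\<bar> \<le> \<bar>\<sigma>1\<bar> * (pi / 2)"
      by (rule mult_left_mono) simp
    then have "\<bar>pi + 2 * \<sigma>1 * a\<bar> \<le> K"
      using abs_triangle_ineq [of pi "2 * \<sigma>1 * a"] by (simp add: K_def abs_mult)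
    moreover have "\<bar>\<psi> t - (pi + 2 * \<sigma>1 * a)\<bar> \<le> r" "\<bar>z t - \<sigma>2 * sqrt (- d / 2)\<bar> \<le> r"
      using order_trans [OF dist_fst_le u [of t]] order_trans [OF dist_snd_le u [of t]]
      by (auto simp: leading_term_def a_def dist_real_def)
    ultimately show "\<bar>\<psi> t\<bar> \<le> K + r" "\<bar>z t\<bar> \<le> Z"
      unfolding Z_def by linarith+
  qed
  note b = this
  \<comment> \<open>With \<psi> and \<open>z\<close> bounded, the level set bounds the square of the
    derivative; \<open>|x| \<le> x\<^sup>2 + 1 / 4\<close> avoids taking a root.\<close>
  have D: "\<bar>deriv \<psi> t\<bar> \<le> 2 * (\<bar>d\<bar> + 8 * c\<^sup>2 + 2 * Z\<^sup>2) + 1" for t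
  proof -
    define u where "u = 4 * c\<^sup>2 * (1 - cos (\<psi> t))"
    have u: "u \<le> 4 * c\<^sup>2 * 2"
      unfolding u_def using cos_ge_minus_one [of "\<psi> t"] by (intro mult_left_mono) auto
    have z: "(z t)\<^sup>2 \<le> Z\<^sup>2"
      using b(2) [of t] by (metis abs_ge_zero power2_abs power_mono)
    have "(deriv \<psi> t)\<^sup>2 = 2 * (d + u + 2 * (z t)\<^sup>2)"
      using l [of t, folded u_def] by (simp add: field_simps)
    also have "\<dots> \<le> 2 * (\<bar>d\<bar> + 8 * c\<^sup>2 + 2 * Z\<^sup>2)"
      using u z by (intro mult_left_mono add_mono) auto
    finally have "(deriv \<psi> t)\<^sup>2 \<le> 2 * (\<bar>d\<bar> + 8 * c\<^sup>2 + 2 * Z\<^sup>2)" .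
    moreover have "\<bar>deriv \<psi> t\<bar> \<le> (deriv \<psi> t)\<^sup>2 + 1 / 4"
      using zero_le_power2 [of "\<bar>deriv \<psi> t\<bar> - 1 / 2"] by (simp add: power2_diff power_divide)
    ultimately show ?thesis by linarith
  qed
  have "norm (\<psi> t, deriv \<psi> t, z t) \<le> (K + r) + ((2 * (\<bar>d\<bar> + 8 * c\<^sup>2 + 2 * Z\<^sup>2) + 1) + Z)" for t
    using b [of t] D [of t] by (intro norm_Pair_le [THEN order_trans] add_mono) auto
  then show ?thesis
    unfolding bounded_solution_def s by (auto simp: bounded_iff)
qed

text \<open>At \<alpha>0 both orbits pass through \<open>pi\<close>, so the comparison is made where
  the arctangent equals \<open>pi / 4\<close>. There opposite signs separate the angles by
  \<open>pi\<close>, and the values of \<open>z\<close> by \<open>2 * sqrt (- d / 2)\<close>; both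
  exceed \<open>2 * r\<close>.\<close>

lemma leading_terms_apart:
  assumes c: "c > 0" and d: "d < 0" and \<sigma>: "\<sigma>1 \<in> {1, -1}" "\<sigma>2 \<in> {1, -1}" "\<tau>1 \<in> {1, -1}" "\<tau>2 \<in> {1, -1}"
    and u: "uniformly_within r (leading_term c d \<alpha>0 \<sigma>1 \<sigma>2) s" "uniformly_within r (leading_term c d \<alpha>0
        \<tau>1 \<tau>2) s"
    and r: "r < 1" "r < sqrt (- d / 2)"
  shows "\<sigma>1 = \<tau>1 \<and> \<sigma>2 = \<tau>2"
proof -
  define t where "t = \<alpha>0 + arsinh 1 / (2 * c)"
  obtain \<psi> z where s: "s = (\<psi>, z)" by fastforce
  have a: "arctan (sinh (2 * c * (t - \<alpha>0))) = pi / 4"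
    using c by (simp add: t_def arctan_one)
  have "dist (\<psi> t, z t) (pi + 2 * \<sigma>1 * (pi / 4), \<sigma>2 * sqrt (- d / 2)) \<le> r"
    "dist (\<psi> t, z t) (pi + 2 * \<tau>1 * (pi / 4), \<tau>2 * sqrt (- d / 2)) \<le> r"
    using u unfolding uniformly_within_def s leading_term_def by (auto simp flip: a)
  from order_trans [OF dist_fst_le this(1)] order_trans [OF dist_snd_le this(1)]
    order_trans [OF dist_fst_le this(2)] order_trans [OF dist_snd_le this(2)]
  have "\<bar>\<psi> t - (pi + 2 * \<sigma>1 * (pi / 4))\<bar> \<le> r" "\<bar>z t - \<sigma>2 * sqrt (- d / 2)\<bar> \<le> r"
    "\<bar>\<psi> t - (pi + 2 * \<tau>1 * (pi / 4))\<bar> \<le> r" "\<bar>z t - \<tau>2 * sqrt (- d / 2)\<bar> \<le> r"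
    by (auto simp: dist_real_def)
  then show ?thesis
    using \<sigma> r pi_gt3 by auto
qed

theorem theorem11:
  fixes c d \<alpha>0 :: real and \<gamma> :: "real \<Rightarrow> real"
  assumes "c > 0" and "d < 0"
    and "\<forall>t. \<gamma> (t + 1) = \<gamma> t"
    and "C2_real \<gamma>"
    and "(\<integral>t. \<gamma> (t + \<alpha>0) * sech (2 * c * t) \<partial>lborel) = 0"
    and "(\<integral>t. deriv \<gamma> (t + \<alpha>0) * sech (2 * c * t) \<partial>lborel) \<noteq> 0"
  shows "\<exists>C0>0. \<forall>C\<ge>C0. \<exists>\<delta>>0. \<forall>\<epsilon>. \<epsilon> \<noteq> 0 \<and> \<bar>\<epsilon>\<bar> < \<delta> \<longrightarrow>
    (\<forall>\<sigma>1\<in>{1, -1}. \<forall>\<sigma>2\<in>{1, -1}.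
       \<exists>!s. global_solution c \<gamma> \<epsilon> s \<and> on_level_set c d s \<and>
            uniformly_within (C * \<bar>\<epsilon>\<bar>) (leading_term c d \<alpha>0 \<sigma>1 \<sigma>2) s) \<and>
    card {s. global_solution c \<gamma> \<epsilon> s \<and> on_level_set c d s \<and> bounded_solution s \<and>
             (\<exists>\<sigma>1\<in>{1, -1}. \<exists>\<sigma>2\<in>{1, -1}.
                uniformly_within (C * \<bar>\<epsilon>\<bar>) (leading_term c d \<alpha>0 \<sigma>1 \<sigma>2) s)} = 4"
proof -
  let ?good = "\<lambda>C \<epsilon> \<sigma>1 \<sigma>2 s. global_solution c \<gamma> \<epsilon> s \<and> on_level_set c d s \<and>
            uniformly_within (C * \<bar>\<epsilon>\<bar>) (leading_term c d \<alpha>0 \<sigma>1 \<sigma>2) s"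
  define S :: "(real \<times> real) set" where "S = {1, -1} \<times> {1, -1}"
  have S: "finite S" "S \<noteq> {}" "card S = 4"
    by (auto simp: S_def card_cartesian_product)
  have "\<forall>p\<in>S. \<exists>C0>0. \<forall>C\<ge>C0. \<exists>\<delta>>0. \<forall>\<epsilon>. \<epsilon> \<noteq> 0 \<and> \<bar>\<epsilon>\<bar> < \<delta> \<longrightarrow> (\<exists>!s. ?good C \<epsilon> (fst p) (snd p) s)"
    using heteroclinic_solution_exists_unique [OF assms] by (simp add: S_def)
  then obtain C0 where C0: "\<forall>p\<in>S. C0 p > 0 \<and> (\<forall>C\<ge>C0 p. \<exists>\<delta>>0. \<forall>\<epsilon>. \<epsilon> \<noteq> 0 \<and> \<bar>\<epsilon>\<bar> < \<delta> \<longrightarrow> (\<exists>!s. ?good C \<epsilon> (fst p) (snd p) s))"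
    by (rule bchoice [THEN exE])
  define Cm where "Cm = Max (C0 ` S)"
  have Cm: "C0 p \<le> Cm" if "p \<in> S" for p
    using S that by (simp add: Cm_def)
  show ?thesis
  proof (rule exI [of _ Cm], rule conjI, goal_cases)
    case 1
    have "(1, 1) \<in> S" by (simp add: S_def)
    then show ?case
      using C0 Cm less_le_trans by blast
  next
    case 2
    show ?case
    proof (intro allI impI)
      fix C assume C: "Cm \<le> C"
      then have "\<forall>p\<in>S. \<exists>\<delta>>0. \<forall>\<epsilon>. \<epsilon> \<noteq> 0 \<and> \<bar>\<epsilon>\<bar> < \<delta> \<longrightarrow> (\<exists>!s. ?good C \<epsilon> (fst p) (snd p) s)"
        using C0 Cm order_trans by meson
      then obtain \<delta>0 where \<delta>0: "\<forall>p\<in>S. \<delta>0 p > 0 \<and> (\<forall>\<epsilon>. \<epsilon> \<noteq> 0 \<and> \<bar>\<epsilon>\<bar> < \<delta>0 p \<longrightarrow> (\<exists>!s. ?good C \<epsilon> (fst p) (snd p) s))"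
        by (rule bchoice [THEN exE])
      have Cpos: "C > 0"
        using C0 Cm C S(2) by (metis all_not_in_conv less_le_trans order_trans)
      \<comment> \<open>The separation threshold: for \<open>C * |\<epsilon>| < m\<close> no
        solution is close to two different leading terms, hence \<open>m / C\<close> in the choice
        of \<delta>.\<close>
      define m where "m = min 1 (sqrt (- d / 2))"
      have m: "m > 0"
        using assms(2) by (simp add: m_def)
      define \<delta> where "\<delta> = min (Min (\<delta>0 ` S)) (m / C)"
      show "\<exists>\<delta>>0. \<forall>\<epsilon>. \<epsilon> \<noteq> 0 \<and> \<bar>\<epsilon>\<bar> < \<delta> \<longrightarrow>
        (\<forall>\<sigma>1\<in>{1, -1}. \<forall>\<sigma>2\<in>{1, -1}. \<exists>!s. ?good C \<epsilon> \<sigma>1 \<sigma>2 s) \<and>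
        card {s. global_solution c \<gamma> \<epsilon> s \<and> on_level_set c d s \<and> bounded_solution s \<and>
             (\<exists>\<sigma>1\<in>{1, -1}. \<exists>\<sigma>2\<in>{1, -1}.
                uniformly_within (C * \<bar>\<epsilon>\<bar>) (leading_term c d \<alpha>0 \<sigma>1 \<sigma>2) s)} = 4"
      proof (rule exI [of _ \<delta>], rule conjI, goal_cases)
        case 1
        show ?case
          using S \<delta>0 m Cpos by (simp add: \<delta>_def)
      next
        case 2
        show ?case
        proof (intro allI impI)
          fix \<epsilon> assume "\<epsilon> \<noteq> 0 \<and> \<bar>\<epsilon>\<bar> < \<delta>"
          then have e: "\<epsilon> \<noteq> 0" "\<And>p. p \<in> S \<Longrightarrow> \<bar>\<epsilon>\<bar> < \<delta>0 p" "C * \<bar>\<epsilon>\<bar> < m"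
            using S Cpos by (simp_all add: \<delta>_def pos_less_divide_eq mult.commute)
          have un: "\<exists>!s. ?good C \<epsilon> (fst p) (snd p) s" if "p \<in> S" for p
            using \<delta>0 [rule_format, OF that] e(1) e(2) [OF that] by blast
          define f where "f p = (THE s. ?good C \<epsilon> (fst p) (snd p) s)" for p
          have f: "?good C \<epsilon> (fst p) (snd p) (f p)" if "p \<in> S" for p
            unfolding f_def by (rule theI' [OF un [OF that]])
          have f_unique: "s = f p" if "p \<in> S" "?good C \<epsilon> (fst p) (snd p) s" for p s
            using un [OF that(1)] f [OF that(1)] that(2) by (elim ex1E) metis
          have "inj_on f S"
          proof (rule inj_onI)
            fix p q assume pq: "p \<in> S" "q \<in> S" "f p = f q"
            then have "uniformly_within (C * \<bar>\<epsilon>\<bar>) (leading_term c d \<alpha>0 (fst p) (snd p)) (f p)"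
              "uniformly_within (C * \<bar>\<epsilon>\<bar>) (leading_term c d \<alpha>0 (fst q) (snd q)) (f p)"
              using f [OF pq(1)] f [OF pq(2)] by auto
            then show "p = q"
              using leading_terms_apart [OF assms(1,2), of "fst p" "snd p" "fst q" "snd q" "C * \<bar>\<epsilon>\<bar>" \<alpha>0 "f p"] pq(1,2) e(3)
              by (auto simp: S_def m_def prod_eq_iff)
          qed
          \<comment> \<open>Closeness on the level set already implies boundedness, so the counted
            set is the injective image of the four sign pairs.\<close>
          moreover have "{s. global_solution c \<gamma> \<epsilon> s \<and> on_level_set c d s \<and> bounded_solution s \<and>
             (\<exists>\<sigma>1\<in>{1, -1}. \<exists>\<sigma>2\<in>{1, -1}.
                uniformly_within (C * \<bar>\<epsilon>\<bar>) (leading_term c d \<alpha>0 \<sigma>1 \<sigma>2) s)} = f ` S" (is "?L = _")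
          proof (intro subset_antisym subsetI)
            fix s assume "s \<in> ?L"
            then obtain \<sigma>1 \<sigma>2 where "(\<sigma>1, \<sigma>2) \<in> S" "?good C \<epsilon> \<sigma>1 \<sigma>2 s"
              unfolding S_def by blast
            then show "s \<in> f ` S"
              using f_unique [of "(\<sigma>1, \<sigma>2)" s] by auto
          next
            fix s assume "s \<in> f ` S"
            then obtain p where p: "p \<in> S" "s = f p" by blast
            then show "s \<in> ?L"
              using f [OF p(1)] bounded_solution_of_close [of c d "f p"] by (cases p) (auto simp: S_def)
          qed
          ultimately have "card ?L = 4"
            using S(3) by (simp add: card_image)
          moreover have "\<forall>\<sigma>1\<in>{1, -1}. \<forall>\<sigma>2\<in>{1, -1}. \<exists>!s. ?good C \<epsilon> \<sigma>1 \<sigma>2 s"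
          proof (intro ballI)
            fix \<sigma>1 \<sigma>2 :: real assume "\<sigma>1 \<in> {1, -1}" "\<sigma>2 \<in> {1, -1}"
            then have "(\<sigma>1, \<sigma>2) \<in> S" unfolding S_def by blast
            from un [OF this] show "\<exists>!s. ?good C \<epsilon> \<sigma>1 \<sigma>2 s"
              by simp
          qed
          ultimately show "(\<forall>\<sigma>1\<in>{1, -1}. \<forall>\<sigma>2\<in>{1, -1}. \<exists>!s. ?good C \<epsilon> \<sigma>1 \<sigma>2 s) \<and> card ?L = 4"
            by blast
        qed
      qed
    qed
  qed
qed

end
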